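(* There is an $\mathsf{XP}$ algorithm for MatchingGap when parameterized by $|V(G)|/2-\beta(G)$. That is, there is an algorithm that, given a graph $G$ and a positive integer $k$, decides whether $\mu(G)\ge k$ and runs in polynomial time for every fixed value of $|V(G)|/2-\beta(G)$.
   Context: Graphs are finite, simple and undirected. $\nu(G)$ is the maximum size of a matching of $G$, $\beta(G)$ is the minimum size of an (inclusion-wise) maximal matching of $G$, and the matching gap of $G$ is $\mu(G)=\nu(G)-\beta(G)$. MatchingGap: given a graph $G$ and a positive integer $k$, decide whether $\mu(G)\ge k$. An $\mathsf{XP}$ algorithm for a parameterized problem is an algorithm solving it in polynomial time for every fixed value of the parameter; here the parameter of the instance $(G,k)$ is $|V(G)|/2-\beta(G)$ (it is not given as part of the input). *)

theory Defs
  imports Complex_Main "HOL-Library.Log_Nat" "HOL-Computational_Algebra.Polynomial"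
begin

section \<open>Matchings in finite simple graphs\<close>

text \<open>A graph is a pair of a vertex set and a set of edges, an edge being a two-element set of
  vertices.\<close>

type_synonym 'a graph = "'a set \<times> 'a set set"

definition simple_graph :: "'a graph \<Rightarrow> bool" where
  "simple_graph G \<longleftrightarrow> finite (fst G) \<and> (\<forall>e\<in>snd G. e \<subseteq> fst G \<and> card e = 2)"

definition matching :: "'a graph \<Rightarrow> 'a set set \<Rightarrow> bool" where
  "matching G M \<longleftrightarrow> M \<subseteq> snd G \<and> pairwise disjnt M"

definition maximal_matching :: "'a graph \<Rightarrow> 'a set set \<Rightarrow> bool" where
  "maximal_matching G M \<longleftrightarrow> matching G M \<and> (\<forall>M'. matching G M' \<and> M \<subseteq> M' \<longrightarrow> M' = M)"

definition matching_number :: "'a graph \<Rightarrow> nat" where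
  "matching_number G = Max (card ` {M. matching G M})"

definition min_maximal_matching_number :: "'a graph \<Rightarrow> nat" where
  "min_maximal_matching_number G = Min (card ` {M. maximal_matching G M})"

definition matching_gap :: "'a graph \<Rightarrow> int" where
  "matching_gap G = int (matching_number G) - int (min_maximal_matching_number G)"


section \<open>Random access machine with logarithmic cost\<close>

text \<open>Algorithms are structured programs for a random access machine: finitely many registers are
  named in the program, and an unbounded memory is addressed indirectly. All cells hold natural
  numbers. Time is measured by the logarithmic cost criterion: each number that is read, computed
  or used as an address is charged its length in binary. Polynomial time on this machine is the same
  as polynomial time on Turing machines. Subtraction is truncated at 0, and division by 0 yields 0.\<close>

datatype expr =
    Const nat
  | Reg nat
  | Mem expr
  | Add expr expr
  | Sub expr expr
  | Mult expr expr
  | Div expr expr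

datatype prog =
    Skip
  | Assign nat expr
  | Store expr expr
  | Seq prog prog
  | If expr prog prog
  | While expr prog

text \<open>A state consists of the contents of the registers and the contents of the memory.\<close>

type_synonym state = "(nat \<Rightarrow> nat) \<times> (nat \<Rightarrow> nat)"

definition bit_length :: "nat \<Rightarrow> nat" where
  "bit_length n = max 1 (floorlog 2 n)"

fun expr_val :: "expr \<Rightarrow> state \<Rightarrow> nat" where
  "expr_val (Const n) s = n"
| "expr_val (Reg r) s = fst s r"
| "expr_val (Mem a) s = snd s (expr_val a s)"
| "expr_val (Add a b) s = expr_val a s + expr_val b s"
| "expr_val (Sub a b) s = expr_val a s - expr_val b s"
| "expr_val (Mult a b) s = expr_val a s * expr_val b s"
| "expr_val (Div a b) s = expr_val a s div expr_val b s"

fun expr_cost :: "expr \<Rightarrow> state \<Rightarrow> nat" where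
  "expr_cost (Const n) s = bit_length n"
| "expr_cost (Reg r) s = bit_length (fst s r)"
| "expr_cost (Mem a) s = expr_cost a s + bit_length (expr_val (Mem a) s)"
| "expr_cost (Add a b) s = expr_cost a s + expr_cost b s + bit_length (expr_val (Add a b) s)"
| "expr_cost (Sub a b) s = expr_cost a s + expr_cost b s + bit_length (expr_val (Sub a b) s)"
| "expr_cost (Mult a b) s = expr_cost a s + expr_cost b s + bit_length (expr_val (Mult a b) s)"
| "expr_cost (Div a b) s = expr_cost a s + expr_cost b s + bit_length (expr_val (Div a b) s)"

text \<open>\<open>exec c s t s'\<close>: started in state \<open>s\<close>, the program \<open>c\<close> halts after time \<open>t\<close> in state \<open>s'\<close>.
  A condition counts as true iff its value is not 0.\<close>

inductive exec :: "prog \<Rightarrow> state \<Rightarrow> nat \<Rightarrow> state \<Rightarrow> bool" where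
  Skip: "exec Skip s 1 s"
| Assign: "exec (Assign r a) s (1 + expr_cost a s) ((fst s)(r := expr_val a s), snd s)"
| Store: "exec (Store a b) s (1 + expr_cost a s + expr_cost b s)
            (fst s, (snd s)(expr_val a s := expr_val b s))"
| Seq: "exec c1 s t1 s' \<Longrightarrow> exec c2 s' t2 s'' \<Longrightarrow> exec (Seq c1 c2) s (t1 + t2) s''"
| IfTrue: "expr_val a s \<noteq> 0 \<Longrightarrow> exec c1 s t s' \<Longrightarrow> exec (If a c1 c2) s (1 + expr_cost a s + t) s'"
| IfFalse: "expr_val a s = 0 \<Longrightarrow> exec c2 s t s' \<Longrightarrow> exec (If a c1 c2) s (1 + expr_cost a s + t) s'"
| WhileFalse: "expr_val a s = 0 \<Longrightarrow> exec (While a c) s (1 + expr_cost a s) s"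
| WhileTrue: "expr_val a s \<noteq> 0 \<Longrightarrow> exec c s t1 s' \<Longrightarrow> exec (While a c) s' t2 s''
    \<Longrightarrow> exec (While a c) s (1 + expr_cost a s + t1 + t2) s''"

text \<open>The machine is deterministic, so running time and final state are determined by the program
  and the initial state.\<close>

lemma exec_deterministic:
  "exec c s t s' \<Longrightarrow> exec c s u s'' \<Longrightarrow> u = t \<and> s'' = s'"
proof (induction arbitrary: u s'' rule: exec.induct)
  case Skip
  from Skip.prems show ?case by cases simp
next
  case Assign
  from Assign.prems show ?case by cases simp
next
  case Store
  from Store.prems show ?case by cases simp
next
  case Seq
  from Seq.prems show ?case by cases (use Seq.IH in blast)
next
  case IfTrue
  from IfTrue.prems show ?case by cases (use IfTrue.IH IfTrue.hyps in blast)+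
next
  case IfFalse
  from IfFalse.prems show ?case by cases (use IfFalse.IH IfFalse.hyps in blast)+
next
  case WhileFalse
  from WhileFalse.prems show ?case by cases (use WhileFalse.hyps in blast)+
next
  case WhileTrue
  from WhileTrue.prems show ?case by cases (use WhileTrue.IH WhileTrue.hyps(1) in blast)+
qed

text \<open>The input is a sequence of numbers, stored in memory from address 0 on; all other cells and
  all registers are 0 initially. The answer is read off from register 0.\<close>

definition init_state :: "nat list \<Rightarrow> state" where
  "init_state w = ((\<lambda>_. 0), (\<lambda>i. if i < length w then w ! i else 0))"

definition answers_in_time :: "prog \<Rightarrow> nat list \<Rightarrow> bool \<Rightarrow> nat \<Rightarrow> bool" where
  "answers_in_time A w b t \<longleftrightarrow> (\<exists>s'. exec A (init_state w) t s' \<and> (fst s' 0 \<noteq> 0 \<longleftrightarrow> b))"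

definition input_size :: "nat list \<Rightarrow> nat" where
  "input_size w = (\<Sum>x\<leftarrow>w. bit_length x)"


section \<open>XP algorithms\<close>

text \<open>A parameterized problem is given by its instances, the encodings of each instance as input
  (there may be several), the yes-instances and the parameter. The program is the same for all
  values of the parameter, which is not part of its input; the polynomial bounding the running time
  depends on the value of the parameter only.\<close>

definition xp_algorithm ::
  "prog \<Rightarrow> 'i set \<Rightarrow> ('i \<Rightarrow> nat list set) \<Rightarrow> ('i \<Rightarrow> bool) \<Rightarrow> ('i \<Rightarrow> 'p) \<Rightarrow> bool" where
  "xp_algorithm A instances encodings yes param \<longleftrightarrow>
     (\<forall>p. \<exists>q :: nat poly. \<forall>x\<in>instances. param x = p \<longrightarrow>
        (\<forall>w\<in>encodings x. \<exists>t \<le> poly q (input_size w). answers_in_time A w (yes x) t))"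


section \<open>The problem MatchingGap\<close>

definition matching_gap_instances :: "('a graph \<times> nat) set" where
  "matching_gap_instances = {(G, k). simple_graph G \<and> k \<ge> 1}"

text \<open>The number of vertices, the number \<open>k\<close>, and the adjacency matrix row by row, for an arbitrary
  enumeration of the vertices.\<close>

definition matching_gap_encodings :: "'a graph \<times> nat \<Rightarrow> nat list set" where
  "matching_gap_encodings = (\<lambda>(G, k).
     {[length vs, k] @ concat (map (\<lambda>u. map (\<lambda>v. if {u, v} \<in> snd G then 1 else 0) vs) vs) |vs.
        distinct vs \<and> set vs = fst G})"

definition matching_gap_yes :: "'a graph \<times> nat \<Rightarrow> bool" where
  "matching_gap_yes = (\<lambda>(G, k). matching_gap G \<ge> int k)"

definition matching_gap_param :: "'a graph \<times> nat \<Rightarrow> real" where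
  "matching_gap_param = (\<lambda>(G, k). real (card (fst G)) / 2 - real (min_maximal_matching_number G))"

end

theory Submission
  imports Defs
begin

text \<open>Call a vertex \<^emph>\<open>exposed\<close> by a matching if no edge of the matching covers it. A matching with
  \<open>c\<close> edges exposes \<open>|V| - 2 * c\<close> vertices, and it is maximal iff the exposed vertices are
  independent. Let \<open>lo\<close> and \<open>hi\<close> be the least and the greatest number of vertices exposed by a
  maximal matching. Then \<open>2 * \<nu> + lo = |V|\<close> and \<open>2 * \<beta> + hi = |V|\<close>, so the matching gap is at least
  \<open>k\<close> iff \<open>lo + 2 * k \<le> hi\<close>, and \<open>hi\<close> is twice the parameter. It remains to compute \<open>lo\<close> and \<open>hi\<close> in
  time polynomial for every fixed value of \<open>hi\<close>.

  The algorithm is a brute force local search around one greedy maximal matching \<open>m\<close>. A move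
  forces an edge into the matching and removes the edges that it meets. For \<open>D = 0, 1, 2, \<dots>\<close> the
  algorithm tries all sequences of \<open>L = 72 * 8 ^ (48 * D + 96)\<close> moves from \<open>m\<close>, completes every result
  greedily to a maximal matching and records the least and the greatest number of exposed vertices.
  It stops as soon as the greatest number is at most \<open>D\<close>, which happens for some \<open>D \<le> hi\<close>. There are
  \<open>|V| ^ (2 * L)\<close> sequences, a polynomial number for fixed \<open>hi\<close>.

  The stopping rule is sound because of \<open>all_exposures_reached\<close>: if \<open>L\<close> moves and a completion never
  expose more than \<open>D\<close> vertices, they produce every number of vertices that a maximal matching can
  expose. Otherwise choose a maximal matching \<open>ms\<close> with a number that is not produced, as close to
  \<open>m\<close> as possible. By its choice, the vertices where \<open>m\<close> and \<open>ms\<close> differ lie on few alternating paths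
  that start at exposed vertices. If all of them are short, \<open>L\<close> moves lead from \<open>m\<close> to \<open>ms\<close>
  (\<open>many_moved\<close>). So there is a long alternating path \<open>a 0, b 0, a 1, b 1, \<dots>\<close> on which \<open>m\<close> matches
  \<open>a i\<close> with \<open>b i\<close> and \<open>ms\<close> matches \<open>b i\<close> with \<open>a (i + 1)\<close>. Chords that shorten this path would bring
  \<open>ms\<close> closer to \<open>m\<close>; hence \<open>b i\<close> and \<open>a j\<close> are not adjacent for \<open>j > i + 1\<close>, and certain pairs of
  crossing chords are excluded (\<open>no_forward_chord\<close>, \<open>no_crossing_chords\<close>). Cut the path into blocks.
  Inside each block one or two edges can be exchanged so that two nonadjacent vertices, some \<open>a i\<close>
  and some \<open>b j\<close>, become exposed (\<open>gadget_exists\<close>). By Ramsey's theorem there are \<open>2 * D + 4\<close> blocks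
  in which the adjacency of these vertices depends only on the order of the blocks. In each of the
  possible patterns one can match some of the exposed vertices with each other so that more than
  \<open>2 * D\<close> independent ones remain (\<open>no_long_segment\<close>). A completion covers at most \<open>D\<close> of them, since
  each of its edges meets a vertex exposed by \<open>m\<close>. So more than \<open>D\<close> vertices stay exposed, a
  contradiction.

  For the running time, \<open>runs\<close> counts the steps of a program while all contents of registers and
  memory stay below a bound \<open>B\<close>. A step then costs \<open>O(bit_length B)\<close>, and for fixed \<open>hi\<close> both the number
  of steps and \<open>bit_length B\<close> are polynomial in the size of the input (\<open>time_bound_correct\<close>).\<close>

section \<open>Homogeneous sequences\<close>

text \<open>Take the least element of \<open>T\<close>, keep those of the remaining elements that have the most
  frequent colour with it, and repeat. Each round divides the number of elements by at most the number
  of colours. The colour of a pair then depends only on its smaller element.\<close>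

lemma end_homogeneous_list:
  fixes col :: "nat \<Rightarrow> nat \<Rightarrow> 'c::finite"
  assumes "2 \<le> card (UNIV :: 'c set)" "finite T" "card (UNIV :: 'c set) ^ n \<le> card T"
  shows "\<exists>xs \<chi>. length xs = n \<and> set xs \<subseteq> T \<and> sorted_wrt (\<lambda>s t. s < t \<and> col s t = \<chi> s) xs"
  using assms(2,3)
proof (induction n arbitrary: T)
  case 0
  show ?case by (rule exI[of _ "[]"]) simp
next
  case (Suc n)
  define c where "c = card (UNIV :: 'c set)"
  have c2: "2 \<le> c" using assms(1) by (simp add: c_def)
  have "0 < c ^ Suc n" using c2 by simp
  hence "T \<noteq> {}" using Suc.prems c_def by auto
  define x where "x = Min T"
  have x: "x \<in> T" "\<And>t. t \<in> T - {x} \<Longrightarrow> x < t"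
    using Suc.prems(1) \<open>T \<noteq> {}\<close> by (auto simp: x_def order.strict_iff_order)
  have "\<exists>k. c ^ n \<le> card {t \<in> T - {x}. col x t = k}"
  proof (rule ccontr)
    assume neg: "\<not> ?thesis"
    have le: "card {t \<in> T - {x}. col x t = k} \<le> c ^ n - 1" for k
    proof -
      have "card {t \<in> T - {x}. col x t = k} < c ^ n" using neg by (simp add: not_le)
      thus ?thesis by linarith
    qed
    have "T - {x} = (\<Union>k. {t \<in> T - {x}. col x t = k})" by auto
    hence "card (T - {x}) \<le> (\<Sum>k\<in>UNIV. card {t \<in> T - {x}. col x t = k})"
      by (metis card_UN_le finite)
    also have "\<dots> \<le> (\<Sum>k\<in>(UNIV::'c set). c ^ n - 1)" by (intro sum_mono le)
    also have "\<dots> = c * (c ^ n - 1)" by (simp add: c_def)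
    finally have "card T - 1 \<le> c ^ Suc n - c" using x(1) Suc.prems(1) by (simp add: diff_mult_distrib2)
    moreover have "c ^ Suc n \<le> card T" using Suc.prems c_def by simp
    moreover have "c \<le> c ^ Suc n" using c2 by simp
    ultimately show False using c2 by linarith
  qed
  then obtain k where k: "c ^ n \<le> card {t \<in> T - {x}. col x t = k}" by blast
  obtain ys \<chi> where ys: "length ys = n" "set ys \<subseteq> {t \<in> T - {x}. col x t = k}"
    "sorted_wrt (\<lambda>s t. s < t \<and> col s t = \<chi> s) ys"
    using Suc.IH[OF _ k[unfolded c_def]] Suc.prems(1) by auto
  have "sorted_wrt (\<lambda>s t. s < t \<and> col s t = (\<chi>(x := k)) s) ys"
    by (rule sorted_wrt_mono_rel[OF _ ys(3)]) (use ys(2) in auto)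
  hence "sorted_wrt (\<lambda>s t. s < t \<and> col s t = (\<chi>(x := k)) s) (x # ys)"
    using ys(2) x(2) by auto
  moreover have "length (x # ys) = Suc n" "set (x # ys) \<subseteq> T" using ys x(1) by auto
  ultimately show ?case by blast
qed

text \<open>A Ramsey bound that the program can compute: an end homogeneous list that is longer by
  a factor of the number of colours has, by the pigeonhole principle, \<open>q\<close> elements with equal \<open>\<chi>\<close>.\<close>

lemma ramsey_list:
  fixes col :: "nat \<Rightarrow> nat \<Rightarrow> 'c::finite"
  assumes "2 \<le> card (UNIV :: 'c set)" "card (UNIV :: 'c set) ^ (card (UNIV :: 'c set) * q) \<le> r"
  shows "\<exists>ts k. length ts = q \<and> set ts \<subseteq> {..<r} \<and> sorted_wrt (\<lambda>s t. s < t \<and> col s t = k) ts"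
proof -
  obtain xs \<chi> where xs: "length xs = card (UNIV :: 'c set) * q" "set xs \<subseteq> {..<r}"
    "sorted_wrt (\<lambda>s t. s < t \<and> col s t = \<chi> s) xs"
    using end_homogeneous_list[of "{..<r}" "card (UNIV :: 'c set) * q" col] assms by auto
  have "distinct xs"
    using xs(3) by (metis (no_types, lifting) sorted_wrt_mono_rel strict_sorted_iff)
  have "\<exists>k. q \<le> length (filter (\<lambda>x. \<chi> x = k) xs)"
  proof (cases "q = 0")
    case False
    show ?thesis
    proof (rule ccontr)
      assume *: "\<not> ?thesis"
      have "length xs = (\<Sum>k\<in>UNIV. length (filter (\<lambda>x. \<chi> x = k) xs))"
      proof (induction xs)
        case (Cons a xs)
        have "(\<Sum>k\<in>UNIV. length (filter (\<lambda>x. \<chi> x = k) (a # xs)))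
            = (\<Sum>k\<in>UNIV. (if \<chi> a = k then 1 else 0) + length (filter (\<lambda>x. \<chi> x = k) xs))"
          by (intro sum.cong) auto
        thus ?case using Cons by (simp add: sum.distrib)
      qed simp
      also have "\<dots> < (\<Sum>k\<in>(UNIV::'c set). q)"
        using * by (intro sum_strict_mono) (auto simp: not_le)
      also have "\<dots> = card (UNIV :: 'c set) * q" by simp
      finally show False using xs(1) by simp
    qed
  qed simp
  then obtain k where k: "q \<le> length (filter (\<lambda>x. \<chi> x = k) xs)" ..
  define ts where "ts = take q (filter (\<lambda>x. \<chi> x = k) xs)"
  have "sorted_wrt (\<lambda>s t. s < t \<and> col s t = \<chi> s) ts"
    unfolding ts_def by (intro sorted_wrt_take sorted_wrt_filter xs)
  moreover have sub: "set ts \<subseteq> set (filter (\<lambda>x. \<chi> x = k) xs)"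
    unfolding ts_def by (rule set_take_subset)
  ultimately have "sorted_wrt (\<lambda>s t. s < t \<and> col s t = k) ts"
    by (elim sorted_wrt_mono_rel[rotated]) auto
  moreover have "length ts = q" using k by (simp add: ts_def)
  moreover have "set ts \<subseteq> {..<r}" using sub xs(2) by auto
  ultimately show ?thesis by blast
qed

section \<open>Matchings as involutions\<close>

text \<open>A matching is represented by the involution that exchanges the ends of its edges and
  fixes the other vertices. This is the move that forces the edge between \<open>x\<close> and \<open>y\<close>: the former
  partners of \<open>x\<close> and \<open>y\<close> become exposed. The order of the updates matters if \<open>x\<close> or \<open>y\<close> was exposed or
  if they were partners already.\<close>

definition rematch :: "'a \<Rightarrow> 'a \<Rightarrow> ('a \<Rightarrow> 'a) \<Rightarrow> 'a \<Rightarrow> 'a" where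
  "rematch x y m = m(m x := m x, m y := m y, x := y, y := x)"

locale finite_graph =
  fixes V :: "'a set" and adj :: "'a \<Rightarrow> 'a \<Rightarrow> bool"
  assumes finite_V: "finite V" and adj_sym: "adj x y \<Longrightarrow> adj y x" and adj_irrefl: "\<not> adj x x"
begin

definition mating :: "('a \<Rightarrow> 'a) \<Rightarrow> bool" where
  "mating m \<longleftrightarrow> (\<forall>x\<in>V. m x \<in> V \<and> m (m x) = x \<and> (m x = x \<or> adj x (m x)))"

definition exposed :: "('a \<Rightarrow> 'a) \<Rightarrow> 'a set" where
  "exposed m = {x\<in>V. m x = x}"

definition maximal_mating :: "('a \<Rightarrow> 'a) \<Rightarrow> bool" where
  "maximal_mating m \<longleftrightarrow> mating m \<and> (\<forall>x\<in>exposed m. \<forall>y\<in>exposed m. \<not> adj x y)"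

definition completion :: "(('a \<Rightarrow> 'a) \<Rightarrow> 'a \<Rightarrow> 'a) \<Rightarrow> bool" where
  "completion g \<longleftrightarrow> (\<forall>m. mating m \<longrightarrow> maximal_mating (g m) \<and> (\<forall>x\<in>V. m x \<noteq> x \<longrightarrow> g m x = m x))"

definition rematches :: "('a \<times> 'a) list \<Rightarrow> ('a \<Rightarrow> 'a) \<Rightarrow> 'a \<Rightarrow> 'a" where
  "rematches N = fold (\<lambda>(x, y) m. if adj x y then rematch x y m else m) N"

lemma matingD:
  assumes "mating m" "x \<in> V"
  shows "m x \<in> V" "m (m x) = x" "m x \<noteq> x \<Longrightarrow> adj x (m x)"
  using assms by (auto simp: mating_def)

lemma mating_rematch:
  assumes "mating m" "x \<in> V" "y \<in> V" "adj x y"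
  shows "mating (rematch x y m)"
proof -
  have "x \<noteq> y" "adj y x" using assms(4) adj_irrefl adj_sym by auto
  show ?thesis
    unfolding mating_def rematch_def
  proof (intro ballI conjI)
    fix z assume z: "z \<in> V"
    note d = matingD[OF assms(1) z] matingD[OF assms(1,2)] matingD[OF assms(1,3)]
    show "(m(m x := m x, m y := m y, x := y, y := x)) z \<in> V" using d assms z by auto
    show "(m(m x := m x, m y := m y, x := y, y := x)) ((m(m x := m x, m y := m y, x := y, y := x)) z) = z"
      using d(2,5,8) \<open>x \<noteq> y\<close> by (smt (verit) fun_upd_apply)
    show "(m(m x := m x, m y := m y, x := y, y := x)) z = z \<or>
        adj z ((m(m x := m x, m y := m y, x := y, y := x)) z)"
      using d assms(4) \<open>adj y x\<close> by auto
  qed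
qed

lemma mating_rematches:
  assumes "mating m" "set N \<subseteq> V \<times> V"
  shows "mating (rematches N m)"
  using assms
proof (induction N arbitrary: m)
  case (Cons p N)
  obtain x y where p: "p = (x, y)" by force
  have "mating (if adj x y then rematch x y m else m)"
    using Cons.prems mating_rematch[of m x y] by (simp add: p)
  with Cons.IH[OF this] Cons.prems(2) show ?case by (simp add: rematches_def p)
qed (simp add: rematches_def)

text \<open>The edges between \<open>z\<close> and \<open>h z\<close> are disjoint, so forcing one of them does not remove the
  ones that were forced before.\<close>

lemma impose_matching:
  assumes m: "mating m" and fin: "finite S" and "S \<subseteq> V"
    and h: "\<And>z. z \<in> S \<Longrightarrow> h z \<in> S \<and> h (h z) = z \<and> adj z (h z)"
  shows "\<exists>N. length N \<le> card S \<and> set N \<subseteq> V \<times> V \<and>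
    (\<forall>z\<in>V. rematches N m z = (if z \<in> S then h z else if m z \<in> S then z else m z))"
  using fin assms(3) h
proof (induction "card S" arbitrary: S rule: less_induct)
  case less
  show ?case
  proof (cases "S = {}")
    case True
    thus ?thesis by (intro exI[of _ "[]"]) (simp add: rematches_def)
  next
    case False
    then obtain x where x: "x \<in> S" by auto
    have hx: "h x \<in> S" "h (h x) = x" "adj x (h x)" "h x \<noteq> x"
      using less.prems(3)[OF x] adj_irrefl[of x] by auto
    define S' where "S' = S - {x, h x}"
    have S': "z \<in> S' \<Longrightarrow> h z \<in> S' \<and> h (h z) = z \<and> adj z (h z)" for z
      using less.prems(3)[of z] hx by (auto simp: S'_def)
    have "card S' < card S" unfolding S'_def using x less.prems(1)
      by (intro psubset_card_mono) auto
    have "finite S'" "S' \<subseteq> V" using less.prems by (auto simp: S'_def)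
    obtain N where N: "length N \<le> card S'" "set N \<subseteq> V \<times> V"
      and Nm: "\<And>z. z \<in> V \<Longrightarrow> rematches N m z = (if z \<in> S' then h z else if m z \<in> S' then z else m z)"
      using less.hyps[OF \<open>card S' < card S\<close> \<open>finite S'\<close> \<open>S' \<subseteq> V\<close> S'] by blast
    let ?N = "N @ [(x, h x)]"
    have "length ?N \<le> card S" using N(1) \<open>card S' < card S\<close> by simp
    moreover have xV: "x \<in> V" "h x \<in> V" using less.prems(2) x hx by auto
    moreover have "rematches ?N m = rematch x (h x) (rematches N m)"
      using hx by (simp add: rematches_def)
    moreover have "rematch x (h x) (rematches N m) z = (if z \<in> S then h z else if m z \<in> S then z else m z)"
      if z: "z \<in> V" for z
    proof -
      have x': "rematches N m x = (if m x \<in> S' then x else m x)"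
           "rematches N m (h x) = (if m (h x) \<in> S' then h x else m (h x))"
        using Nm[OF xV(1)] Nm[OF xV(2)] by (auto simp: S'_def)
      note d = matingD[OF m z] matingD[OF m xV(1)] matingD[OF m xV(2)]
      show ?thesis
      proof (cases "z \<in> S")
        case True
        show ?thesis
        proof (cases "z = x \<or> z = h x")
          case True
          thus ?thesis using hx x by (elim disjE) (simp_all add: rematch_def)
        next
          case False
          hence zS: "z \<in> S'" using True by (auto simp: S'_def)
          have "rematches N m x \<noteq> z" "rematches N m (h x) \<noteq> z"
            using x' zS False by (auto split: if_splits)
          thus ?thesis using False True zS Nm[OF z] by (auto simp: rematch_def)
        qed
      next
        case False
        hence f: "z \<noteq> x" "z \<noteq> h x" "z \<notin> S'" using x hx by (auto simp: S'_def)
        show ?thesis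
        proof (cases "m z = x \<or> m z = h x")
          case True
          hence "rematches N m x = z \<or> rematches N m (h x) = z"
            using x' d f by auto
          moreover have "m z \<in> S" using True x hx by auto
          ultimately show ?thesis using f False by (elim disjE) (simp_all add: rematch_def)
        next
          case nm: False
          hence "rematches N m x \<noteq> z" "rematches N m (h x) \<noteq> z"
            using x' f d by (auto split: if_splits)
          moreover have "m z \<in> S \<longleftrightarrow> m z \<in> S'" using nm by (auto simp: S'_def)
          ultimately show ?thesis using False f Nm[OF z] by (simp add: rematch_def)
        qed
      qed
    qed
    ultimately show ?thesis using N(2) by (intro exI[of _ ?N]) auto
  qed
qed

lemma completion_of_maximal:
  assumes g: "completion g" and m: "maximal_mating m"
  shows "exposed (g m) = exposed m"
proof -
  have m': "mating m" using m by (simp add: maximal_mating_def)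
  have gm: "mating (g m)" "\<And>x. x \<in> V \<Longrightarrow> m x \<noteq> x \<Longrightarrow> g m x = m x"
    using g m' by (auto simp: completion_def maximal_mating_def)
  have "g m x = x" if x: "x \<in> V" "m x = x" for x
  proof (rule ccontr)
    assume ne: "g m x \<noteq> x"
    define y where "y = g m x"
    have y: "y \<in> V" "g m y = x" "adj x y"
      using matingD[OF gm(1) x(1)] ne by (auto simp: y_def)
    have "m y = y" using gm(2)[OF y(1)] y x matingD[OF m' y(1)] by metis
    thus False using y x m by (auto simp: maximal_mating_def exposed_def)
  qed
  moreover have "m x = x" if "x \<in> V" "g m x = x" for x
    using gm(2)[OF that(1)] that(2) by force
  ultimately show ?thesis by (auto simp: exposed_def)
qed

text \<open>An edge that the completion adds joins two vertices exposed by \<open>m\<close>. As \<open>I\<close> is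
  independent, one of them is in \<open>U\<close>; so at most \<open>card U\<close> vertices of \<open>I\<close> get covered.\<close>

lemma exposed_completion_ge:
  assumes g: "completion g" and m: "mating m" and I: "I \<subseteq> exposed m"
    and U: "exposed m \<subseteq> I \<union> U" "finite U" and indep: "\<And>x y. x \<in> I \<Longrightarrow> y \<in> I \<Longrightarrow> \<not> adj x y"
  shows "card I \<le> card (exposed (g m)) + card U"
proof -
  have gm: "mating (g m)" "\<And>x. x \<in> V \<Longrightarrow> m x \<noteq> x \<Longrightarrow> g m x = m x"
    using g m by (auto simp: completion_def maximal_mating_def)
  have IV: "I \<subseteq> V" "\<And>x. x \<in> I \<Longrightarrow> m x = x" using I by (auto simp: exposed_def)
  have "g m x \<in> U" if x: "x \<in> I" "g m x \<noteq> x" for x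
  proof -
    define y where "y = g m x"
    have xV: "x \<in> V" using x IV by auto
    have y: "y \<in> V" "g m y = x" "adj x y" using matingD[OF gm(1) xV] x by (auto simp: y_def)
    have "m y = y" using gm(2)[OF y(1)] y IV(2)[OF x(1)] matingD[OF m y(1)] by metis
    thus ?thesis using y U indep[OF x(1), of y] by (auto simp: exposed_def y_def)
  qed
  moreover have "inj_on (g m) I" 
    by (rule inj_on_inverseI[of _ "g m"]) (use IV(1) matingD(2)[OF gm(1)] in blast)
  ultimately have "card {x\<in>I. g m x \<noteq> x} \<le> card U"
    using U(2) by (intro card_inj_on_le[of "g m"]) (auto intro: inj_on_subset)
  moreover have "card {x\<in>I. g m x = x} \<le> card (exposed (g m))"
    using IV finite_V by (intro card_mono) (auto simp: exposed_def)
  moreover have "card I = card {x\<in>I. g m x \<noteq> x} + card {x\<in>I. g m x = x}"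
    using finite_subset[OF IV(1) finite_V] by (subst card_Un_disjoint[symmetric]) (auto intro: arg_cong[of _ _ card])
  ultimately show ?thesis by linarith
qed

end

section \<open>Shortcuts between two maximal matchings\<close>

lemma pairing_involution:
  fixes f g :: "nat \<Rightarrow> 'a"
  assumes "inj_on f A" "inj_on g A" "f ` A \<inter> g ` A = {}"
  shows "\<exists>k. \<forall>i\<in>A. k (f i) = g i \<and> k (g i) = f i"
proof -
  define k where "k z = (if z \<in> f ` A then g (the_inv_into A f z) else f (the_inv_into A g z))" for z
  have "k (f i) = g i \<and> k (g i) = f i" if "i \<in> A" for i
    using assms that by (auto simp: k_def the_inv_into_f_f)
  thus ?thesis by blast
qed

text \<open>The setting of an indirect proof. No completed sequence of at most \<open>L\<close> moves from \<open>m\<close>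
  exposes more than \<open>D\<close> vertices, and none exposes as many as \<open>ms\<close>. Among the maximal matchings whose
  number of exposed vertices is not reached in this way, \<open>ms\<close> differs from \<open>m\<close> at the fewest vertices.\<close>

locale closest_unreached = finite_graph V adj
  for V :: "'a set" and adj :: "'a \<Rightarrow> 'a \<Rightarrow> bool" +
  fixes g :: "('a \<Rightarrow> 'a) \<Rightarrow> 'a \<Rightarrow> 'a" and m ms :: "'a \<Rightarrow> 'a" and L D :: nat
  assumes completion_g: "completion g"
    and m_max: "maximal_mating m" and ms_max: "maximal_mating ms"
    and reached_le: "\<And>N. length N \<le> L \<Longrightarrow> set N \<subseteq> V \<times> V \<Longrightarrow> card (exposed (g (rematches N m))) \<le> D"
    and unreached: "\<And>N. length N \<le> L \<Longrightarrow> set N \<subseteq> V \<times> V \<Longrightarrow>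
      card (exposed (g (rematches N m))) \<noteq> card (exposed ms)"
    and closest: "\<And>m'. maximal_mating m' \<Longrightarrow>
      card {x\<in>V. m x \<noteq> m' x} < card {x\<in>V. m x \<noteq> ms x} \<Longrightarrow>
      \<exists>N. length N \<le> L \<and> set N \<subseteq> V \<times> V \<and> card (exposed (g (rematches N m))) = card (exposed m')"
begin

abbreviation moved :: "'a set" where "moved \<equiv> {x\<in>V. m x \<noteq> ms x}"

lemma m_mating: "mating m" and ms_mating: "mating ms"
  using m_max ms_max by (auto simp: maximal_mating_def)

lemmas m_props = matingD[OF m_mating] and ms_props = matingD[OF ms_mating]

lemma card_exposed_m_le: "card (exposed m) \<le> D"
  using reached_le[of "[]"] completion_of_maximal[OF completion_g m_max] by (simp add: rematches_def)

lemma finite_exposed: "finite (exposed m')"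
  using finite_V by (simp add: exposed_def)

lemma closer_maximal:
  assumes "maximal_mating m'" "{x\<in>V. m x \<noteq> m' x} \<subset> moved"
  shows "card (exposed m') \<le> D" "card (exposed m') \<noteq> card (exposed ms)"
proof -
  have "card {x\<in>V. m x \<noteq> m' x} < card moved"
    using assms(2) finite_V by (intro psubset_card_mono) auto
  from closest[OF assms(1) this] reached_le unreached
  show "card (exposed m') \<le> D" "card (exposed m') \<noteq> card (exposed ms)" by metis+
qed

text \<open>Replacing \<open>ms\<close> by \<open>h\<close> on \<open>Z\<close> does not change the set of exposed vertices. So the result
  is again maximal and not reached, but it is closer to \<open>m\<close> because it agrees with \<open>m\<close> at \<open>z0\<close>.\<close>

lemma no_rewiring:
  assumes Z: "\<And>z. z \<in> Z \<Longrightarrow> z \<in> moved \<and> ms z \<in> Z \<and> ms z \<noteq> z"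
    and h: "\<And>z. z \<in> Z \<Longrightarrow> h z \<in> Z \<and> h (h z) = z \<and> adj z (h z)"
    and z0: "z0 \<in> Z" "h z0 = m z0"
  shows False
proof -
  define m' where "m' z = (if z \<in> Z then h z else ms z)" for z
  have notin: "ms z \<notin> Z" if "z \<in> V" "z \<notin> Z" for z
    using Z[of "ms z"] ms_props(2)[OF that(1)] that(2) by auto
  have ZV: "Z \<subseteq> V" using Z by auto
  have hne: "h z \<noteq> z" if "z \<in> Z" for z using h[OF that] adj_irrefl by metis
  have mat: "mating m'"
    unfolding mating_def
  proof (intro ballI)
    fix x assume x: "x \<in> V"
    show "m' x \<in> V \<and> m' (m' x) = x \<and> (m' x = x \<or> adj x (m' x))"
      using h[of x] ZV notin[OF x] ms_props[OF x] by (cases "x \<in> Z") (auto simp: m'_def)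
  qed
  have ex: "exposed m' = exposed ms"
    using hne Z by (auto simp: exposed_def m'_def)
  hence "maximal_mating m'" using mat ms_max by (simp add: maximal_mating_def)
  moreover have "{x\<in>V. m x \<noteq> m' x} \<subseteq> moved"
    using Z by (auto simp: m'_def split: if_splits)
  moreover have "z0 \<in> moved" "z0 \<notin> {x\<in>V. m x \<noteq> m' x}" using z0 Z[of z0] by (auto simp: m'_def)
  ultimately have "maximal_mating m'" "{x\<in>V. m x \<noteq> m' x} \<subset> moved" by blast+
  from closer_maximal(2)[OF this] show False using ex by simp
qed

text \<open>Replace \<open>ms\<close> by \<open>m\<close> on \<open>C\<close>. As \<open>m\<close> exposes no vertex of \<open>C\<close>, the exposed vertices are a
  subset of those of \<open>ms\<close>, hence independent. The result is a maximal matching closer to \<open>m\<close>, so the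
  number of its exposed vertices is reached: it is at most \<open>D\<close> and differs from that of \<open>ms\<close>.\<close>

lemma reset_closed_set:
  assumes C: "\<And>z. z \<in> C \<Longrightarrow> z \<in> V \<and> m z \<in> C \<and> ms z \<in> C"
    and noU: "C \<inter> exposed m = {}" and moved: "C \<inter> moved \<noteq> {}"
  shows "card (exposed ms - C) \<le> D" "C \<inter> exposed ms \<noteq> {}"
proof -
  define m' where "m' z = (if z \<in> C then m z else ms z)" for z
  have notin: "ms z \<notin> C" if "z \<in> V" "z \<notin> C" for z
    using C[of "ms z"] ms_props(2)[OF that(1)] that(2) by auto
  have mat: "mating m'"
    unfolding mating_def
  proof (intro ballI)
    fix x assume x: "x \<in> V"
    show "m' x \<in> V \<and> m' (m' x) = x \<and> (m' x = x \<or> adj x (m' x))"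
      using C[of x] notin[OF x] ms_props[OF x] m_props[OF x] by (cases "x \<in> C") (auto simp: m'_def)
  qed
  have ex: "exposed m' = exposed ms - C"
    using noU by (auto simp: exposed_def m'_def)
  hence "maximal_mating m'" using mat ms_max by (simp add: maximal_mating_def)
  moreover have "{x\<in>V. m x \<noteq> m' x} \<subset> moved"
    using moved by (auto simp: m'_def)
  ultimately have "card (exposed m') \<le> D" "card (exposed m') \<noteq> card (exposed ms)"
    using closer_maximal by blast+
  thus "card (exposed ms - C) \<le> D" "C \<inter> exposed ms \<noteq> {}"
    unfolding ex by (auto simp: Diff_triv inf_commute)
qed

end

text \<open>An alternating path \<open>a 0, b 0, a 1, b 1, \<dots>\<close> whose edges belong to \<open>m\<close> and \<open>ms\<close> in turn,
  with room for \<open>r\<close> blocks of four edges of \<open>m\<close> each. The bound on \<open>r\<close> is that of \<open>ramsey_list\<close> for eight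
  colours and \<open>2 * D + 4\<close> blocks.\<close>

locale long_segment = closest_unreached V adj g m ms L D
  for V :: "'a set" and adj :: "'a \<Rightarrow> 'a \<Rightarrow> bool" and g m ms L D +
  fixes a b :: "nat \<Rightarrow> 'a" and r :: nat
  assumes many_blocks: "8 ^ (8 * (2 * D + 4)) \<le> r" and r_le_L: "8 * r \<le> L"
    and a_V: "\<And>i. i < 4 * r \<Longrightarrow> a i \<in> V"
    and m_a: "\<And>i. i < 4 * r \<Longrightarrow> m (a i) = b i"
    and ms_b: "\<And>i. Suc i < 4 * r \<Longrightarrow> ms (b i) = a (Suc i)"
    and inj_a: "inj_on a {..<4 * r}" and inj_b: "inj_on b {..<4 * r}"
    and a_ne_b: "\<And>i j. i < 4 * r \<Longrightarrow> j < 4 * r \<Longrightarrow> a i \<noteq> b j"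
begin

lemma b_V: "i < 4 * r \<Longrightarrow> b i \<in> V" using m_a a_V m_props by metis
lemma m_b: "i < 4 * r \<Longrightarrow> m (b i) = a i" using m_a a_V m_props by metis
lemma ms_a: "Suc i < 4 * r \<Longrightarrow> ms (a (Suc i)) = b i"
  using ms_b b_V ms_props by (metis Suc_lessD)
lemma a_eq: "i < 4 * r \<Longrightarrow> j < 4 * r \<Longrightarrow> a i = a j \<longleftrightarrow> i = j"
  using inj_a by (auto simp: inj_on_def)
lemma b_eq: "i < 4 * r \<Longrightarrow> j < 4 * r \<Longrightarrow> b i = b j \<longleftrightarrow> i = j"
  using inj_b by (auto simp: inj_on_def)
lemma adj_ab: "i < 4 * r \<Longrightarrow> adj (a i) (b i)"
  using m_props(3)[of "a i"] a_V m_a a_ne_b by metis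
lemma adj_ba: "i < 4 * r \<Longrightarrow> adj (b i) (a i)" using adj_ab adj_sym by blast
lemma adj_b_Suc: "Suc i < 4 * r \<Longrightarrow> adj (b i) (a (Suc i))"
  using ms_props(3)[of "b i"] b_V ms_b a_ne_b by (metis Suc_lessD)

text \<open>The part of the path from \<open>b i\<close> to \<open>a l\<close>, which is a union of edges of \<open>ms\<close>.\<close>

definition seg :: "nat \<Rightarrow> nat \<Rightarrow> 'a set" where
  "seg i l = b ` {i..<l} \<union> a ` {Suc i..l}"

lemma seg_closed:
  assumes "l < 4 * r" "z \<in> seg i l"
  shows "z \<in> moved \<and> ms z \<in> seg i l \<and> ms z \<noteq> z"
proof -
  consider x where "z = b x" "i \<le> x" "x < l" | x where "z = a (Suc x)" "i \<le> x" "x < l"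
    using assms(2) unfolding seg_def by (auto simp: image_iff) (metis Suc_le_D Suc_le_mono Suc_le_eq)
  thus ?thesis
  proof cases
    case 1
    hence "Suc x < 4 * r" using assms(1) by simp
    moreover have "a (Suc x) \<in> seg i l" using 1 by (auto simp: seg_def)
    ultimately show ?thesis using 1 b_V[of x] m_b[of x] ms_b[of x] a_eq[of x "Suc x"] a_ne_b[of "Suc x" x]
      by auto
  next
    case 2
    hence "Suc x < 4 * r" using assms(1) by simp
    moreover have "b x \<in> seg i l" using 2 by (auto simp: seg_def)
    ultimately show ?thesis using 2 a_V[of "Suc x"] m_a[of "Suc x"] ms_a[of x] b_eq[of x "Suc x"] a_ne_b[of "Suc x" x]
      by auto
  qed
qed

text \<open>Such a chord is a shortcut: use it in place of the part of \<open>ms\<close> from \<open>b i\<close> to \<open>a j\<close>, and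
  match the vertices in between as \<open>m\<close> does.\<close>

lemma no_forward_chord:
  assumes ij: "Suc i < j" "j < 4 * r"
  shows "\<not> adj (b i) (a j)"
proof
  assume adj: "adj (b i) (a j)"
  define h where "h z = (if z = b i then a j else if z = a j then b i else m z)" for z
  have ba: "b i \<noteq> a j" "a j \<noteq> b i" using a_ne_b[of j i] ij by auto
  have hb: "h (b x) = a x" if "i < x" "x < j" for x
    using that ij b_eq[of x i] a_ne_b[of j x] m_b[of x] by (auto simp: h_def)
  have ha: "h (a x) = b x" if "i < x" "x < j" for x
    using that ij a_eq[of x j] a_ne_b[of x i] m_a[of x] by (auto simp: h_def)
  show False
  proof (rule no_rewiring[of "seg i j" h "b (Suc i)"])
    show "z \<in> moved \<and> ms z \<in> seg i j \<and> ms z \<noteq> z" if "z \<in> seg i j" for z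
      using seg_closed[OF ij(2) that] .
    show "h z \<in> seg i j \<and> h (h z) = z \<and> adj z (h z)" if z: "z \<in> seg i j" for z
    proof -
      consider "z = b i" | "z = a j" | x where "z = b x" "i < x" "x < j" | x where "z = a x" "i < x" "x < j"
        using z unfolding seg_def by (auto simp: image_iff) (metis nat_less_le Suc_le_eq)+
      thus ?thesis
      proof cases
        case 1
        thus ?thesis using adj ij by (auto simp: h_def seg_def)
      next
        case 2
        thus ?thesis using adj_sym[OF adj] ij ba by (auto simp: h_def seg_def)
      next
        case 3
        thus ?thesis using hb[of x] ha[of x] adj_ba[of x] ij by (auto simp: seg_def)
      next
        case 4
        thus ?thesis using hb[of x] ha[of x] adj_ab[of x] ij by (auto simp: seg_def)
      qed
    qed
    show "b (Suc i) \<in> seg i j" using ij by (auto simp: seg_def)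
    show "h (b (Suc i)) = m (b (Suc i))" using hb[of "Suc i"] m_b[of "Suc i"] ij by simp
  qed
qed

lemma b_in_seg: "x < 4 * r \<Longrightarrow> l < 4 * r \<Longrightarrow> b x \<in> seg i l \<longleftrightarrow> i \<le> x \<and> x < l"
  by (auto simp: seg_def image_iff b_eq) (metis a_ne_b le_less_trans)+
lemma a_in_seg: "x < 4 * r \<Longrightarrow> l < 4 * r \<Longrightarrow> a x \<in> seg i l \<longleftrightarrow> i < x \<and> x \<le> l"
  using a_ne_b[of x] by (auto simp: seg_def image_iff a_eq)

text \<open>Two such chords form a shortcut from \<open>b i\<close> via \<open>b j\<close>, backwards along the path to \<open>a j'\<close>,
  and on to \<open>a l\<close>. Use the chords, keep \<open>ms\<close> between \<open>a j'\<close> and \<open>b j\<close>, and match the skipped vertices as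
  \<open>m\<close> does. Some vertex is skipped since \<open>Suc i < j'\<close>.\<close>

lemma no_crossing_chords:
  assumes ord: "Suc i < j'" "j' \<le> j" "j < l" "l < 4 * r" and adj: "adj (b i) (b j)"
  shows "\<not> adj (a j') (a l)"
proof
  assume adj': "adj (a j') (a l)"
  define h where "h z = (if z = b i then b j else if z = b j then b i else if z = a j' then a l
     else if z = a l then a j' else if z \<in> seg j' j then ms z else m z)" for z
  have lt: "i < 4 * r" "j < 4 * r" "j' < 4 * r" using ord by auto
  have ends: "h (b i) = b j" "h (b j) = b i" "h (a j') = a l" "h (a l) = a j'"
    using lt ord b_eq[of i j] a_eq[of j' l] a_ne_b[of _ i] a_ne_b[of _ j] by (auto simp: h_def)
  have outer: "h (b x) = a x \<and> h (a x) = b x" if "i < x \<and> x < j' \<or> j < x \<and> x < l" for x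
  proof -
    have x: "x < 4 * r" using that ord by auto
    have "b x \<notin> {b i, b j, a j', a l}" "a x \<notin> {b i, b j, a j', a l}"
      using that ord lt x a_ne_b b_eq a_eq by (auto dest: sym)
    moreover have "b x \<notin> seg j' j" "a x \<notin> seg j' j"
      using that ord x lt by (auto simp: b_in_seg a_in_seg)
    ultimately show ?thesis using m_a[OF x] m_b[OF x] by (simp add: h_def)
  qed
  have inner: "h (b x) = a (Suc x) \<and> h (a (Suc x)) = b x" if "j' \<le> x \<and> x < j" for x
  proof -
    have x: "x < 4 * r" "Suc x < 4 * r" using that ord by auto
    have "b x \<notin> {b i, b j, a j', a l}" "a (Suc x) \<notin> {b i, b j, a j', a l}"
      using that ord lt x a_ne_b b_eq a_eq by (auto dest: sym)
    moreover have "b x \<in> seg j' j" "a (Suc x) \<in> seg j' j"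
      using that ord x lt by (auto simp: b_in_seg a_in_seg)
    ultimately show ?thesis using ms_a[OF x(2)] ms_b[OF x(2)] by (simp add: h_def)
  qed
  show False
  proof (rule no_rewiring[of "seg i l" h "b (Suc i)"])
    show "z \<in> moved \<and> ms z \<in> seg i l \<and> ms z \<noteq> z" if "z \<in> seg i l" for z
      using seg_closed[OF ord(4) that] .
    show "h z \<in> seg i l \<and> h (h z) = z \<and> adj z (h z)" if z: "z \<in> seg i l" for z
    proof -
      have lt': "x \<le> l \<Longrightarrow> x < 4 * r" for x using ord by simp
      have "\<exists>x. z = b x \<and> i \<le> x \<and> x < l \<or> z = a x \<and> i < x \<and> x \<le> l"
        using z unfolding seg_def by (force simp: Suc_le_eq)
      then obtain x where x: "z = b x \<and> i \<le> x \<and> x < l \<or> z = a x \<and> i < x \<and> x \<le> l" ..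
      then consider "z = b i" | "z = b j" | "z = a j'" | "z = a l"
        | "z = b x \<or> z = a x" "i < x \<and> x < j' \<or> j < x \<and> x < l"
        | "z = b x" "j' \<le> x \<and> x < j" | y where "z = a (Suc y)" "j' \<le> y \<and> y < j"
        using ord by (cases x) (force simp: not_less_eq less_Suc_eq_le le_less)+
      thus ?thesis
      proof cases
        case 5
        thus ?thesis using outer[of x] adj_ba[of x] adj_ab[of x] ord lt'[of x]
          by (auto simp: b_in_seg a_in_seg)
      next
        case 6
        thus ?thesis using inner[of x] adj_b_Suc[of x] ord lt'[of x] lt'[of "Suc x"]
          by (auto simp: b_in_seg a_in_seg)
      next
        case 7
        thus ?thesis using inner[of y] adj_sym[OF adj_b_Suc[of y]] ord lt'[of y] lt'[of "Suc y"]
          by (auto simp: b_in_seg a_in_seg)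
      qed (use ends adj adj' adj_sym ord lt in \<open>auto simp: b_in_seg a_in_seg\<close>)
    qed
    show "b (Suc i) \<in> seg i l" using ord by (auto simp: seg_def)
    show "h (b (Suc i)) = m (b (Suc i))" using outer[of "Suc i"] m_b[of "Suc i"] ord by simp
  qed
qed

end

section \<open>Long alternating segments\<close>

context long_segment begin

text \<open>A block leaves out the last of its four edges. The gap ensures that a vertex \<open>b i\<close> of one
  block and a vertex \<open>a j\<close> of a later block satisfy \<open>Suc i < j\<close>, even for neighbouring blocks.\<close>

definition block :: "nat \<Rightarrow> 'a set" where
  "block t = a ` {4 * t..4 * t + 2} \<union> b ` {4 * t..4 * t + 2}"

lemma block_eq:
  assumes "t < r" "u < r" "z \<in> block t" "z \<in> block u"
  shows "t = u"
proof -
  obtain x where x: "z = a x \<or> z = b x" "4 * t \<le> x" "x \<le> 4 * t + 2"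
    using assms(3) unfolding block_def by fastforce
  obtain y where y: "z = a y \<or> z = b y" "4 * u \<le> y" "y \<le> 4 * u + 2"
    using assms(4) unfolding block_def by fastforce
  have lt: "x < 4 * r" "y < 4 * r" using assms x y by auto
  hence "x = y" using x(1) y(1) a_eq b_eq a_ne_b by metis
  thus ?thesis using x y by linarith
qed

text \<open>Inside block \<open>t\<close>, replacing \<open>m\<close> on \<open>S\<close> by \<open>h\<close> exposes just the vertices \<open>a i\<close> and \<open>b j\<close>.\<close>

definition gadget :: "nat \<Rightarrow> nat \<Rightarrow> nat \<Rightarrow> 'a set \<Rightarrow> ('a \<Rightarrow> 'a) \<Rightarrow> bool" where
  "gadget t i j S h \<longleftrightarrow> i \<in> {4 * t..4 * t + 2} \<and> j \<in> {4 * t..4 * t + 2} \<and> \<not> adj (a i) (b j) \<and>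
     S \<subseteq> block t - {a i, b j} \<and> m (a i) \<in> S \<and> m (b j) \<in> S \<and>
     (\<forall>z\<in>S. m z \<in> insert (a i) (insert (b j) S) \<and> h z \<in> S \<and> h (h z) = z \<and> adj z (h z))"

text \<open>Let the edges of the block be \<open>a b\<close>, \<open>a' b'\<close> and \<open>a'' b''\<close>. If \<open>a\<close> and \<open>b'\<close> are not
  adjacent, the edge \<open>b a'\<close> of \<open>ms\<close> exposes them; if \<open>a'\<close> and \<open>b''\<close> are not adjacent, the edge \<open>b' a''\<close> does.
  Otherwise the edges \<open>a b'\<close> and \<open>a' b''\<close> expose \<open>b\<close> and \<open>a''\<close>, which are not adjacent because there
  are no forward chords.\<close>

lemma gadget_exists:
  assumes "t < r"
  shows "\<exists>i j S h. gadget t i j S h"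
proof -
  define x where "x = 4 * t"
  have x: "x < 4 * r" "Suc x < 4 * r" "Suc (Suc x) < 4 * r" using assms by (auto simp: x_def)
  note eqs = a_eq b_eq a_ne_b a_ne_b[THEN not_sym] m_a m_b ms_b ms_a
  have mem: "x \<in> {4 * t..4 * t + 2}" "Suc x \<in> {4 * t..4 * t + 2}" "Suc (Suc x) \<in> {4 * t..4 * t + 2}"
    by (auto simp: x_def)
  hence blk: "a x \<in> block t" "b x \<in> block t" "a (Suc x) \<in> block t" "b (Suc x) \<in> block t"
    "a (Suc (Suc x)) \<in> block t" "b (Suc (Suc x)) \<in> block t"
    unfolding block_def by blast+
  show ?thesis
  proof (cases "adj (a x) (b (Suc x))")
    case False
    have "gadget t x (Suc x) {b x, a (Suc x)} ms"
      using x mem blk False adj_b_Suc[of x] adj_sym by (auto simp: gadget_def eqs)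
    thus ?thesis by blast
  next
    case adj1: True
    show ?thesis
    proof (cases "adj (a (Suc x)) (b (Suc (Suc x)))")
      case False
      have "gadget t (Suc x) (Suc (Suc x)) {b (Suc x), a (Suc (Suc x))} ms"
        using x mem blk False adj_b_Suc[of "Suc x"] adj_sym by (auto simp: gadget_def eqs)
      thus ?thesis by blast
    next
      case True
      define h where "h z = (if z = a x then b (Suc x) else if z = b (Suc x) then a x
        else if z = a (Suc x) then b (Suc (Suc x)) else a (Suc x))" for z
      have "\<not> adj (a (Suc (Suc x))) (b x)" using no_forward_chord[of x "Suc (Suc x)"] x adj_sym by blast
      moreover have "h (a x) = b (Suc x)" "h (b (Suc x)) = a x"
        "h (a (Suc x)) = b (Suc (Suc x))" "h (b (Suc (Suc x))) = a (Suc x)"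
        using x by (simp_all add: h_def eqs)
      ultimately have "gadget t (Suc (Suc x)) x {a x, b (Suc x), a (Suc x), b (Suc (Suc x))} h"
        using x mem blk True adj1 adj_sym[OF True] adj_sym[OF adj1] unfolding gadget_def
        by (simp add: eqs)
      thus ?thesis by blast
    qed
  qed
qed

text \<open>One gadget is fixed in every block.\<close>

definition ai :: "nat \<Rightarrow> nat" where "ai t = (SOME i. \<exists>j S h. gadget t i j S h)"
definition bi :: "nat \<Rightarrow> nat" where "bi t = (SOME j. \<exists>S h. gadget t (ai t) j S h)"
definition inner :: "nat \<Rightarrow> 'a set" where "inner t = (SOME S. \<exists>h. gadget t (ai t) (bi t) S h)"
definition inner_mate :: "nat \<Rightarrow> 'a \<Rightarrow> 'a" where
  "inner_mate t = (SOME h. gadget t (ai t) (bi t) (inner t) h)"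

abbreviation left :: "nat \<Rightarrow> 'a" where "left t \<equiv> a (ai t)"
abbreviation right :: "nat \<Rightarrow> 'a" where "right t \<equiv> b (bi t)"

lemma gadget_t: "t < r \<Longrightarrow> gadget t (ai t) (bi t) (inner t) (inner_mate t)"
  unfolding inner_mate_def inner_def bi_def ai_def
  using gadget_exists[of t] by (metis (mono_tags, lifting) someI_ex)

lemma gadgetD:
  assumes "t < r"
  shows "4 * t \<le> ai t" "ai t \<le> 4 * t + 2" "4 * t \<le> bi t" "bi t \<le> 4 * t + 2"
    "ai t < 4 * r" "bi t < 4 * r"
    "left t \<in> block t" "right t \<in> block t" "left t \<in> V" "right t \<in> V"
    "\<not> adj (left t) (right t)" "inner t \<subseteq> block t" "left t \<notin> inner t" "right t \<notin> inner t"
    "m (left t) \<in> inner t" "m (right t) \<in> inner t"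
    "z \<in> inner t \<Longrightarrow> m z \<in> insert (left t) (insert (right t) (inner t))"
    "z \<in> inner t \<Longrightarrow> inner_mate t z \<in> inner t \<and> inner_mate t (inner_mate t z) = z \<and> adj z (inner_mate t z)"
proof -
  show *: "4 * t \<le> ai t" "ai t \<le> 4 * t + 2" "4 * t \<le> bi t" "bi t \<le> 4 * t + 2"
    "\<not> adj (left t) (right t)" "inner t \<subseteq> block t" "left t \<notin> inner t" "right t \<notin> inner t"
    "m (left t) \<in> inner t" "m (right t) \<in> inner t"
    "z \<in> inner t \<Longrightarrow> m z \<in> insert (left t) (insert (right t) (inner t))"
    "z \<in> inner t \<Longrightarrow> inner_mate t z \<in> inner t \<and> inner_mate t (inner_mate t z) = z \<and> adj z (inner_mate t z)"
    using gadget_t[OF assms] by (auto simp: gadget_def)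
  show "ai t < 4 * r" "bi t < 4 * r" using * assms by auto
  thus "left t \<in> V" "right t \<in> V" by (auto intro: a_V b_V)
  show "left t \<in> block t" "right t \<in> block t" using * by (auto simp: block_def)
qed

lemma right_left_nonadj:
  assumes "s < t" "t < r"
  shows "\<not> adj (right s) (left t)"
proof -
  have "bi s \<le> 4 * s + 2" "4 * t \<le> ai t" "ai t < 4 * r" using gadgetD[of s] gadgetD[of t] assms by auto
  thus ?thesis using assms by (intro no_forward_chord) auto
qed

text \<open>Apply the gadgets of all blocks in \<open>T\<close> and then match some of the vertices exposed in
  this way, \<open>S'\<close>, along \<open>k\<close>. All these edges can be forced by \<open>L\<close> moves from \<open>m\<close>. If the remaining
  exposed vertices of the gadgets are independent, a completion covers at most \<open>D\<close> of them, the
  number of vertices exposed by \<open>m\<close>, and exposes at most \<open>D\<close> vertices.\<close>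

lemma exposed_family_bound:
  assumes T: "T \<subseteq> {..<r}" and S': "S' \<subseteq> left ` T \<union> right ` T"
    and k: "\<And>z. z \<in> S' \<Longrightarrow> k z \<in> S' \<and> k (k z) = z \<and> adj z (k z)"
    and indep: "\<And>x y. x \<in> left ` T \<union> right ` T - S' \<Longrightarrow> y \<in> left ` T \<union> right ` T - S' \<Longrightarrow> \<not> adj x y"
  shows "card (left ` T \<union> right ` T - S') \<le> 2 * D"
proof -
  define Y where "Y = left ` T \<union> right ` T"
  define S where "S = (\<Union>t\<in>T. inner t) \<union> S'"
  have Tr: "t < r" if "t \<in> T" for t using that T by auto
  \<comment> \<open>The blocks are disjoint, so a vertex of a gadget determines its block.\<close>
  define idx where "idx z = (THE t. t \<in> T \<and> z \<in> inner t)" for z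
  have idx: "idx z = t" if "t \<in> T" "z \<in> inner t" for z t
    unfolding idx_def using that block_eq[of _ t z] gadgetD(12) Tr by (intro the_equality) blast+
  have YS: "z \<notin> inner t" if zY: "z \<in> Y" and tT: "t \<in> T" for z t
  proof
    assume z: "z \<in> inner t"
    obtain u where u: "u \<in> T" "z = left u \<or> z = right u" using zY unfolding Y_def by blast
    have "z \<in> block u" "z \<in> block t" using u z gadgetD(7,8)[OF Tr[OF u(1)]] gadgetD(12)[OF Tr[OF tT]] by auto
    hence "u = t" using block_eq Tr u tT by blast
    thus False using u z gadgetD(13,14)[OF Tr[OF tT]] by auto
  qed
  have mY: "\<exists>t\<in>T. m z \<in> inner t" if "z \<in> Y" for z
    using that gadgetD(15,16) Tr by (auto simp: Y_def)
  define h where "h z = (if z \<in> S' then k z else inner_mate (idx z) z)" for z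
  have h: "h z \<in> S \<and> h (h z) = z \<and> adj z (h z)" if z: "z \<in> S" for z
  proof (cases "z \<in> S'")
    case True
    thus ?thesis using k[OF True] by (auto simp: h_def S_def)
  next
    case False
    then obtain t where t: "t \<in> T" "z \<in> inner t" using z by (auto simp: S_def)
    have g: "inner_mate t z \<in> inner t \<and> inner_mate t (inner_mate t z) = z \<and> adj z (inner_mate t z)"
      using gadgetD(18)[OF Tr[OF t(1)] t(2)] .
    moreover have "inner_mate t z \<notin> S'" using YS[OF _ t(1)] g S' by (auto simp: Y_def)
    ultimately show ?thesis using idx[OF t] idx[OF t(1), of "inner_mate t z"] False t
      by (auto simp: h_def S_def)
  qed
  have blocks: "S \<subseteq> a ` {..<4 * r} \<union> b ` {..<4 * r}"
  proof -
    have "block t \<subseteq> a ` {..<4 * r} \<union> b ` {..<4 * r}" if "t < r" for t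
      using that by (auto simp: block_def)
    moreover have "S \<subseteq> (\<Union>t\<in>T. block t)"
    proof
      fix z assume "z \<in> S"
      then obtain t where "t \<in> T" "z \<in> inner t \<or> z = left t \<or> z = right t"
        using S' unfolding S_def by blast
      thus "z \<in> (\<Union>t\<in>T. block t)" using gadgetD(7,8,12)[OF Tr, of t] by blast
    qed
    ultimately show ?thesis using Tr by blast
  qed
  have SV: "S \<subseteq> V" using blocks a_V b_V by auto
  have "card S \<le> card (a ` {..<4 * r} \<union> b ` {..<4 * r})" using blocks by (intro card_mono) auto
  also have "\<dots> \<le> 4 * r + 4 * r"
    by (rule order_trans[OF card_Un_le]) (intro add_mono order_trans[OF card_image_le], auto)
  finally have "card S \<le> L" using r_le_L by simp
  moreover have "finite S" using SV finite_V finite_subset by blast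
  ultimately obtain N where N: "length N \<le> L" "set N \<subseteq> V \<times> V"
    and Nm: "\<And>z. z \<in> V \<Longrightarrow> rematches N m z = (if z \<in> S then h z else if m z \<in> S then z else m z)"
    using impose_matching[OF m_mating _ SV h] by (metis order_trans)
  let ?m = "rematches N m"
  have YV: "Y \<subseteq> V" using gadgetD(9,10) Tr by (auto simp: Y_def)
  have I: "Y - S' \<subseteq> exposed ?m"
  proof
    fix z assume z: "z \<in> Y - S'"
    hence "z \<notin> S" using YS[of z] by (auto simp: S_def)
    moreover have "m z \<in> S" using mY z by (auto simp: S_def)
    ultimately show "z \<in> exposed ?m" using Nm[of z] YV z by (auto simp: exposed_def)
  qed
  have "exposed ?m \<subseteq> (Y - S') \<union> exposed m"
  proof
    fix z assume "z \<in> exposed ?m"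
    hence z: "z \<in> V" "?m z = z" by (auto simp: exposed_def)
    have zS: "z \<notin> S" using h[of z] Nm[OF z(1)] z(2) adj_irrefl[of z] by auto
    show "z \<in> (Y - S') \<union> exposed m"
    proof (cases "m z \<in> S")
      case False
      thus ?thesis using Nm[OF z(1)] z zS by (auto simp: exposed_def)
    next
      case True
      have mm: "m (m z) = z" using m_props(2)[OF z(1)] .
      have "m z \<notin> S'"
      proof
        assume "m z \<in> S'"
        then obtain t where "t \<in> T" "m (m z) \<in> inner t" using mY[of "m z"] S' by (auto simp: Y_def)
        thus False using mm zS by (auto simp: S_def)
      qed
      then obtain t where t: "t \<in> T" "m z \<in> inner t" using True by (auto simp: S_def)
      have "z \<in> insert (left t) (insert (right t) (inner t))"
        using gadgetD(17)[OF Tr[OF t(1)] t(2)] mm by simp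
      thus ?thesis using t(1) zS by (auto simp: Y_def S_def)
    qed
  qed
  from exposed_completion_ge[OF completion_g mating_rematches[OF m_mating N(2)] I this finite_exposed] indep
  have "card (Y - S') \<le> card (exposed (g ?m)) + card (exposed m)" by (auto simp: Y_def)
  also have "\<dots> \<le> D + D" using reached_le[OF N] card_exposed_m_le by (rule add_mono)
  finally show ?thesis by (simp add: Y_def)
qed

text \<open>In a homogeneous family of \<open>2 * D + 4\<close> blocks let \<open>\<alpha> i\<close> and \<open>\<beta> i\<close> be the vertices exposed by
  the gadget of the \<open>i\<close>-th block. There are no edges from \<open>\<beta> i\<close> to \<open>\<alpha> j\<close> for \<open>i \<le> j\<close>. If the \<open>\<alpha>\<close> and the
  \<open>\<beta>\<close> both form a clique, there are crossing chords. If just one side is a clique, matching it perfectly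
  leaves the other side. If neither is, and \<open>\<alpha> i\<close> is adjacent to \<open>\<beta> j\<close> for \<open>i < j\<close>, matching the
  first half of the \<open>\<alpha>\<close> with the second half of the \<open>\<beta>\<close> leaves an independent set; and without such
  edges all vertices are independent. More than \<open>2 * D\<close> independent vertices remain in every case,
  contrary to \<open>exposed_family_bound\<close>.\<close>

lemma no_long_segment: False
proof -
  \<comment> \<open>Colour a pair of blocks by the three adjacencies that shortcuts do not exclude.\<close>
  define col where "col s t = (adj (left s) (left t), adj (right s) (right t), adj (left s) (right t))" for s t
  define G where "G = D + 2"
  have c8: "card (UNIV :: (bool \<times> bool \<times> bool) set) = 8" by (simp add: card_UNIV_bool flip: UNIV_Times_UNIV)
  have "\<exists>ts c. length ts = 2 * G \<and> set ts \<subseteq> {..<r} \<and> sorted_wrt (\<lambda>s t. s < t \<and> col s t = c) ts"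
    by (rule ramsey_list) (use many_blocks in \<open>simp_all add: c8 G_def algebra_simps\<close>)
  then obtain ts c where ts: "length ts = 2 * G" "set ts \<subseteq> {..<r}"
    "sorted_wrt (\<lambda>s t. s < t \<and> col s t = c) ts" by blast
  obtain p1 p2 p3 where c: "c = (p1, p2, p3)" by (cases c)
  define \<alpha> where "\<alpha> i = left (ts ! i)" for i
  define \<beta> where "\<beta> i = right (ts ! i)" for i
  have r: "ts ! i < r" if "i < 2 * G" for i using ts that by (auto simp: subset_iff)
  have lt: "ts ! i < ts ! j" and p: "adj (\<alpha> i) (\<alpha> j) = p1" "adj (\<beta> i) (\<beta> j) = p2" "adj (\<alpha> i) (\<beta> j) = p3"
    if "i < j" "j < 2 * G" for i j
    using sorted_wrt_nth_less[OF ts(3) that(1)] that ts(1) by (auto simp: c col_def \<alpha>_def \<beta>_def)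
  have ba: "\<not> adj (\<beta> i) (\<alpha> j)" if "i \<le> j" "j < 2 * G" for i j
  proof (cases "i = j")
    case True
    thus ?thesis using gadgetD(11)[OF r[OF that(2)]] adj_sym by (auto simp: \<alpha>_def \<beta>_def)
  next
    case False
    thus ?thesis using right_left_nonadj[OF lt[of i j] r[of j]] that by (auto simp: \<alpha>_def \<beta>_def)
  qed
  define T where "T = set ts"
  have img: "left ` T = \<alpha> ` {..<2 * G}" "right ` T = \<beta> ` {..<2 * G}"
    using ts(1) by (auto simp: T_def \<alpha>_def \<beta>_def set_conv_nth)
  have ne: "\<alpha> i \<noteq> \<beta> j" if "i < 2 * G" "j < 2 * G" for i j
    using a_ne_b gadgetD(5,6) r that by (auto simp: \<alpha>_def \<beta>_def)
  have "ts ! i = ts ! j" if "i < 2 * G" "j < 2 * G" "left (ts ! i) = left (ts ! j) \<or> right (ts ! i) = right (ts ! j)" for i j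
    using block_eq[OF r[OF that(1)] r[OF that(2)]] gadgetD(7,8)[OF r[OF that(1)]] gadgetD(7,8)[OF r[OF that(2)]] that(3)
    by metis
  hence eq: "i = j" if "i < 2 * G" "j < 2 * G" "\<alpha> i = \<alpha> j \<or> \<beta> i = \<beta> j" for i j
    using lt[of i j] lt[of j i] that by (metis \<alpha>_def \<beta>_def nat_neq_iff)
  have inj: "inj_on \<alpha> {..<2 * G}" "inj_on \<beta> {..<2 * G}" using eq by (auto simp: inj_on_def)
  define Y where "Y = \<alpha> ` {..<2 * G} \<union> \<beta> ` {..<2 * G}"
  have Y: "left ` T \<union> right ` T = Y" by (simp add: img Y_def)
  have T: "T \<subseteq> {..<r}" using ts(2) by (simp add: T_def)
  note bound = exposed_family_bound[OF T, unfolded Y]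
  have cardY: "card Y = 4 * G" unfolding Y_def
    using inj ne by (subst card_Un_disjoint) (auto simp: card_image)
  \<comment> \<open>Matching \<open>f i\<close> with \<open>f' i\<close> covers half of the vertices \<open>\<alpha> i\<close> and \<open>\<beta> i\<close>. It leaves \<open>2 * D + 4\<close>
    of them, so they cannot be independent.\<close>
  have shift: False if S': "S' = f ` {..<G} \<union> f' ` {..<G}" "S' \<subseteq> Y"
      and f: "inj_on f {..<G}" "inj_on f' {..<G}" "f ` {..<G} \<inter> f' ` {..<G} = {}"
      and ad: "\<And>i. i < G \<Longrightarrow> adj (f i) (f' i)"
      and ind: "\<And>x y. x \<in> Y - S' \<Longrightarrow> y \<in> Y - S' \<Longrightarrow> \<not> adj x y" for S' f f'
  proof -
    obtain k where k: "\<And>i. i < G \<Longrightarrow> k (f i) = f' i \<and> k (f' i) = f i"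
      using pairing_involution[OF f] by auto
    have kk: "k z \<in> S' \<and> k (k z) = z \<and> adj z (k z)" if "z \<in> S'" for z
      using that k ad adj_sym[OF ad] unfolding S'(1) by auto
    have "card (Y - S') \<le> 2 * D"
      by (rule bound[OF S'(2) kk ind])
    moreover have "card S' \<le> 2 * G" unfolding S'(1)
      by (rule order_trans[OF card_Un_le]) (metis add_mono card_image_le card_lessThan finite_lessThan mult_2)
    moreover have "card (Y - S') \<ge> card Y - card S'" by (rule diff_card_le_card_Diff) (auto simp: S'(1))
    ultimately show False using cardY by (simp add: G_def)
  qed
  have low: "i < 2 * G" "i + G < 2 * G" if "i < G" for i using that by auto
  have split: "{..<2 * G} = {..<G} \<union> (\<lambda>i. i + G) ` {..<G}"
    by (auto simp: image_add_atLeastLessThan' lessThan_atLeast0 ivl_disj_un)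
  have inj': "inj_on \<alpha> {..<G}" "inj_on (\<lambda>i. \<alpha> (i + G)) {..<G}" "inj_on \<beta> {..<G}" "inj_on (\<lambda>i. \<beta> (i + G)) {..<G}"
    using eq low eq[of "_ + G" "_ + G"] by (auto simp: inj_on_def) 
  have Gpos: "4 \<le> 2 * G" by (simp add: G_def)
  show False
  proof (cases "p1 \<and> p2")
    case True
    define i j' j l where "i = bi (ts ! 0)" and "j' = ai (ts ! 1)" and "j = bi (ts ! 2)" and "l = ai (ts ! 3)"
    have o: "ts ! 0 < ts ! 1" "ts ! 1 < ts ! 2" "ts ! 2 < ts ! 3" using lt Gpos by auto
    have b: "i \<le> 4 * ts ! 0 + 2" "4 * ts ! 1 \<le> j'" "j' \<le> 4 * ts ! 1 + 2" "4 * ts ! 2 \<le> j"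
       "j \<le> 4 * ts ! 2 + 2" "4 * ts ! 3 \<le> l" "l < 4 * r"
      using gadgetD[OF r[of 0]] gadgetD[OF r[of 1]] gadgetD[OF r[of 2]] gadgetD[OF r[of 3]] Gpos
      by (auto simp: i_def j'_def j_def l_def)
    have "Suc i < j'" "j' \<le> j" "j < l" using b o by linarith+
    moreover have "adj (b i) (b j)" "adj (a j') (a l)"
      using p(2)[of 0 2] p(1)[of 1 3] True Gpos by (auto simp: \<alpha>_def \<beta>_def i_def j'_def j_def l_def)
    ultimately show False using no_crossing_chords b(7) by blast
  next
    case np: False
    have pp1: "adj (\<alpha> i) (\<alpha> j) \<longrightarrow> p1" "adj (\<beta> i) (\<beta> j) \<longrightarrow> p2" if "i < 2 * G" "j < 2 * G" for i j
      using p[of i j] p[of j i] adj_sym adj_irrefl that by (metis nat_neq_iff)+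
    show False
    proof (cases p1)
      case True
      let ?S = "\<alpha> ` {..<2 * G}"
      show False
      proof (rule shift[of ?S \<alpha> "\<lambda>i. \<alpha> (i + G)"])
        show "?S = \<alpha> ` {..<G} \<union> (\<lambda>i. \<alpha> (i + G)) ` {..<G}" unfolding split by auto
        show "\<alpha> ` {..<G} \<inter> (\<lambda>i. \<alpha> (i + G)) ` {..<G} = {}" using eq low by fastforce
        show "adj (\<alpha> i) (\<alpha> (i + G))" if "i < G" for i using p(1)[of i "i + G"] True that by auto
        show "\<not> adj x y" if "x \<in> Y - ?S" "y \<in> Y - ?S" for x y
          using that pp1(2) np True by (auto simp: Y_def)
      qed (use inj' in \<open>auto simp: Y_def\<close>)
    next
      case np1: False
      show False
      proof (cases p2)
        case True
        let ?S = "\<beta> ` {..<2 * G}"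
        show False
        proof (rule shift[of ?S \<beta> "\<lambda>i. \<beta> (i + G)"])
          show "?S = \<beta> ` {..<G} \<union> (\<lambda>i. \<beta> (i + G)) ` {..<G}" unfolding split by auto
          show "\<beta> ` {..<G} \<inter> (\<lambda>i. \<beta> (i + G)) ` {..<G} = {}" using eq low by fastforce
          show "adj (\<beta> i) (\<beta> (i + G))" if "i < G" for i using p(2)[of i "i + G"] True that by auto
          show "\<not> adj x y" if "x \<in> Y - ?S" "y \<in> Y - ?S" for x y
            using that pp1(1) np True by (auto simp: Y_def)
        qed (use inj' in \<open>auto simp: Y_def\<close>)
      next
        case np2: False
        show False
        proof (cases p3)
          case True
          let ?S = "\<alpha> ` {..<G} \<union> (\<lambda>i. \<beta> (i + G)) ` {..<G}"
          show False
          proof (rule shift[of ?S \<alpha> "\<lambda>i. \<beta> (i + G)"])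
            show "\<alpha> ` {..<G} \<inter> (\<lambda>i. \<beta> (i + G)) ` {..<G} = {}" using ne low by fastforce
            show "?S \<subseteq> Y" using low by (auto simp: Y_def)
            show "adj (\<alpha> i) (\<beta> (i + G))" if "i < G" for i using p(3)[of i "i + G"] True that by auto
            have sub: "Y - ?S \<subseteq> (\<lambda>i. \<alpha> (i + G)) ` {..<G} \<union> \<beta> ` {..<G}"
              unfolding Y_def split by auto
            have nonadj: "\<not> adj x y" if x: "x \<in> (\<lambda>i. \<alpha> (i + G)) ` {..<G} \<union> \<beta> ` {..<G}"
              and y: "y \<in> (\<lambda>i. \<alpha> (i + G)) ` {..<G} \<union> \<beta> ` {..<G}" for x y
            proof -
              have "\<not> adj (\<beta> i) (\<alpha> (j + G))" "\<not> adj (\<alpha> (j + G)) (\<beta> i)" if "i < G" "j < G" for i j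
                using ba[of i "j + G"] that adj_sym by auto
              thus ?thesis using x y pp1 np1 np2 low by auto
            qed
            show "\<not> adj x y" if "x \<in> Y - ?S" "y \<in> Y - ?S" for x y
              using nonadj[OF subsetD[OF sub that(1)] subsetD[OF sub that(2)]] .
          qed (use inj' in auto)
        next
          case np3: False
          have ab: "\<not> adj (\<alpha> i) (\<beta> j)" if "i < 2 * G" "j < 2 * G" for i j
            using p(3)[of i j] ba[of j i] adj_sym that np3 by (metis not_le)
          have "card (Y - {}) \<le> 2 * D"
            using ab adj_sym pp1 np1 np2 by (intro bound) (auto simp: Y_def)
          thus False using cardY by (simp add: G_def)
        qed
      qed
    qed
  qed
qed

end

section \<open>Reaching every number of exposed vertices\<close>

text \<open>The walk from \<open>e\<close> that applies \<open>f\<close> and \<open>h\<close> in turn; with two matchings for \<open>f\<close> and \<open>h\<close> it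
  follows an alternating path.\<close>

primrec walk :: "('a \<Rightarrow> 'a) \<Rightarrow> ('a \<Rightarrow> 'a) \<Rightarrow> 'a \<Rightarrow> nat \<Rightarrow> 'a" where
  "walk f h e 0 = e"
| "walk f h e (Suc i) = (if even i then f else h) (walk f h e i)"

text \<open>Both involutions send a vertex of the walk to its predecessor or successor, and \<open>h\<close>
  fixes the first vertex. So the vertices before the first repetition form a closed set.\<close>

lemma walk_long_or_closed:
  assumes f: "\<And>x. x \<in> V \<Longrightarrow> f x \<in> V \<and> f (f x) = x"
    and h: "\<And>x. x \<in> V \<Longrightarrow> h x \<in> V \<and> h (h x) = x" and e: "e \<in> V" "h e = e"
  shows "walk f h e i \<in> V"
    and "inj_on (walk f h e) {..k} \<or>
      (\<exists>C. e \<in> C \<and> C \<subseteq> V \<and> finite C \<and> card C \<le> k \<and> (\<forall>x\<in>C. f x \<in> C \<and> h x \<in> C))"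
proof -
  let ?w = "walk f h e"
  show V: "?w i \<in> V" for i using e f h by (induction i) auto
  show "inj_on ?w {..k} \<or>
      (\<exists>C. e \<in> C \<and> C \<subseteq> V \<and> finite C \<and> card C \<le> k \<and> (\<forall>x\<in>C. f x \<in> C \<and> h x \<in> C))"
  proof (cases "\<exists>j\<le>k. ?w j \<in> ?w ` {..<j}")
    case False
    hence "?w i \<noteq> ?w j" if "i < j" "j \<le> k" for i j
      using that by (metis imageI lessThan_iff)
    hence "inj_on ?w {..k}" by (intro linorder_inj_onI) auto
    thus ?thesis ..
  next
    case True
    then obtain j where j: "j \<le> k" "?w j \<in> ?w ` {..<j}" by blast
    define C where "C = ?w ` {..<j}"
    have "f (?w i) \<in> C \<and> h (?w i) \<in> C" if i: "i < j" for i
    proof -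
      have nxt: "?w (Suc i) \<in> C" 
        using i j(2) image_eqI[of "?w (Suc i)" ?w "Suc i" "{..<j}"]
        by (cases "Suc i = j") (simp_all only: C_def lessThan_iff)
      have here: "?w i \<in> C" using i by (auto simp: C_def)
      show ?thesis
      proof (cases i)
        case 0
        thus ?thesis using nxt here e by simp
      next
        case (Suc i')
        have prev: "?w i' \<in> C" using i Suc by (auto simp: C_def)
        have "(if even i' then f else h) (?w i) = ?w i'" using f h V[of i'] Suc by auto
        thus ?thesis using nxt prev Suc by (auto split: if_splits)
      qed
    qed
    hence "\<forall>x\<in>C. f x \<in> C \<and> h x \<in> C" by (auto simp: C_def)
    moreover have "e \<in> C" using j(2) by (auto simp: C_def intro!: image_eqI[of _ _ 0])
    moreover have "finite C" "C \<subseteq> V" using V by (auto simp: C_def)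
    moreover have "card C \<le> k" unfolding C_def using card_image_le[of "{..<j}" ?w] j(1) by simp
    ultimately show ?thesis by blast
  qed
qed

context closest_unreached begin

text \<open>The walk from a vertex exposed by \<open>ms\<close> starts with \<open>m\<close>, the one from a vertex exposed by
  \<open>m\<close> starts with \<open>ms\<close>. If it has more than \<open>8 * r\<close> different vertices, it contains a long segment;
  in the second case the segment starts at the second vertex.\<close>

lemma small_component:
  assumes r: "8 ^ (8 * (2 * D + 4)) \<le> r" "8 * r \<le> L" and e: "e \<in> exposed m \<union> exposed ms"
  shows "\<exists>C. e \<in> C \<and> C \<subseteq> V \<and> card C \<le> 8 * r \<and> (\<forall>x\<in>C. m x \<in> C \<and> ms x \<in> C)"
proof -
  have eV: "e \<in> V" using e by (auto simp: exposed_def)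
  have inv: "x \<in> V \<Longrightarrow> m x \<in> V \<and> m (m x) = x" "x \<in> V \<Longrightarrow> ms x \<in> V \<and> ms (ms x) = x" for x
    using m_props ms_props by blast+
  show ?thesis
  proof (cases "ms e = e")
    case True
    note w = walk_long_or_closed[of V m ms e, OF inv(1,2) eV True]
    have wV: "walk m ms e i \<in> V" for i by (rule w(1))
    have "\<not> inj_on (walk m ms e) {..8 * r}"
    proof
      assume inj: "inj_on (walk m ms e) {..8 * r}"
      define a where "a i = walk m ms e (2 * i)" for i
      define b where "b i = walk m ms e (2 * i + 1)" for i
      have inj_ab: "inj_on a {..<4 * r}" "inj_on b {..<4 * r}"
        unfolding a_def b_def by ((rule inj_onI; drule inj_onD[OF inj]; simp del: walk.simps)+)
      have ne: "a i \<noteq> b j" if "i < 4 * r" "j < 4 * r" for i j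
      proof
        assume "a i = b j"
        hence "2 * i = 2 * j + 1" 
          using inj_onD[OF inj, of "2 * i" "2 * j + 1"] that unfolding a_def b_def by (simp del: walk.simps)
        thus False by presburger
      qed
      have ab: "a i \<in> V" "m (a i) = b i" "ms (b i) = a (Suc i)" for i
        unfolding a_def b_def by (rule wV, simp_all)
      interpret long_segment V adj g m ms L D a b r
        by unfold_locales (use r inj_ab ne ab in blast)+
      show False by (rule no_long_segment)
    qed
    thus ?thesis using w(2)[of "8 * r"] by blast
  next
    case False
    hence me: "m e = e" using e by (auto simp: exposed_def)
    note w = walk_long_or_closed[of V ms m e, OF inv(2,1) eV me]
    have wV: "walk ms m e i \<in> V" for i by (rule w(1))
    have "\<not> inj_on (walk ms m e) {..8 * r}"
    proof
      assume inj: "inj_on (walk ms m e) {..8 * r}"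
      define a where "a i = walk ms m e (2 * i + 1)" for i
      define b where "b i = walk ms m e (2 * i + 2)" for i
      have inj_ab: "inj_on a {..<4 * r}" "inj_on b {..<4 * r}"
        unfolding a_def b_def by ((rule inj_onI; drule inj_onD[OF inj]; simp del: walk.simps)+)
      have ne: "a i \<noteq> b j" if "i < 4 * r" "j < 4 * r" for i j
      proof
        assume "a i = b j"
        hence "2 * i + 1 = 2 * j + 2" 
          using inj_onD[OF inj, of "2 * i + 1" "2 * j + 2"] that unfolding a_def b_def by (simp del: walk.simps)
        thus False by presburger
      qed
      have ab: "a i \<in> V" "m (a i) = b i" "ms (b i) = a (Suc i)" for i
        unfolding a_def b_def by (rule wV, simp_all)
      interpret long_segment V adj g m ms L D a b r
        by unfold_locales (use r inj_ab ne ab in blast)+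
      show False by (rule no_long_segment)
    qed
    thus ?thesis using w(2)[of "8 * r"] by blast
  qed
qed

text \<open>Otherwise forcing the edges of \<open>ms\<close> between moved vertices takes at most \<open>L\<close> moves and
  turns \<open>m\<close> into \<open>ms\<close>. A moved vertex exposed by \<open>ms\<close> loses its partner in \<open>m\<close>, which \<open>ms\<close> matches
  because \<open>ms\<close> is maximal.\<close>

lemma many_moved: "L < card moved"
proof (rule ccontr)
  assume few: "\<not> ?thesis"
  define S where "S = {z \<in> moved. ms z \<noteq> z}"
  have mV: "m z \<in> moved" if "z \<in> moved" for z
    using that m_props ms_props by (smt (verit) mem_Collect_eq)
  have "ms z \<in> S \<and> ms (ms z) = z \<and> adj z (ms z)" if "z \<in> S" for z
  proof -
    have z: "z \<in> V" "m z \<noteq> ms z" "ms z \<noteq> z" using that by (auto simp: S_def)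
    have "m (ms z) \<noteq> z" using m_props(2)[OF z(1)] m_props(2)[of "ms z"] ms_props(1)[OF z(1)] z(2) by metis
    thus ?thesis using z ms_props[OF z(1)] by (auto simp: S_def)
  qed
  moreover have "finite S" "S \<subseteq> V" using finite_V by (auto simp: S_def)
  ultimately obtain N where N: "length N \<le> card S" "set N \<subseteq> V \<times> V"
    and Nm: "\<And>z. z \<in> V \<Longrightarrow> rematches N m z = (if z \<in> S then ms z else if m z \<in> S then z else m z)"
    using impose_matching[OF m_mating, of S ms] by metis
  have eq: "rematches N m z = ms z" if z: "z \<in> V" for z
  proof (cases "z \<in> moved")
    case False
    hence "m z \<notin> moved" using mV[of "m z"] m_props[OF z] by auto
    thus ?thesis using False Nm[OF z] z by (auto simp: S_def)
  next
    case True
    show ?thesis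
    proof (cases "ms z = z")
      case False
      thus ?thesis using True Nm[OF z] by (simp add: S_def)
    next
      case ms_z: True
      have "ms (m z) \<noteq> m z"
      proof
        assume "ms (m z) = m z"
        moreover have "m z \<noteq> z" using True ms_z by simp
        ultimately show False
          using ms_max ms_z z m_props[OF z] by (auto simp: maximal_mating_def exposed_def)
      qed
      hence "m z \<in> S" using mV[OF True] by (simp add: S_def)
      thus ?thesis using ms_z True Nm[OF z] by (simp add: S_def)
    qed
  qed
  hence ex: "exposed (rematches N m) = exposed ms" by (auto simp: exposed_def)
  have "card S \<le> card moved" using finite_V by (intro card_mono) (auto simp: S_def)
  hence NL: "length N \<le> L" using N(1) few by linarith
  have "maximal_mating (rematches N m)"
    using mating_rematches[OF m_mating N(2)] ex ms_max by (simp add: maximal_mating_def)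
  from completion_of_maximal[OF completion_g this] unreached[OF NL N(2)] ex show False by simp
qed

text \<open>Every moved vertex lies in the component of an exposed vertex: on the union of the other
  components one could replace \<open>ms\<close> by \<open>m\<close> without changing the exposed vertices. Components have at
  most \<open>8 * r\<close> vertices, and \<open>m\<close> exposes at most \<open>D\<close>. As for the vertices exposed by \<open>ms\<close>, either all
  of them lie in components of vertices exposed by \<open>m\<close>, or resetting one of the other components shows
  that all but \<open>8 * r\<close> of them number at most \<open>D\<close>. So at most \<open>L\<close> vertices are moved.\<close>

lemma no_closest_unreached:
  assumes r: "8 ^ (8 * (2 * D + 4)) \<le> r" and L: "72 * r ^ 3 \<le> L"
  shows False
proof -
  have Dr: "D + 1 \<le> r"
  proof -
    have "D + 1 \<le> 2 ^ D" using less_exp[of D] by linarith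
    also have "(2::nat) ^ D \<le> 8 ^ D" by (rule power_mono) auto
    also have "(8::nat) ^ D \<le> 8 ^ (8 * (2 * D + 4))" by (rule power_increasing) auto
    finally show ?thesis using r by linarith
  qed
  have r1: "r * 1 \<le> r * (r * r)" using Dr by (intro mult_left_mono) auto
  have rL: "8 * r \<le> L" using r1 L unfolding power3_eq_cube mult.assoc by linarith
  define C where "C e = (SOME C. e \<in> C \<and> C \<subseteq> V \<and> card C \<le> 8 * r \<and> (\<forall>x\<in>C. m x \<in> C \<and> ms x \<in> C))" for e
  have C: "e \<in> C e" "C e \<subseteq> V" "card (C e) \<le> 8 * r" "\<And>x. x \<in> C e \<Longrightarrow> m x \<in> C e \<and> ms x \<in> C e"
    if "e \<in> exposed m \<union> exposed ms" for e
    using someI_ex[OF small_component[OF r rL that]] unfolding C_def[symmetric] by blast+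
  have un: "card (\<Union>e\<in>E. C e) \<le> card E * (8 * r)" if "E \<subseteq> exposed m \<union> exposed ms" for E
  proof -
    have "finite E" using that finite_exposed finite_subset by blast
    hence "card (\<Union>e\<in>E. C e) \<le> (\<Sum>e\<in>E. card (C e))" by (rule card_UN_le)
    also have "\<dots> \<le> (\<Sum>e\<in>E. 8 * r)" using C(3) that by (intro sum_mono) auto
    finally show ?thesis by simp
  qed
  have compl: "m z \<notin> B \<and> ms z \<notin> B" if "z \<in> V" "z \<notin> B" "\<And>x. x \<in> B \<Longrightarrow> m x \<in> B \<and> ms x \<in> B" for z B
    using that m_props(2) ms_props(2) by metis
  \<comment> \<open>The components of the vertices exposed by \<open>m\<close>.\<close>
  define SU where "SU = (\<Union>e\<in>exposed m. C e)"
  have SU: "x \<in> SU \<Longrightarrow> m x \<in> SU \<and> ms x \<in> SU" for x using C(4) by (auto simp: SU_def)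
  have cSU: "card SU \<le> D * (8 * r)"
    using un[of "exposed m"] card_exposed_m_le mult_le_mono1 unfolding SU_def by (metis Un_upper1 order_trans)
  have cardU: "card (exposed ms) \<le> (D + 1) * (8 * r)"
  proof (cases "exposed ms \<subseteq> SU")
    case True
    have "finite SU" using finite_V C(2) unfolding SU_def
      by (intro finite_subset[OF _ finite_V]) auto
    thus ?thesis using card_mono[OF _ True] cSU by fastforce
  next
    case False
    then obtain e where e: "e \<in> exposed ms" "e \<notin> SU" by blast
    have e': "e \<in> exposed m \<union> exposed ms" "e \<in> V" using e by (auto simp: exposed_def)
    define C' where "C' = C e - SU"
    have "card (exposed ms - C') \<le> D"
    proof (rule reset_closed_set(1))
      show "z \<in> V \<and> m z \<in> C' \<and> ms z \<in> C'" if "z \<in> C'" for z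
        using that C(2,4)[OF e'(1)] compl[OF _ _ SU, of z] unfolding C'_def by blast
      show "C' \<inter> exposed m = {}" using C(1) by (auto simp: C'_def SU_def)
      have "e \<notin> exposed m" using e(2) C(1) by (auto simp: SU_def)
      hence "e \<in> C' \<inter> moved" using e C(1)[OF e'(1)] by (auto simp: C'_def exposed_def)
      thus "C' \<inter> moved \<noteq> {}" by blast
    qed
    moreover have "card C' \<le> 8 * r" using C(2,3)[OF e'(1)] finite_V card_mono[of "C e" C']
      by (auto simp: C'_def intro: finite_subset order_trans)
    moreover have "card (exposed ms) - card C' \<le> card (exposed ms - C')"
      using C(2)[OF e'(1)] finite_V by (intro diff_card_le_card_Diff) (auto simp: C'_def intro: finite_subset)
    ultimately have "card (exposed ms) \<le> D + 8 * r" by linarith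
    moreover have "D * 1 \<le> D * (8 * r)" using Dr by (intro mult_left_mono) auto
    ultimately show ?thesis unfolding add_mult_distrib by linarith
  qed
  define W where "W = (\<Union>e\<in>exposed m \<union> exposed ms. C e)"
  have W: "x \<in> W \<Longrightarrow> m x \<in> W \<and> ms x \<in> W" for x using C(4) unfolding W_def by blast
  have "moved \<subseteq> W"
  proof (rule ccontr)
    assume "\<not> moved \<subseteq> W"
    hence ne: "(V - W) \<inter> moved \<noteq> {}" by auto
    have "(V - W) \<inter> exposed ms \<noteq> {}"
    proof (rule reset_closed_set(2)[OF _ _ ne])
      show "z \<in> V \<and> m z \<in> V - W \<and> ms z \<in> V - W" if "z \<in> V - W" for z
        using that m_props(1) ms_props(1) compl[OF _ _ W, of z] by blast
      show "(V - W) \<inter> exposed m = {}" using C(1) by (auto simp: W_def)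
    qed
    thus False using C(1) by (auto simp: W_def)
  qed
  moreover have "finite W" using C(2) unfolding W_def by (intro finite_subset[OF _ finite_V]) blast
  ultimately have "card moved \<le> card W" by (intro card_mono)
  also have "\<dots> \<le> card (exposed m \<union> exposed ms) * (8 * r)" unfolding W_def by (intro un) auto
  also have "\<dots> \<le> (r * r + r * (8 * r)) * (8 * r)"
  proof (rule mult_right_mono)
    have "card (exposed m \<union> exposed ms) \<le> D + (D + 1) * (8 * r)"
      using card_Un_le[of "exposed m" "exposed ms"] card_exposed_m_le cardU by linarith
    also have "\<dots> \<le> r * r + r * (8 * r)"
    proof (rule add_mono)
      show "(D + 1) * (8 * r) \<le> r * (8 * r)" using Dr by (intro mult_right_mono) auto
      have "D * 1 \<le> r * r" using Dr by (intro mult_mono) auto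
      thus "D \<le> r * r" by simp
    qed
    finally show "card (exposed m \<union> exposed ms) \<le> r * r + r * (8 * r)" .
  qed simp
  also have "\<dots> = 72 * r ^ 3" by (simp add: power3_eq_cube algebra_simps)
  finally show False using many_moved L by linarith
qed

end

context finite_graph begin

theorem all_exposures_reached:
  assumes g: "completion g" and m: "maximal_mating m" and L: "72 * (8 ^ (16 * D + 32)) ^ 3 \<le> L"
    and le: "\<And>N. length N \<le> L \<Longrightarrow> set N \<subseteq> V \<times> V \<Longrightarrow> card (exposed (g (rematches N m))) \<le> D"
    and ms: "maximal_mating ms"
  shows "\<exists>N. length N \<le> L \<and> set N \<subseteq> V \<times> V \<and> card (exposed (g (rematches N m))) = card (exposed ms)"
  using ms
proof (induction "card {x\<in>V. m x \<noteq> ms x}" arbitrary: ms rule: less_induct)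
  case less
  show ?case
  proof (rule ccontr)
    assume un: "\<not> ?case"
    interpret closest_unreached V adj g m ms L D
      by unfold_locales (use g m le less un in blast)+
    show False by (rule no_closest_unreached[OF _ L]) (simp add: algebra_simps)
  qed
qed

end

section \<open>Running times of random access machine programs\<close>

lemma bit_length_le_iff: "1 \<le> k \<Longrightarrow> bit_length x \<le> k \<longleftrightarrow> x < 2 ^ k"
  by (simp add: bit_length_def floorlog_le_iff)

lemma less_two_power_bit_length: "x < 2 ^ bit_length x"
  using bit_length_le_iff[of "bit_length x" x] by (simp add: bit_length_def)

lemma bit_length_ge_1: "1 \<le> bit_length x"
  by (simp add: bit_length_def)

lemma bit_length_mono: "x \<le> y \<Longrightarrow> bit_length x \<le> bit_length y"
  by (meson bit_length_ge_1 bit_length_le_iff le_less_trans less_two_power_bit_length)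

lemma bit_length_mult: "bit_length (x * y) \<le> bit_length x + bit_length y"
proof -
  have "x * y < 2 ^ bit_length x * 2 ^ bit_length y"
    by (intro mult_strict_mono less_two_power_bit_length) auto
  thus ?thesis using bit_length_le_iff[of "bit_length x + bit_length y" "x * y"] bit_length_ge_1[of x]
    by (simp add: power_add)
qed

lemma bit_length_add: "bit_length (x + y) \<le> bit_length x + bit_length y"
proof -
  define a b where "a = bit_length x" and "b = bit_length y"
  have ab: "1 \<le> a" "1 \<le> b" using bit_length_ge_1 by (auto simp: a_def b_def)
  have "x + 1 \<le> 2 ^ a" "y + 1 \<le> 2 ^ b"
    using less_two_power_bit_length[of x] less_two_power_bit_length[of y] by (auto simp: a_def b_def)
  hence "(x + 1) * (y + 1) \<le> 2 ^ a * 2 ^ b" by (rule mult_mono) auto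
  moreover have "x + y < (x + 1) * (y + 1)" by (simp add: algebra_simps)
  ultimately have "x + y < 2 ^ (a + b)" by (simp add: power_add)
  thus ?thesis using bit_length_le_iff[of "a + b" "x + y"] ab by (simp add: a_def b_def)
qed

lemma bit_length_power: "bit_length (x ^ i) \<le> Suc i * bit_length x"
proof (induction i)
  case 0
  have "bit_length 1 \<le> 1" by (simp add: bit_length_le_iff)
  thus ?case using bit_length_ge_1[of x] by simp
next
  case (Suc i)
  have "bit_length (x ^ Suc i) \<le> bit_length x + bit_length (x ^ i)"
    using bit_length_mult[of x "x ^ i"] by simp
  thus ?case using Suc by simp
qed

lemma bit_length_le_self: "1 \<le> x \<Longrightarrow> bit_length x \<le> x"
  by (simp add: bit_length_le_iff)

fun esize :: "expr \<Rightarrow> nat" where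
  "esize (Const c) = 1"
| "esize (Reg r) = 1"
| "esize (Mem a) = esize a + 1"
| "esize (Add a b) = esize a + esize b + 1"
| "esize (Sub a b) = esize a + esize b + 1"
| "esize (Mult a b) = esize a + esize b + 1"
| "esize (Div a b) = esize a + esize b + 1"

fun consts_le :: "nat \<Rightarrow> expr \<Rightarrow> bool" where
  "consts_le B (Const c) = (c \<le> B)"
| "consts_le B (Reg r) = True"
| "consts_le B (Mem a) = consts_le B a"
| "consts_le B (Add a b) = (consts_le B a \<and> consts_le B b)"
| "consts_le B (Sub a b) = (consts_le B a \<and> consts_le B b)"
| "consts_le B (Mult a b) = (consts_le B a \<and> consts_le B b)"
| "consts_le B (Div a b) = (consts_le B a \<and> consts_le B b)"

definition bounded_state :: "nat \<Rightarrow> state \<Rightarrow> bool" where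
  "bounded_state B s \<longleftrightarrow> (\<forall>r. fst s r \<le> B) \<and> (\<forall>a. snd s a \<le> B)"

text \<open>The result of an operation has at most as many bits as its arguments together.\<close>

lemma bit_length_expr_val:
  assumes "bounded_state B s"
  shows "consts_le B e \<Longrightarrow> bit_length (expr_val e s) \<le> esize e * bit_length B"
proof (induction e)
  case (Const c)
  thus ?case using bit_length_mono by auto
next
  case (Reg r)
  thus ?case using assms bit_length_mono by (auto simp: bounded_state_def)
next
  case (Mem a)
  have "bit_length (snd s (expr_val a s)) \<le> bit_length B"
    using assms bit_length_mono by (auto simp: bounded_state_def)
  thus ?case by simp
next
  case (Add a b)
  thus ?case using bit_length_add[of "expr_val a s" "expr_val b s"] by (simp add: algebra_simps)
next
  case (Sub a b)
  thus ?case using bit_length_mono[of "expr_val a s - expr_val b s" "expr_val a s"] by (simp add: algebra_simps)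
next
  case (Mult a b)
  thus ?case using bit_length_mult[of "expr_val a s" "expr_val b s"] by (simp add: algebra_simps)
next
  case (Div a b)
  thus ?case using bit_length_mono[of "expr_val a s div expr_val b s" "expr_val a s"] by (simp add: algebra_simps)
qed

lemma expr_cost_le:
  assumes "bounded_state B s"
  shows "consts_le B e \<Longrightarrow> expr_cost e s \<le> esize e * esize e * bit_length B"
proof -
  have bin: "ca + cb + c \<le> (x + y + 1) * (x + y + 1) * l"
    if "ca \<le> x * x * l" "cb \<le> y * y * l" "c \<le> (x + y + 1) * l" for ca cb c x y l :: nat
  proof -
    have "ca + cb + c \<le> x * x * l + y * y * l + (x + y + 1) * l" using that by linarith
    also have "\<dots> = (x * x + y * y + (x + y + 1)) * l" by (simp only: add_mult_distrib)
    also have "\<dots> \<le> (x + y + 1) * (x + y + 1) * l"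
      by (intro mult_right_mono) (simp_all add: algebra_simps)
    finally show ?thesis .
  qed
  note val = bit_length_expr_val[OF assms]
  show "consts_le B e \<Longrightarrow> expr_cost e s \<le> esize e * esize e * bit_length B"
  proof (induction e)
    case (Const c)
    thus ?case using bit_length_mono by auto
  next
    case (Reg r)
    thus ?case using assms bit_length_mono by (auto simp: bounded_state_def)
  next
    case (Mem a)
    have "bit_length (snd s (expr_val a s)) \<le> bit_length B"
      using assms bit_length_mono by (auto simp: bounded_state_def)
    thus ?case using Mem by (simp add: algebra_simps)
  next
    case (Add a b)
    thus ?case using bin[OF Add.IH(1) Add.IH(2) val[of "Add a b", unfolded esize.simps]] by simp
  next
    case (Sub a b)
    thus ?case using bin[OF Sub.IH(1) Sub.IH(2) val[of "Sub a b", unfolded esize.simps]] by simp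
  next
    case (Mult a b)
    thus ?case using bin[OF Mult.IH(1) Mult.IH(2) val[of "Mult a b", unfolded esize.simps]] by simp
  next
    case (Div a b)
    thus ?case using bin[OF Div.IH(1) Div.IH(2) val[of "Div a b", unfolded esize.simps]] by simp
  qed
qed

text \<open>The bound on the size holds for all expressions of the program below; it makes the cost
  of a step uniform.\<close>

definition fits :: "nat \<Rightarrow> expr \<Rightarrow> bool" where
  "fits B e \<longleftrightarrow> esize e \<le> 16 \<and> consts_le B e"

text \<open>A store evaluates two expressions, each of cost at most \<open>256 * bit_length B\<close>.\<close>

definition step_cost :: "nat \<Rightarrow> nat" where
  "step_cost B = 600 * bit_length B"

lemma fits_cost:
  assumes "bounded_state B s" "fits B e"
  shows "expr_cost e s \<le> 256 * bit_length B"
proof -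
  have "expr_cost e s \<le> esize e * esize e * bit_length B"
    using expr_cost_le[OF assms(1)] assms(2) by (simp add: fits_def)
  also have "\<dots> \<le> (16 * 16) * bit_length B"
    using assms(2) by (intro mult_right_mono mult_mono) (auto simp: fits_def)
  finally show ?thesis by simp
qed

text \<open>Total correctness with running time, for runs in which all contents stay below \<open>B\<close>. The
  time \<open>T\<close> counts assignments, stores and tests.\<close>

definition runs :: "nat \<Rightarrow> prog \<Rightarrow> state \<Rightarrow> nat \<Rightarrow> (state \<Rightarrow> bool) \<Rightarrow> bool" where
  "runs B c s T Q \<longleftrightarrow> (bounded_state B s \<longrightarrow>
     (\<exists>t s'. exec c s t s' \<and> t \<le> T * step_cost B \<and> bounded_state B s' \<and> Q s'))"

lemma runs_weaken:
  assumes "runs B c s T Q" "T \<le> T'" "\<And>s'. Q s' \<Longrightarrow> Q' s'"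
  shows "runs B c s T' Q'"
  using assms unfolding runs_def by (meson mult_le_mono1 order_trans)

lemma runs_Skip: "Q s \<Longrightarrow> runs B Skip s 1 Q"
  unfolding runs_def using bit_length_ge_1[of B]
  by (intro impI exI[of _ 1] exI[of _ s]) (simp add: exec.Skip[simplified] step_cost_def)

lemma runs_Assign:
  assumes "fits B e" "expr_val e s \<le> B" "Q ((fst s)(r := expr_val e s), snd s)"
  shows "runs B (Assign r e) s 1 Q"
  unfolding runs_def
proof
  assume b: "bounded_state B s"
  have "1 + expr_cost e s \<le> 1 * step_cost B"
    using fits_cost[OF b assms(1)] bit_length_ge_1[of B] by (simp add: step_cost_def)
  moreover have "bounded_state B ((fst s)(r := expr_val e s), snd s)"
    using b assms(2) by (auto simp: bounded_state_def)
  ultimately show "\<exists>t s'. exec (Assign r e) s t s' \<and> t \<le> 1 * step_cost B \<and> bounded_state B s' \<and> Q s'"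
    using exec.Assign assms(3) by blast
qed

lemma runs_Store:
  assumes "fits B e" "fits B e'" "expr_val e' s \<le> B" "Q (fst s, (snd s)(expr_val e s := expr_val e' s))"
  shows "runs B (Store e e') s 1 Q"
  unfolding runs_def
proof
  assume b: "bounded_state B s"
  have "1 + expr_cost e s + expr_cost e' s \<le> 1 * step_cost B"
    using fits_cost[OF b assms(1)] fits_cost[OF b assms(2)] bit_length_ge_1[of B] by (simp add: step_cost_def)
  moreover have "bounded_state B (fst s, (snd s)(expr_val e s := expr_val e' s))"
    using b assms(3) by (auto simp: bounded_state_def)
  ultimately show "\<exists>t s'. exec (Store e e') s t s' \<and> t \<le> 1 * step_cost B \<and> bounded_state B s' \<and> Q s'"
    using exec.Store assms(4) by blast
qed

lemma runs_Seq:
  assumes "runs B c1 s T1 (\<lambda>s'. runs B c2 s' T2 Q)"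
  shows "runs B (Seq c1 c2) s (T1 + T2) Q"
  unfolding runs_def
proof
  assume "bounded_state B s"
  with assms obtain t1 s1 where 1: "exec c1 s t1 s1" "t1 \<le> T1 * step_cost B" "bounded_state B s1" "runs B c2 s1 T2 Q"
    unfolding runs_def by blast
  then obtain t2 s2 where 2: "exec c2 s1 t2 s2" "t2 \<le> T2 * step_cost B" "bounded_state B s2" "Q s2"
    unfolding runs_def by blast
  have "t1 + t2 \<le> (T1 + T2) * step_cost B" using 1(2) 2(2) by (simp add: add_mult_distrib)
  thus "\<exists>t s'. exec (Seq c1 c2) s t s' \<and> t \<le> (T1 + T2) * step_cost B \<and> bounded_state B s' \<and> Q s'"
    using exec.Seq[OF 1(1) 2(1)] 2 by blast
qed

lemma runs_If:
  assumes "fits B e" "expr_val e s \<noteq> 0 \<Longrightarrow> runs B c1 s T1 Q" "expr_val e s = 0 \<Longrightarrow> runs B c2 s T2 Q"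
  shows "runs B (If e c1 c2) s (1 + T1 + T2) Q"
  unfolding runs_def
proof
  assume b: "bounded_state B s"
  have c: "1 + expr_cost e s \<le> step_cost B"
    using fits_cost[OF b assms(1)] bit_length_ge_1[of B] by (simp add: step_cost_def)
  show "\<exists>t s'. exec (If e c1 c2) s t s' \<and> t \<le> (1 + T1 + T2) * step_cost B \<and> bounded_state B s' \<and> Q s'"
  proof (cases "expr_val e s = 0")
    case False
    then obtain t s' where *: "exec c1 s t s'" "t \<le> T1 * step_cost B" "bounded_state B s'" "Q s'"
      using assms(2) b unfolding runs_def by blast
    have "1 + expr_cost e s + t \<le> (1 + T1 + T2) * step_cost B"
      using c *(2) by (simp add: add_mult_distrib)
    thus ?thesis using exec.IfTrue[OF False *(1)] * by blast
  next
    case True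
    then obtain t s' where *: "exec c2 s t s'" "t \<le> T2 * step_cost B" "bounded_state B s'" "Q s'"
      using assms(3) b unfolding runs_def by blast
    have "1 + expr_cost e s + t \<le> (1 + T1 + T2) * step_cost B"
      using c *(2) by (simp add: add_mult_distrib)
    thus ?thesis using exec.IfFalse[OF True *(1)] * by blast
  qed
qed

lemma runs_While_False:
  assumes "fits B e" "expr_val e s = 0" "Q s"
  shows "runs B (While e c) s 1 Q"
  unfolding runs_def
proof
  assume b: "bounded_state B s"
  have "1 + expr_cost e s \<le> 1 * step_cost B"
    using fits_cost[OF b assms(1)] bit_length_ge_1[of B] by (simp add: step_cost_def)
  thus "\<exists>t s'. exec (While e c) s t s' \<and> t \<le> 1 * step_cost B \<and> bounded_state B s' \<and> Q s'"
    using exec.WhileFalse[OF assms(2)] b assms(3) by blast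
qed

lemma runs_While_True:
  assumes "fits B e" "expr_val e s \<noteq> 0" "runs B c s T1 (\<lambda>s'. runs B (While e c) s' T2 Q)"
  shows "runs B (While e c) s (1 + T1 + T2) Q"
  unfolding runs_def
proof
  assume b: "bounded_state B s"
  have c: "1 + expr_cost e s \<le> step_cost B"
    using fits_cost[OF b assms(1)] bit_length_ge_1[of B] by (simp add: step_cost_def)
  from b assms(3) obtain t1 s1 where 1: "exec c s t1 s1" "t1 \<le> T1 * step_cost B" "bounded_state B s1"
      "runs B (While e c) s1 T2 Q"
    unfolding runs_def by blast
  then obtain t2 s2 where 2: "exec (While e c) s1 t2 s2" "t2 \<le> T2 * step_cost B" "bounded_state B s2" "Q s2"
    unfolding runs_def by blast
  have "1 + expr_cost e s + t1 + t2 \<le> (1 + T1 + T2) * step_cost B"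
    using c 1(2) 2(2) by (simp add: add_mult_distrib)
  thus "\<exists>t s'. exec (While e c) s t s' \<and> t \<le> (1 + T1 + T2) * step_cost B \<and> bounded_state B s' \<and> Q s'"
    using exec.WhileTrue[OF assms(2) 1(1) 2(1)] 2 by blast
qed

text \<open>The expression \<open>e\<close> is evaluated before every iteration, so the body must preserve its value.\<close>

definition For :: "nat \<Rightarrow> expr \<Rightarrow> prog \<Rightarrow> prog" where
  "For r e c = Seq (Assign r (Const 0))
     (While (Sub e (Reg r)) (Seq c (Assign r (Add (Reg r) (Const 1)))))"

text \<open>Each iteration has two steps besides its body, the test and the increment; the other two
  are the initial assignment and the last test. The invariant \<open>I i\<close> holds before iteration \<open>i\<close>.\<close>

lemma runs_For:
  assumes fits: "esize e \<le> 8" "consts_le B e" and N: "N \<le> B" "1 \<le> B"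
    and init: "I 0 ((fst s)(r := 0), snd s)"
    and body: "\<And>i s. i < N \<Longrightarrow> I i s \<Longrightarrow> fst s r = i \<Longrightarrow>
      runs B c s T (\<lambda>s'. fst s' r = i \<and> I (Suc i) ((fst s')(r := Suc i), snd s'))"
    and val: "\<And>i s. i \<le> N \<Longrightarrow> I i s \<Longrightarrow> fst s r = i \<Longrightarrow> expr_val e s = N"
    and fin: "\<And>s. I N s \<Longrightarrow> fst s r = N \<Longrightarrow> Q s"
  shows "runs B (For r e c) s (N * (T + 2) + 2) Q"
proof -
  let ?w = "While (Sub e (Reg r)) (Seq c (Assign r (Add (Reg r) (Const 1))))"
  have f: "fits B (Sub e (Reg r))" using fits by (simp add: fits_def)
  have loop: "runs B ?w s ((N - i) * (T + 2) + 1) Q" if "i \<le> N" "I i s" "fst s r = i" for i s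
    using that
  proof (induction "N - i" arbitrary: i s)
    case 0
    hence "expr_val (Sub e (Reg r)) s = 0" "Q s" using val[of i s] fin[of s] by auto
    thus ?case using runs_While_False[OF f] 0 by simp
  next
    case (Suc d)
    hence i: "i < N" by linarith
    have ne: "expr_val (Sub e (Reg r)) s \<noteq> 0" using val[of i s] Suc.prems i by simp
    have "runs B ?w s (1 + (T + 1) + ((N - Suc i) * (T + 2) + 1)) Q"
    proof (rule runs_While_True[OF f ne])
      show "runs B (Seq c (Assign r (Add (Reg r) (Const 1)))) s (T + 1)
         (\<lambda>s'. runs B ?w s' ((N - Suc i) * (T + 2) + 1) Q)"
      proof (rule runs_Seq, rule runs_weaken[OF body[OF i Suc.prems(2,3)] order_refl], elim conjE)
        fix s' assume s': "fst s' r = i" "I (Suc i) ((fst s')(r := Suc i), snd s')"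
        have "runs B ?w ((fst s')(r := Suc i), snd s') ((N - Suc i) * (T + 2) + 1) Q"
          by (rule Suc.hyps(1)) (use Suc.hyps(2) i s'(2) in auto)
        thus "runs B (Assign r (Add (Reg r) (Const 1))) s' 1
            (\<lambda>s'. runs B ?w s' ((N - Suc i) * (T + 2) + 1) Q)"
          using s'(1) i N by (intro runs_Assign) (simp_all add: fits_def)
      qed
    qed
    moreover have "1 + (T + 1) + ((N - Suc i) * (T + 2) + 1) = (N - i) * (T + 2) + 1"
      using i by (simp add: Suc_diff_Suc[symmetric])
    ultimately show ?case by simp
  qed
  have "runs B (For r e c) s (1 + (N * (T + 2) + 1)) Q"
    unfolding For_def
    apply (rule runs_Seq)
    apply (rule runs_Assign)
    using loop[of 0] init by (auto simp: fits_def)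
  thus ?thesis by simp
qed

section \<open>A program for the matching gap\<close>

text \<open>Names for the registers. Register 0 is reserved for the answer.\<close>

abbreviation (input) "rn \<equiv> 19 :: nat"
abbreviation (input) "rnn \<equiv> 2 :: nat"
abbreviation (input) "rbase \<equiv> 3 :: nat"
abbreviation (input) "rD \<equiv> 4 :: nat"
abbreviation (input) "rL \<equiv> 5 :: nat"
abbreviation (input) "rP \<equiv> 6 :: nat"
abbreviation (input) "rX \<equiv> 7 :: nat"
abbreviation (input) "rY \<equiv> 8 :: nat"
abbreviation (input) "ri \<equiv> 9 :: nat"
abbreviation (input) "rc \<equiv> 10 :: nat"
abbreviation (input) "rx \<equiv> 11 :: nat"
abbreviation (input) "ry \<equiv> 12 :: nat"
abbreviation (input) "ru \<equiv> 13 :: nat"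
abbreviation (input) "rv \<equiv> 14 :: nat"
abbreviation (input) "rhi \<equiv> 15 :: nat"
abbreviation (input) "rlo \<equiv> 16 :: nat"
abbreviation (input) "rcnt \<equiv> 17 :: nat"
abbreviation (input) "rgo \<equiv> 18 :: nat"

abbreviation seq_prog :: "prog \<Rightarrow> prog \<Rightarrow> prog" (infixr ";;" 60) where "c1 ;; c2 \<equiv> Seq c1 c2"
text \<open>The partner of vertex \<open>x\<close> is stored at address \<open>n * n + 2 + x\<close>, behind the input. A pair
  of vertices \<open>x\<close> and \<open>y\<close> has the code \<open>x * n + y\<close>, which is also its position in the adjacency matrix; the
  matrix starts at address 2. Since subtraction is truncated, \<open>differ\<close> is 0 iff its arguments are equal.\<close>

abbreviation "mate_addr e \<equiv> Add (Reg rbase) e"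
abbreviation "mate_of e \<equiv> Mem (mate_addr e)"
abbreviation "differ a b \<equiv> Add (Sub a b) (Sub b a)"
abbreviation "edge_flag \<equiv> Mem (Add (Reg rc) (Const 2))"

definition split_code :: prog where
  "split_code = Assign rx (Div (Reg rc) (Reg rn)) ;;
     Assign ry (Sub (Reg rc) (Mult (Reg rx) (Reg rn)))"

definition rematch_prog :: prog where
  "rematch_prog = split_code ;;
     Assign ru (mate_of (Reg rx)) ;; Assign rv (mate_of (Reg ry)) ;;
     Store (mate_addr (Reg ru)) (Reg ru) ;; Store (mate_addr (Reg rv)) (Reg rv) ;;
     Store (mate_addr (Reg rx)) (Reg ry) ;; Store (mate_addr (Reg ry)) (Reg rx)"

definition init_prog :: prog where
  "init_prog = For rc (Reg rn) (Store (mate_addr (Reg rc)) (Reg rc))"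

definition greedy_prog :: prog where
  "greedy_prog = For rc (Reg rnn) (If edge_flag
     (split_code ;; If (differ (mate_of (Reg rx)) (Reg rx)) Skip
       (If (differ (mate_of (Reg ry)) (Reg ry)) Skip rematch_prog)) Skip)"

text \<open>A sequence of moves is a number \<open>X\<close> whose digits in base \<open>n * n\<close> are codes of pairs, the
  first move being the least significant digit. Digits that do not code an edge are skipped.\<close>

definition moves_prog :: prog where
  "moves_prog = Assign rY (Reg rX) ;; For ri (Reg rL)
     (Assign rc (Sub (Reg rY) (Mult (Div (Reg rY) (Reg rnn)) (Reg rnn))) ;;
      Assign rY (Div (Reg rY) (Reg rnn)) ;;
      If edge_flag rematch_prog Skip)"

definition count_prog :: prog where
  "count_prog = Assign rcnt (Const 0) ;; For rc (Reg rn)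
     (If (differ (mate_of (Reg rc)) (Reg rc)) Skip (Assign rcnt (Add (Reg rcnt) (Const 1))))"

definition try_prog :: prog where
  "try_prog = init_prog ;; greedy_prog ;; moves_prog ;; greedy_prog ;; count_prog ;;
     If (Sub (Reg rcnt) (Reg rhi)) (Assign rhi (Reg rcnt)) Skip ;;
     If (Sub (Reg rlo) (Reg rcnt)) (Assign rlo (Reg rcnt)) Skip"

definition phase_prog :: prog where
  "phase_prog = Assign rP (Const 1) ;; For ri (Reg rL) (Assign rP (Mult (Reg rP) (Reg rnn))) ;;
     Assign rhi (Const 0) ;; Assign rlo (Reg rn) ;; For rX (Reg rP) try_prog"

text \<open>The functions computed by the greedy loop and by the loop over the moves, after \<open>c\<close> and \<open>i\<close>
  iterations respectively. \<open>E\<close> tells which codes are edges.\<close>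

primrec greedy_upto :: "nat \<Rightarrow> (nat \<Rightarrow> bool) \<Rightarrow> (nat \<Rightarrow> nat) \<Rightarrow> nat \<Rightarrow> nat \<Rightarrow> nat" where
  "greedy_upto n E m 0 = m"
| "greedy_upto n E m (Suc c) = (let m' = greedy_upto n E m c in
     if E c \<and> m' (c div n) = c div n \<and> m' (c mod n) = c mod n then rematch (c div n) (c mod n) m' else m')"

primrec moves_upto :: "nat \<Rightarrow> (nat \<Rightarrow> bool) \<Rightarrow> nat \<Rightarrow> (nat \<Rightarrow> nat) \<Rightarrow> nat \<Rightarrow> nat \<Rightarrow> nat" where
  "moves_upto n E X m 0 = m"
| "moves_upto n E X m (Suc i) = (let m' = moves_upto n E X m i; c = X div (n * n) ^ i mod (n * n) in
     if E c then rematch (c div n) (c mod n) m' else m')"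

abbreviation greedy :: "nat \<Rightarrow> (nat \<Rightarrow> bool) \<Rightarrow> (nat \<Rightarrow> nat) \<Rightarrow> nat \<Rightarrow> nat" where
  "greedy n E m \<equiv> greedy_upto n E m (n * n)"

definition trial :: "nat \<Rightarrow> (nat \<Rightarrow> bool) \<Rightarrow> nat \<Rightarrow> nat \<Rightarrow> nat" where
  "trial n E L X = card {x. x < n \<and> greedy n E (moves_upto n E X (greedy n E (\<lambda>x. x)) L) x = x}"

lemma code_split_less:
  fixes c n :: nat
  assumes "c < n * n"
  shows "c div n < n" "c mod n < n"
  using assms by (cases "n = 0"; simp add: less_mult_imp_div_less)+

lemma rematch_less:
  "\<forall>x<n. m x < n \<Longrightarrow> a < n \<Longrightarrow> b < n \<Longrightarrow> \<forall>x<n. rematch a b m x < n"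
  by (auto simp: rematch_def)

lemma greedy_upto_less: "\<forall>x<n. m x < n \<Longrightarrow> c \<le> n * n \<Longrightarrow> \<forall>x<n. greedy_upto n E m c x < n"
proof (induction c)
  case (Suc c)
  thus ?case using code_split_less[of c n] rematch_less[of n "greedy_upto n E m c"] by (auto simp: Let_def)
qed simp

lemma moves_upto_less: "\<forall>x<n. m x < n \<Longrightarrow> \<forall>x<n. moves_upto n E X m i x < n"
proof (cases "n = 0")
  case False
  assume "\<forall>x<n. m x < n"
  thus ?thesis
  proof (induction i)
    case (Suc i)
    thus ?case using False code_split_less[of "X div (n * n) ^ i mod (n * n)" n]
        rematch_less[of n "moves_upto n E X m i"] by (simp add: Let_def)
  qed simp
qed simp

text \<open>The input has \<open>n\<close> vertices, threshold \<open>k\<close> and adjacency matrix \<open>E\<close>, and \<open>B\<close> bounds all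
  contents of registers and memory. The lower bound for \<open>B\<close> makes room for addresses.\<close>

locale gap_machine =
  fixes n k :: nat and E :: "nat \<Rightarrow> bool" and B :: nat
  assumes B_n: "n * n + n + 2 \<le> B"
begin

definition env :: "state \<Rightarrow> bool" where
  "env s \<longleftrightarrow> snd s 0 = n \<and> snd s 1 = k \<and> (\<forall>c<n * n. snd s (c + 2) = (if E c then 1 else 0)) \<and>
     fst s rn = n \<and> fst s rnn = n * n \<and> fst s rbase = n * n + 2"

definition mates :: "(nat \<Rightarrow> nat) \<Rightarrow> state \<Rightarrow> bool" where
  "mates m s \<longleftrightarrow> (\<forall>x<n. snd s (n * n + 2 + x) = m x)"

definition keeps :: "nat set \<Rightarrow> state \<Rightarrow> state \<Rightarrow> bool" where
  "keeps X s s' \<longleftrightarrow> (\<forall>r. r \<notin> X \<longrightarrow> fst s' r = fst s r)"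

lemma keeps_trans: "keeps X s s' \<Longrightarrow> keeps X s' s'' \<Longrightarrow> keeps X s s''"
  by (simp add: keeps_def)

lemma keepsD: "keeps X s s' \<Longrightarrow> r \<notin> X \<Longrightarrow> fst s' r = fst s r"
  by (simp add: keeps_def)

lemma B_bounds: "n \<le> B" "n * n \<le> B" "1 \<le> B" "2 \<le> B"
  using B_n by auto

lemma runs_split_code:
  assumes "env s" "fst s rc < n * n"
    and "Q ((fst s)(rx := fst s rc div n, ry := fst s rc mod n), snd s)"
  shows "runs B split_code s 2 Q"
proof -
  have s: "fst s rn = n" using assms(1) by (simp add: env_def)
  have le: "fst s rc div n \<le> B" "fst s rc mod n \<le> B"
    using code_split_less[OF assms(2)] B_n by linarith+
  have "runs B split_code s (1 + 1) Q"
    unfolding split_code_def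
    apply (rule runs_Seq)
    apply (rule runs_Assign)
    subgoal by (simp add: fits_def)
    subgoal using s le by simp
    apply (rule runs_Assign)
    subgoal by (simp add: fits_def)
    subgoal using s le by (simp add: minus_div_mult_eq_mod)
    subgoal using s assms(3) by (simp add: minus_div_mult_eq_mod)
    done
  from runs_weaken[OF this] show ?thesis by simp
qed

lemma env_cong:
  "env s \<Longrightarrow> fst s' rn = fst s rn \<Longrightarrow> fst s' rnn = fst s rnn \<Longrightarrow> fst s' rbase = fst s rbase \<Longrightarrow>
    (\<And>a. a < n * n + 2 \<Longrightarrow> snd s' a = snd s a) \<Longrightarrow> env s'"
  by (simp add: env_def)

lemma mates_cong: "mates m s \<Longrightarrow> snd s' = snd s \<Longrightarrow> mates m s'"
  by (simp add: mates_def)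

lemma mate_val: "env s \<Longrightarrow> mates m s \<Longrightarrow> fst s r < n \<Longrightarrow> expr_val (mate_of (Reg r)) s = m (fst s r)"
  by (simp add: env_def mates_def)

lemma runs_load_mate:
  assumes "env s" "mates m s" "fst s r' < n" "\<forall>x<n. m x < n" "r \<notin> {rn, rnn, rbase}"
  shows "runs B (Assign r (mate_of (Reg r'))) s 1
    (\<lambda>s'. env s' \<and> mates m s' \<and> fst s' = (fst s)(r := m (fst s r')))"
proof (rule runs_Assign)
  have "m (fst s r') < n" using assms by blast
  thus "expr_val (mate_of (Reg r')) s \<le> B" unfolding mate_val[OF assms(1-3)] using B_n by linarith
  show "env ((fst s)(r := expr_val (mate_of (Reg r')) s), snd s) \<and>
    mates m ((fst s)(r := expr_val (mate_of (Reg r')) s), snd s) \<and>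
    fst ((fst s)(r := expr_val (mate_of (Reg r')) s), snd s) = (fst s)(r := m (fst s r'))"
    unfolding mate_val[OF assms(1-3)] using assms by (auto intro: env_cong mates_cong)
qed (simp add: fits_def)

lemma runs_store_mate:
  assumes "env s" "mates m s" "fst s r < n" "fst s r' \<le> B"
  shows "runs B (Store (mate_addr (Reg r)) (Reg r')) s 1
    (\<lambda>s'. env s' \<and> mates (m(fst s r := fst s r')) s' \<and> fst s' = fst s)"
proof (rule runs_Store)
  have v: "expr_val (mate_addr (Reg r)) s = n * n + 2 + fst s r" using assms(1) by (simp add: env_def)
  show "env (fst s, (snd s)(expr_val (mate_addr (Reg r)) s := expr_val (Reg r') s)) \<and>
     mates (m(fst s r := fst s r')) (fst s, (snd s)(expr_val (mate_addr (Reg r)) s := expr_val (Reg r') s)) \<and>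
     fst (fst s, (snd s)(expr_val (mate_addr (Reg r)) s := expr_val (Reg r') s)) = fst s"
    unfolding v using assms by (auto simp: mates_def intro: env_cong)
qed (use assms(4) in \<open>simp_all add: fits_def\<close>)

lemma runs_rematch_prog:
  assumes s: "env s" "mates m s" and c: "fst s rc = c" "c < n * n" and m: "\<forall>x<n. m x < n"
  shows "runs B rematch_prog s 8 (\<lambda>s'. env s' \<and> mates (rematch (c div n) (c mod n) m) s' \<and>
    keeps {rx, ry, ru, rv} s s')"
proof -
  note xy = code_split_less[OF c(2)]
  note mxy = m[rule_format, OF xy(1)] m[rule_format, OF xy(2)]
  have le: "c div n \<le> B" "c mod n \<le> B" "m (c div n) \<le> B" "m (c mod n) \<le> B"
    using xy mxy B_n by linarith+
  have "runs B rematch_prog s (2 + (1 + (1 + (1 + (1 + (1 + 1)))))) (\<lambda>s'. env s' \<and> mates (rematch (c div n) (c mod n) m) s' \<and>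
    keeps {rx, ry, ru, rv} s s')"
    unfolding rematch_prog_def
  proof (rule runs_Seq, rule runs_split_code[OF s(1)], goal_cases)
    case 2
    let ?s = "((fst s)(rx := fst s rc div n, ry := fst s rc mod n), snd s)"
    have 0: "env ?s" "mates m ?s" using s by (auto intro: env_cong mates_cong)
    show ?case
      apply (rule runs_Seq, rule runs_weaken[OF runs_load_mate[OF 0] order_refl])
      subgoal using c xy by simp
      subgoal using m .
      subgoal by simp
      apply (elim conjE, rule runs_Seq, rule runs_weaken[OF runs_load_mate order_refl], assumption+)
      subgoal using c xy by simp
      subgoal using m .
      subgoal by simp
      apply (elim conjE, rule runs_Seq, rule runs_weaken[OF runs_store_mate order_refl], assumption+)
      subgoal using c mxy by simp
      subgoal using c le by simp
      apply (elim conjE, rule runs_Seq, rule runs_weaken[OF runs_store_mate order_refl], assumption+)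
      subgoal using c mxy by simp
      subgoal using c le by simp
      apply (elim conjE, rule runs_Seq, rule runs_weaken[OF runs_store_mate order_refl], assumption+)
      subgoal using c xy by simp
      subgoal using c le by simp
      apply (elim conjE, rule runs_weaken[OF runs_store_mate order_refl], assumption+)
      subgoal using c xy by simp
      subgoal using c le by simp
      subgoal using c by (simp add: keeps_def rematch_def)
      done
  qed (use c in simp)
  from runs_weaken[OF this] show ?thesis by simp
qed

end

section \<open>Running the program\<close>

lemma differ_eq_0: "expr_val (differ a b) s = 0 \<longleftrightarrow> expr_val a s = expr_val b s"
  by auto

context gap_machine begin

lemma env_reg [simp]: "r \<notin> {rn, rnn, rbase} \<Longrightarrow> env (R(r := v), M) \<longleftrightarrow> env (R, M)"
  by (auto simp: env_def)

lemma mates_reg [simp]: "mates m (R(r := v), M) \<longleftrightarrow> mates m (R, M)"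
  by (simp add: mates_def)

lemma keeps_reg [simp]: "r \<in> X \<Longrightarrow> keeps X s (R(r := v), M) \<longleftrightarrow> keeps X s (R, M)"
  by (auto simp: keeps_def)

lemma keeps_refl [simp]: "keeps X s s"
  by (simp add: keeps_def)

lemma edge_flag_val: "env s \<Longrightarrow> fst s rc < n * n \<Longrightarrow> expr_val edge_flag s \<noteq> 0 \<longleftrightarrow> E (fst s rc)"
  by (simp add: env_def)

lemma runs_init_prog:
  assumes "env s"
  shows "runs B init_prog s (n * 3 + 2) (\<lambda>s'. env s' \<and> mates (\<lambda>x. x) s' \<and> keeps {rc} s s')"
proof -
  let ?I = "\<lambda>i s'. env s' \<and> keeps {rc} s s' \<and> (\<exists>m. mates m s' \<and> (\<forall>x<i. m x = x))"
  have "runs B init_prog s (n * (1 + 2) + 2) (\<lambda>s'. env s' \<and> mates (\<lambda>x. x) s' \<and> keeps {rc} s s')"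
    unfolding init_prog_def
  proof (rule runs_For[where I = ?I])
    have "mates (\<lambda>x. snd s (n * n + 2 + x)) ((fst s)(rc := 0), snd s)" by (simp add: mates_def)
    hence "\<exists>m. mates m ((fst s)(rc := 0), snd s)" by blast
    thus "?I 0 ((fst s)(rc := 0), snd s)"
      using assms by simp
  next
    fix i s1 assume i: "i < n" and I: "?I i s1" and c: "fst s1 rc = i"
    then obtain m where m: "mates m s1" "\<forall>x<i. m x = x" by blast
    show "runs B (Store (mate_addr (Reg rc)) (Reg rc)) s1 1
      (\<lambda>s'. fst s' rc = i \<and> ?I (Suc i) ((fst s')(rc := Suc i), snd s'))"
    proof (rule runs_weaken[OF runs_store_mate[of s1 m] order_refl])
      fix s' assume s': "env s' \<and> mates (m(fst s1 rc := fst s1 rc)) s' \<and> fst s' = fst s1"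
      have "mates (m(i := i)) ((fst s')(rc := Suc i), snd s')" using s' unfolding c by (simp add: mates_def)
      moreover have "\<forall>x<Suc i. (m(i := i)) x = x" using m(2) by (auto simp: less_Suc_eq)
      moreover have "keeps {rc} s s'" using I s' by (simp add: keeps_def)
      moreover have "env s'" "fst s' rc = i" using s' c by auto
      ultimately show "fst s' rc = i \<and> ?I (Suc i) ((fst s')(rc := Suc i), snd s')"
        by (intro conjI exI[of _ "m(i := i)"]) simp_all
    qed (use I i c m B_n in auto)
  next
    fix s1 assume "?I n s1"
    then show "env s1 \<and> mates (\<lambda>x. x) s1 \<and> keeps {rc} s s1" by (auto simp: mates_def)
  qed (use B_n in \<open>auto simp: env_def\<close>)
  thus ?thesis by (rule runs_weaken) auto
qed

text \<open>The invariant after \<open>c\<close> iterations is that memory holds \<open>greedy_upto n E m c\<close>; an iteration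
  takes at most 16 steps.\<close>

lemma runs_greedy_prog:
  assumes s: "env s" "mates m s" and m: "\<forall>x<n. m x < n"
  shows "runs B greedy_prog s (n * n * 18 + 2)
    (\<lambda>s'. env s' \<and> mates (greedy n E m) s' \<and> keeps {rc, rx, ry, ru, rv} s s')"
proof -
  let ?X = "{rc, rx, ry, ru, rv}"
  let ?I = "\<lambda>c s'. env s' \<and> mates (greedy_upto n E m c) s' \<and> keeps ?X s s'"
  have "runs B greedy_prog s (n * n * (16 + 2) + 2) (\<lambda>s'. ?I (n * n) s')"
    unfolding greedy_prog_def
  proof (rule runs_For[where I = ?I])
    show "?I 0 ((fst s)(rc := 0), snd s)"
      using s by simp
  next
    fix c s1 assume c: "c < n * n" and I: "?I c s1" and rc: "fst s1 rc = c"
    let ?m = "greedy_upto n E m c"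
    let ?x = "c div n" and ?y = "c mod n"
    have less: "\<forall>x<n. ?m x < n" using greedy_upto_less[OF m] c by simp
    note xy = code_split_less[OF c]
    let ?Q = "\<lambda>s'. fst s' rc = c \<and> ?I (Suc c) ((fst s')(rc := Suc c), snd s')"
    have finish: "?Q s'" if "env s'" "mates (greedy_upto n E m (Suc c)) s'" "keeps {rx, ry, ru, rv} s1 s'" for s'
    proof -
      have "keeps ?X s s'" using that(3) I by (auto simp: keeps_def)
      moreover have "fst s' rc = c" using that(3) rc by (simp add: keeps_def)
      ultimately show ?thesis using that by simp
    qed
    let ?s = "((fst s1)(rx := ?x, ry := ?y), snd s1)"
    have s2: "env ?s" "mates ?m ?s" "fst ?s rc = c" "keeps {rx, ry, ru, rv} s1 ?s"
      using I rc by simp_all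
    have vx: "expr_val (mate_of (Reg rx)) ?s = ?m ?x" "expr_val (mate_of (Reg ry)) ?s = ?m ?y"
      using mate_val[OF s2(1,2), of rx] mate_val[OF s2(1,2), of ry] xy by simp_all
    have "runs B (If edge_flag
     (split_code ;; If (differ (mate_of (Reg rx)) (Reg rx)) Skip
       (If (differ (mate_of (Reg ry)) (Reg ry)) Skip rematch_prog)) Skip) s1
       (1 + (2 + (1 + 1 + (1 + 1 + 8))) + 1) ?Q"
    proof (rule runs_If, goal_cases)
      case 1
      show ?case using B_n by (simp add: fits_def)
    next
      case 3
      hence "\<not> E c" using edge_flag_val[of s1] I rc c by blast
      thus ?case using I by (intro runs_Skip finish) (simp_all add: keeps_refl Let_def)
    next
      case 2
      hence e: "E c" using edge_flag_val[of s1] I rc c by blast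
      show ?case
      proof (rule runs_Seq, rule runs_split_code, goal_cases)
        case 3
        show ?case unfolding rc
        proof (rule runs_If, goal_cases)
          case 1
          show ?case using B_n by (simp add: fits_def)
        next
          case 2
          hence "?m ?x \<noteq> ?x" unfolding differ_eq_0 vx by simp
          thus ?case using s2 by (intro runs_Skip finish) (simp_all add: Let_def)
        next
          case x: 3
          hence x: "?m ?x = ?x" unfolding differ_eq_0 vx by simp
          show ?case
          proof (rule runs_If, goal_cases)
            case 1
            show ?case using B_n by (simp add: fits_def)
          next
            case 2
            hence "?m ?y \<noteq> ?y" unfolding differ_eq_0 vx by simp
            thus ?case using s2 by (intro runs_Skip finish) (simp_all add: Let_def)
          next
            case 3
            hence "?m ?y = ?y" unfolding differ_eq_0 vx by simp
            hence g: "greedy_upto n E m (Suc c) = rematch ?x ?y ?m" using x e by (simp add: Let_def)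
            show ?case
              by (rule runs_weaken[OF runs_rematch_prog[OF s2(1-3) c less] order_refl], rule finish)
                (use s2(4) keeps_trans in \<open>auto simp only: g\<close>)
          qed
        qed
      qed (use I c rc in auto)
    qed
    thus "runs B (If edge_flag
     (split_code ;; If (differ (mate_of (Reg rx)) (Reg rx)) Skip
       (If (differ (mate_of (Reg ry)) (Reg ry)) Skip rematch_prog)) Skip) s1 16 ?Q"
      by (rule runs_weaken) auto
  qed (use B_n in \<open>auto simp: env_def\<close>)
  thus ?thesis by (rule runs_weaken) auto
qed

text \<open>After \<open>i\<close> iterations the register \<open>rY\<close> holds the number without its first \<open>i\<close> digits. The
  digits are below \<open>n * n\<close>, and hence codes of pairs, only if there is a vertex.\<close>

lemma runs_moves_prog:
  assumes s: "env s" "mates m s" and m: "\<forall>x<n. m x < n" and n: "0 < n"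
    and X: "fst s rX = X" "X \<le> B" and L: "fst s rL = L" "L \<le> B"
  shows "runs B moves_prog s (L * 14 + 3)
    (\<lambda>s'. env s' \<and> mates (moves_upto n E X m L) s' \<and> keeps {rY, ri, rc, rx, ry, ru, rv} s s')"
proof -
  let ?K = "{rY, ri, rc, rx, ry, ru, rv}"
  let ?Q = "\<lambda>s'. env s' \<and> mates (moves_upto n E X m L) s' \<and> keeps ?K s s'"
  let ?I = "\<lambda>i s'. env s' \<and> mates (moves_upto n E X m i) s' \<and> keeps ?K s s' \<and> fst s' rY = X div (n * n) ^ i"
  let ?c = "Assign rc (Sub (Reg rY) (Mult (Div (Reg rY) (Reg rnn)) (Reg rnn))) ;;
      Assign rY (Div (Reg rY) (Reg rnn)) ;; If edge_flag rematch_prog Skip"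
  let ?s0 = "((fst s)(rY := X), snd s)"
  have "runs B (For ri (Reg rL) ?c) ?s0 (L * (12 + 2) + 2) ?Q"
  proof (rule runs_For[where I = ?I])
    show "?I 0 ((fst ?s0)(ri := 0), snd ?s0)"
      using s by simp
  next
    fix i s1 assume i: "i < L" and I: "?I i s1" and ri: "fst s1 ri = i"
    let ?m = "moves_upto n E X m i"
    define Y where "Y = X div (n * n) ^ i"
    define c where "c = Y mod (n * n)"
    have less: "\<forall>x<n. ?m x < n" using moves_upto_less[OF m] .
    have c: "c < n * n" using n by (simp add: c_def)
    have nn: "fst s1 rnn = n * n" using I by (simp add: env_def)
    have Yle: "Y \<le> B" using X(2) unfolding Y_def by (meson div_le_dividend order_trans)
    let ?P = "\<lambda>s'. fst s' ri = i \<and> ?I (Suc i) ((fst s')(ri := Suc i), snd s')"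
    let ?s = "((fst s1)(rc := c, rY := Y div (n * n)), snd s1)"
    have s2: "env ?s" "mates ?m ?s" "fst ?s rc = c"
      using I by simp_all
    have finish: "?P s'" if "env s'" "mates (moves_upto n E X m (Suc i)) s'" "keeps {rx, ry, ru, rv} ?s s'" for s'
    proof -
      have "fst s' r = fst ?s r" if "r \<notin> {rx, ry, ru, rv}" for r
        using \<open>keeps {rx, ry, ru, rv} ?s s'\<close> that by (rule keepsD)
      hence "keeps ?K s s'" "fst s' rY = Y div (n * n)" "fst s' ri = i"
        using I ri by (auto simp: keeps_def)
      moreover have "Y div (n * n) = X div (n * n) ^ Suc i"
        unfolding Y_def by (simp add: div_mult2_eq[symmetric] mult.commute)
      ultimately show ?thesis using that(1,2) by simp
    qed
    have "runs B ?c s1 (1 + (1 + (1 + 8 + 1))) ?P"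
    proof (rule runs_Seq, rule runs_Assign, goal_cases)
      case 3
      have v: "expr_val (Sub (Reg rY) (Mult (Div (Reg rY) (Reg rnn)) (Reg rnn))) s1 = c"
        using I nn by (simp add: c_def Y_def minus_div_mult_eq_mod)
      show ?case unfolding v
      proof (rule runs_Seq, rule runs_Assign, goal_cases)
        case 3
        have v': "expr_val (Div (Reg rY) (Reg rnn)) ((fst s1)(rc := c), snd s1) = Y div (n * n)"
          using I nn by (simp add: Y_def)
        have st: "((fst ((fst s1)(rc := c), snd s1))(rY := Y div (n * n)), snd ((fst s1)(rc := c), snd s1)) = ?s"
          by simp
        show ?case unfolding v' st
        proof (rule runs_If, goal_cases)
          case 1
          show ?case using B_n by (simp add: fits_def)
        next
          case 2
          hence "E c" using edge_flag_val[OF s2(1)] s2(3) c by metis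
          hence g: "moves_upto n E X m (Suc i) = rematch (c div n) (c mod n) ?m"
            by (simp add: Let_def c_def Y_def)
          show ?case
            by (rule runs_weaken[OF runs_rematch_prog[OF s2(1-3) c less] order_refl], rule finish)
              (auto simp only: g)
        next
          case 3
          hence "\<not> E c" using edge_flag_val[OF s2(1)] s2(3) c by metis
          hence "moves_upto n E X m (Suc i) = ?m" by (simp add: Let_def c_def Y_def)
          thus ?case using s2 by (intro runs_Skip finish) (simp_all add: keeps_refl)
        qed
      next
        case 2
        have "Y div (n * n) \<le> B" using Yle by (meson div_le_dividend order_trans)
        thus ?case using I nn by (simp add: Y_def)
      qed (simp add: fits_def)
    next
      case 2
      show ?case using c B_n I nn by (simp add: c_def Y_def minus_div_mult_eq_mod)
    qed (simp add: fits_def)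
    thus "runs B ?c s1 12 ?P" by (rule runs_weaken) auto
  qed (use B_n L in \<open>auto simp: keeps_def\<close>)
  hence "runs B moves_prog s (1 + (L * (12 + 2) + 2)) ?Q"
    unfolding moves_prog_def using X by (intro runs_Seq runs_Assign) (simp_all add: fits_def)
  thus ?thesis by (rule runs_weaken) auto
qed

lemma runs_count_prog:
  assumes s: "env s" "mates m s" and m: "\<forall>x<n. m x < n"
  shows "runs B count_prog s (n * 5 + 3)
    (\<lambda>s'. env s' \<and> fst s' rcnt = card {x. x < n \<and> m x = x} \<and> keeps {rc, rcnt} s s')"
proof -
  let ?K = "{rc, rcnt}"
  let ?cnt = "\<lambda>i. card {x. x < i \<and> m x = x}"
  let ?Q = "\<lambda>s'. env s' \<and> fst s' rcnt = ?cnt n \<and> keeps ?K s s'"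
  let ?I = "\<lambda>i s'. env s' \<and> mates m s' \<and> keeps ?K s s' \<and> fst s' rcnt = ?cnt i"
  let ?c = "If (differ (mate_of (Reg rc)) (Reg rc)) Skip (Assign rcnt (Add (Reg rcnt) (Const 1)))"
  let ?s0 = "((fst s)(rcnt := 0), snd s)"
  have cnt: "?cnt (Suc i) = (if m i = i then Suc (?cnt i) else ?cnt i)" for i
  proof -
    have "{x. x < Suc i \<and> m x = x} = (if m i = i then insert i {x. x < i \<and> m x = x} else {x. x < i \<and> m x = x})"
      by (auto simp: less_Suc_eq)
    thus ?thesis by simp
  qed
  have cnt_le: "?cnt i \<le> i" for i
    using card_mono[of "{..<i}" "{x. x < i \<and> m x = x}"] by fastforce
  have "runs B (For rc (Reg rn) ?c) ?s0 (n * (3 + 2) + 2) ?Q"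
  proof (rule runs_For[where I = ?I])
    show "?I 0 ((fst ?s0)(rc := 0), snd ?s0)"
      using s by simp
  next
    fix i s1 assume i: "i < n" and I: "?I i s1" and rc: "fst s1 rc = i"
    have v: "expr_val (mate_of (Reg rc)) s1 = m i" using mate_val[of s1 m rc] I i rc by simp
    let ?P = "\<lambda>s'. fst s' rc = i \<and> ?I (Suc i) ((fst s')(rc := Suc i), snd s')"
    have "runs B ?c s1 (1 + 1 + 1) ?P"
    proof (rule runs_If, goal_cases)
      case 1
      show ?case by (simp add: fits_def)
    next
      case 2
      hence "m i \<noteq> i" unfolding differ_eq_0 v using rc by simp
      thus ?case using I rc by (intro runs_Skip) (auto simp: cnt)
    next
      case 3
      hence "m i = i" unfolding differ_eq_0 v using rc by simp
      thus ?case using I rc i B_n cnt_le[of i]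
        by (intro runs_Assign) (auto simp: cnt fits_def)
    qed
    thus "runs B ?c s1 3 ?P" by (rule runs_weaken) auto
  qed (use B_n in \<open>auto simp: env_def\<close>)
  hence "runs B count_prog s (1 + (n * (3 + 2) + 2)) ?Q"
    unfolding count_prog_def by (intro runs_Seq runs_Assign) (simp_all add: fits_def)
  thus ?thesis by (rule runs_weaken) auto
qed

end

text \<open>Written as a product, the number of moves for \<open>D + 1\<close> arises from that for \<open>D\<close> by one
  multiplication; \<open>move_count_eq\<close> relates it to the bound of \<open>all_exposures_reached\<close>.\<close>

definition initial_moves :: nat where "initial_moves = 72 * 8 ^ 96"
definition moves_factor :: nat where "moves_factor = 8 ^ 48"
definition move_count :: "nat \<Rightarrow> nat" where "move_count D = initial_moves * moves_factor ^ D"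

text \<open>The answer is \<open>(hi + 1) - (lo + 2 * k)\<close>, which is not 0 iff \<open>lo + 2 * k \<le> hi\<close>.\<close>

definition gap_prog :: prog where
  "gap_prog = Assign rn (Mem (Const 0)) ;; Assign rnn (Mult (Reg rn) (Reg rn)) ;;
     Assign rbase (Add (Reg rnn) (Const 2)) ;; Assign rD (Const 0) ;;
     Assign rL (Const initial_moves) ;; Assign rgo (Const 1) ;;
     While (Reg rgo) (phase_prog ;;
       If (Sub (Reg rhi) (Reg rD))
         (Assign rD (Add (Reg rD) (Const 1)) ;; Assign rL (Mult (Reg rL) (Const moves_factor)))
         (Assign rgo (Const 0))) ;;
     Assign 0 (Sub (Add (Reg rhi) (Const 1)) (Add (Reg rlo) (Add (Mem (Const 1)) (Mem (Const 1)))))"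

text \<open>The extreme numbers of exposed vertices over all sequences of \<open>L\<close> moves. The values 0 and
  \<open>n\<close> are the initial contents of the registers; they matter only if there are no vertices and hence
  no sequences.\<close>

definition hi_trial :: "nat \<Rightarrow> (nat \<Rightarrow> bool) \<Rightarrow> nat \<Rightarrow> nat" where
  "hi_trial n E L = Max (insert 0 (trial n E L ` {..<(n * n) ^ L}))"

definition lo_trial :: "nat \<Rightarrow> (nat \<Rightarrow> bool) \<Rightarrow> nat \<Rightarrow> nat" where
  "lo_trial n E L = Min (insert n (trial n E L ` {..<(n * n) ^ L}))"

definition try_time :: "nat \<Rightarrow> nat \<Rightarrow> nat" where
  "try_time n L = 36 * (n * n) + 8 * n + 14 * L + 18"

definition phase_time :: "nat \<Rightarrow> nat \<Rightarrow> nat" where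
  "phase_time n L = 3 * L + (n * n) ^ L * (try_time n L + 2) + 7"

lemma trial_le: "trial n E L X \<le> n"
  unfolding trial_def using card_mono[of "{..<n}" "{x. x < n \<and> P x}" for P] by fastforce

lemma hi_trial_le: "hi_trial n E L \<le> n"
  unfolding hi_trial_def by (subst Max_le_iff) (auto simp: trial_le)

lemma lo_trial_le: "lo_trial n E L \<le> n"
  unfolding lo_trial_def by (rule Min_le) auto

context gap_machine begin

definition try_regs :: "nat set" where
  "try_regs = {rY, ri, rc, rx, ry, ru, rv, rcnt, rhi, rlo}"

definition phase_regs :: "nat set" where
  "phase_regs = {rP, rX, rY, ri, rc, rx, ry, ru, rv, rcnt, rhi, rlo}"

lemma runs_If_assign:
  assumes "env s" "r \<notin> {rn, rnn, rbase}" "r \<in> X" "fst s r' \<le> B" "fits B e"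
  shows "runs B (If e (Assign r (Reg r')) Skip) s 3
    (\<lambda>s'. env s' \<and> fst s' r = (if expr_val e s \<noteq> 0 then fst s r' else fst s r) \<and> keeps {r} s s')"
proof -
  have "runs B (If e (Assign r (Reg r')) Skip) s (1 + 1 + 1)
    (\<lambda>s'. env s' \<and> fst s' r = (if expr_val e s \<noteq> 0 then fst s r' else fst s r) \<and> keeps {r} s s')"
    using assms by (intro runs_If runs_Assign runs_Skip) (simp_all add: fits_def)
  thus ?thesis by (rule runs_weaken) auto
qed

lemma runs_try_prog:
  assumes s: "env s" and n: "0 < n" and X: "fst s rX = X" "X \<le> B" and L: "fst s rL = L" "L \<le> B"
    and hl: "fst s rhi \<le> B" "fst s rlo \<le> B"
  shows "runs B try_prog s (try_time n L)
    (\<lambda>s'. env s' \<and> fst s' rhi = max (fst s rhi) (trial n E L X) \<and>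
      fst s' rlo = min (fst s rlo) (trial n E L X) \<and> keeps try_regs s s')"
proof -
  let ?m0 = "greedy n E (\<lambda>x. x)"
  let ?m1 = "moves_upto n E X ?m0 L"
  let ?m2 = "greedy n E ?m1"
  let ?Q = "\<lambda>s'. env s' \<and> fst s' rhi = max (fst s rhi) (trial n E L X) \<and>
      fst s' rlo = min (fst s rlo) (trial n E L X) \<and> keeps try_regs s s'"
  have less: "\<forall>x<n. ?m0 x < n" "\<forall>x<n. ?m1 x < n" "\<forall>x<n. ?m2 x < n"
    by (intro greedy_upto_less moves_upto_less; simp)+
  have tB: "trial n E L X \<le> B" using trial_le B_bounds order_trans by blast
  have "runs B try_prog s (n * 3 + 2 + (n * n * 18 + 2 + (L * 14 + 3 + (n * n * 18 + 2 + (n * 5 + 3 + (3 + 3)))))) ?Q"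
    unfolding try_prog_def
  proof (rule runs_Seq, rule runs_weaken[OF runs_init_prog[OF s] order_refl], elim conjE)
    fix s1 assume s1: "env s1" "mates (\<lambda>x. x) s1" and k1: "keeps {rc} s s1"
    show "runs B (greedy_prog ;; moves_prog ;; greedy_prog ;; count_prog ;;
       If (Sub (Reg rcnt) (Reg rhi)) (Assign rhi (Reg rcnt)) Skip ;;
       If (Sub (Reg rlo) (Reg rcnt)) (Assign rlo (Reg rcnt)) Skip) s1
       (n * n * 18 + 2 + (L * 14 + 3 + (n * n * 18 + 2 + (n * 5 + 3 + (3 + 3))))) ?Q"
    proof (rule runs_Seq, rule runs_weaken[OF runs_greedy_prog[OF s1] order_refl], simp, elim conjE)
      fix s2 assume s2: "env s2" "mates ?m0 s2" and k2: "keeps {rc, rx, ry, ru, rv} s1 s2"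
      have X2: "fst s2 rX = X" "fst s2 rL = L" using k1 k2 X L by (auto simp: keeps_def)
      show "runs B (moves_prog ;; greedy_prog ;; count_prog ;;
         If (Sub (Reg rcnt) (Reg rhi)) (Assign rhi (Reg rcnt)) Skip ;;
         If (Sub (Reg rlo) (Reg rcnt)) (Assign rlo (Reg rcnt)) Skip) s2
         (L * 14 + 3 + (n * n * 18 + 2 + (n * 5 + 3 + (3 + 3)))) ?Q"
      proof (rule runs_Seq, rule runs_weaken[OF runs_moves_prog[OF s2 less(1) n X2(1) X(2) X2(2) L(2)] order_refl], elim conjE)
        fix s3 assume s3: "env s3" "mates ?m1 s3" and k3: "keeps {rY, ri, rc, rx, ry, ru, rv} s2 s3"
        show "runs B (greedy_prog ;; count_prog ;;
           If (Sub (Reg rcnt) (Reg rhi)) (Assign rhi (Reg rcnt)) Skip ;;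
           If (Sub (Reg rlo) (Reg rcnt)) (Assign rlo (Reg rcnt)) Skip) s3
           (n * n * 18 + 2 + (n * 5 + 3 + (3 + 3))) ?Q"
        proof (rule runs_Seq, rule runs_weaken[OF runs_greedy_prog[OF s3 less(2)] order_refl], elim conjE)
          fix s4 assume s4: "env s4" "mates ?m2 s4" and k4: "keeps {rc, rx, ry, ru, rv} s3 s4"
          show "runs B (count_prog ;;
             If (Sub (Reg rcnt) (Reg rhi)) (Assign rhi (Reg rcnt)) Skip ;;
             If (Sub (Reg rlo) (Reg rcnt)) (Assign rlo (Reg rcnt)) Skip) s4 (n * 5 + 3 + (3 + 3)) ?Q"
          proof (rule runs_Seq, rule runs_weaken[OF runs_count_prog[OF s4 less(3)] order_refl], elim conjE)
            fix s5 assume s5: "env s5" and cnt: "fst s5 rcnt = card {x. x < n \<and> ?m2 x = x}"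
              and k5: "keeps {rc, rcnt} s4 s5"
            have cnt: "fst s5 rcnt = trial n E L X" using cnt by (simp add: trial_def)
            have k: "keeps {rY, ri, rc, rx, ry, ru, rv, rcnt} s s5"
              using k1 k2 k3 k4 k5 by (auto simp: keeps_def)
            show "runs B (If (Sub (Reg rcnt) (Reg rhi)) (Assign rhi (Reg rcnt)) Skip ;;
               If (Sub (Reg rlo) (Reg rcnt)) (Assign rlo (Reg rcnt)) Skip) s5 (3 + 3) ?Q"
            proof (rule runs_Seq, rule runs_weaken[OF runs_If_assign[OF s5, of _ UNIV] order_refl], goal_cases)
              case (5 s6)
              hence s6: "env s6" and k6: "keeps {rhi} s5 s6"
                and hi: "fst s6 rhi = max (fst s rhi) (trial n E L X)"
                using k cnt by (auto simp: keeps_def)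
              show ?case
              proof (rule runs_weaken[OF runs_If_assign[OF s6, of _ UNIV] order_refl], goal_cases)
                case (5 s7)
                hence s7: "env s7" and k7: "keeps {rlo} s6 s7" by auto
                have "fst s7 rlo = min (fst s rlo) (trial n E L X)"
                  using 5 k6 k cnt by (auto simp: keeps_def)
                moreover have "fst s7 rhi = max (fst s rhi) (trial n E L X)"
                  using hi k7 by (simp add: keeps_def)
                moreover have "keeps try_regs s s7"
                  using k k6 k7 by (auto simp: keeps_def try_regs_def)
                ultimately show ?case using s7 by simp
              qed (use k6 cnt tB in \<open>auto simp: keeps_def fits_def\<close>)
            qed (use cnt tB in \<open>auto simp: fits_def\<close>)
          qed
        qed
      qed
    qed
  qed
  thus ?thesis by (rule runs_weaken) (auto simp: try_time_def)
qed

lemma runs_phase_prog: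
  assumes s: "env s" and L: "fst s rL = L" "L \<le> B" "0 < L" and P: "(n * n) ^ L \<le> B"
  shows "runs B phase_prog s (phase_time n L)
    (\<lambda>s'. env s' \<and> fst s' rhi = hi_trial n E L \<and> fst s' rlo = lo_trial n E L \<and> keeps phase_regs s s')"
proof -
  let ?P = "(n * n) ^ L"
  let ?Q = "\<lambda>s'. env s' \<and> fst s' rhi = hi_trial n E L \<and> fst s' rlo = lo_trial n E L \<and> keeps phase_regs s s'"
  let ?I = "\<lambda>i s'. env s' \<and> fst s' rP = (n * n) ^ i \<and> keeps {rP, ri} s s'"
  let ?J = "\<lambda>i s'. env s' \<and> keeps phase_regs s s' \<and> fst s' rP = ?P \<and>
     fst s' rhi = Max (insert 0 (trial n E L ` {..<i})) \<and> fst s' rlo = Min (insert n (trial n E L ` {..<i}))"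
  have pw: "(n * n) ^ i \<le> B" if "i \<le> L" for i
  proof (cases "n = 0")
    case True
    thus ?thesis using B_n by (cases i) auto
  next
    case False
    hence "(n * n) ^ i \<le> ?P" using that by (intro power_increasing) auto
    thus ?thesis using P by linarith
  qed
  have loop1: "runs B (For ri (Reg rL) (Assign rP (Mult (Reg rP) (Reg rnn)))) ((fst s)(rP := 1), snd s)
      (L * (1 + 2) + 2) (\<lambda>s'. env s' \<and> fst s' rP = ?P \<and> keeps {rP, ri} s s')"
  proof (rule runs_For[where I = ?I])
    fix i s1 assume i: "i < L" and I: "?I i s1" and ri: "fst s1 ri = i"
    have v: "expr_val (Mult (Reg rP) (Reg rnn)) s1 = (n * n) ^ Suc i"
      using I by (simp add: env_def mult.commute)
    show "runs B (Assign rP (Mult (Reg rP) (Reg rnn))) s1 1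
      (\<lambda>s'. fst s' ri = i \<and> ?I (Suc i) ((fst s')(ri := Suc i), snd s'))"
      by (rule runs_Assign, unfold v) (use I ri i pw[of "Suc i"] in \<open>simp_all add: fits_def\<close>)
  qed (use s L B_n in \<open>auto simp: keeps_def\<close>)
  have loop2: "runs B (For rX (Reg rP) try_prog) s1 (?P * (try_time n L + 2) + 2) ?Q"
    if s1: "env s1" "keeps phase_regs s s1" "fst s1 rP = ?P" "fst s1 rhi = 0" "fst s1 rlo = n" for s1
  proof (rule runs_For[where I = ?J])
    show "?J 0 ((fst s1)(rX := 0), snd s1)" using s1 by (simp add: phase_regs_def)
  next
    fix i s2 assume i: "i < ?P" and J: "?J i s2" and rX: "fst s2 rX = i"
    have n: "0 < n" using i L(3) by (cases n) (auto simp: zero_power)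
    have rL: "fst s2 rL = L" using J L by (simp add: keeps_def phase_regs_def)
    have "Max (insert 0 (trial n E L ` {..<i})) \<le> n"
      by (subst Max_le_iff) (auto simp: trial_le)
    moreover have "Min (insert n (trial n E L ` {..<i})) \<le> n" by (rule Min_le) auto
    ultimately have hl: "fst s2 rhi \<le> B" "fst s2 rlo \<le> B" using J B_bounds(1) by linarith+
    have iB: "i \<le> B" using i P by linarith
    have "runs B try_prog s2 (try_time n L)
      (\<lambda>s'. env s' \<and> fst s' rhi = max (fst s2 rhi) (trial n E L i) \<and>
        fst s' rlo = min (fst s2 rlo) (trial n E L i) \<and> keeps try_regs s2 s')"
      by (rule runs_try_prog) (use J n rX rL L(2) iB hl in blast)+
    thus "runs B try_prog s2 (try_time n L)
      (\<lambda>s'. fst s' rX = i \<and> ?J (Suc i) ((fst s')(rX := Suc i), snd s'))"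
    proof (rule runs_weaken[OF _ order_refl], elim conjE)
      fix s3 assume s3: "env s3" and hi: "fst s3 rhi = max (fst s2 rhi) (trial n E L i)"
        and lo: "fst s3 rlo = min (fst s2 rlo) (trial n E L i)" and k: "keeps try_regs s2 s3"
      have k': "keeps phase_regs s s3" "fst s3 rX = i" "fst s3 rP = ?P"
        using k J rX by (auto simp: keeps_def try_regs_def phase_regs_def)
      let ?A = "trial n E L ` {..<i}"
      have img: "trial n E L ` {..<Suc i} = insert (trial n E L i) ?A" by (simp add: lessThan_Suc)
      have "Max (insert 0 (insert (trial n E L i) ?A)) = max (trial n E L i) (Max (insert 0 ?A))"
        by (subst insert_commute, subst Max_insert) auto
      moreover have "Min (insert n (insert (trial n E L i) ?A)) = min (trial n E L i) (Min (insert n ?A))"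
        by (subst insert_commute, subst Min_insert) auto
      ultimately have "fst s3 rhi = Max (insert 0 (trial n E L ` {..<Suc i}))"
        "fst s3 rlo = Min (insert n (trial n E L ` {..<Suc i}))"
        unfolding img using hi lo J by (simp_all only: max.commute min.commute)
      thus "fst s3 rX = i \<and> ?J (Suc i) ((fst s3)(rX := Suc i), snd s3)"
        using s3 k' by (simp add: phase_regs_def)
    qed
  next
    fix s2 assume "?J ?P s2"
    thus "?Q s2" by (simp add: hi_trial_def lo_trial_def)
  qed (use P B_n in auto)
  have "runs B phase_prog s (1 + (L * (1 + 2) + 2 + (1 + (1 + (?P * (try_time n L + 2) + 2))))) ?Q"
    unfolding phase_prog_def
  proof (rule runs_Seq, rule runs_Assign, goal_cases)
    case 3
    show ?case
    proof (rule runs_Seq, simp only: expr_val.simps, rule runs_weaken[OF loop1 order_refl], elim conjE)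
      fix s1 assume s1: "env s1" "fst s1 rP = ?P" "keeps {rP, ri} s s1"
      have rn: "fst s1 rn = n" using s1(1) by (simp add: env_def)
      have k: "keeps phase_regs s s1" using s1(3) by (auto simp: keeps_def phase_regs_def)
      show "runs B (Assign rhi (Const 0) ;; Assign rlo (Reg rn) ;; For rX (Reg rP) try_prog) s1
         (1 + (1 + (?P * (try_time n L + 2) + 2))) ?Q"
        apply (rule runs_Seq, rule runs_Assign)
        subgoal by (simp add: fits_def)
        subgoal by simp
        apply (rule runs_Seq, rule runs_Assign)
        subgoal by (simp add: fits_def)
        subgoal using rn B_bounds by simp
        apply (rule loop2)
        using s1 rn k by (simp_all add: phase_regs_def)
    qed
  qed (use B_n in \<open>simp_all add: fits_def\<close>)
  thus ?thesis by (rule runs_weaken) (auto simp: phase_time_def algebra_simps)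
qed

end

lemma move_count_eq: "move_count D = 72 * (8 ^ (16 * D + 32)) ^ 3"
proof -
  have "(8 ^ (16 * D + 32)) ^ 3 = (8::nat) ^ (96 + 48 * D)"
    by (simp only: power_mult[symmetric]) (simp add: algebra_simps)
  also have "\<dots> = 8 ^ 96 * (8 ^ 48) ^ D" by (simp only: power_add power_mult)
  finally show ?thesis unfolding move_count_def initial_moves_def moves_factor_def by (simp only: mult.assoc)
qed

lemma move_count_pos: "0 < move_count D"
  by (simp add: move_count_def initial_moves_def moves_factor_def)

lemma move_count_mono: "i \<le> j \<Longrightarrow> move_count i \<le> move_count j"
  unfolding move_count_def by (intro mult_left_mono power_increasing) (auto simp: moves_factor_def)

lemma power_mono_exp:
  fixes n :: nat
  assumes "0 < i" "i \<le> j"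
  shows "n ^ i \<le> n ^ j"
  using assms by (cases "n = 0") (auto simp: zero_power intro: power_increasing)

lemma phase_time_mono:
  assumes "0 < L" "L \<le> L'"
  shows "phase_time n L \<le> phase_time n L'"
proof -
  have "(n * n) ^ L * (try_time n L + 2) \<le> (n * n) ^ L' * (try_time n L' + 2)"
    using assms by (intro mult_mono power_mono_exp) (auto simp: try_time_def)
  thus ?thesis using assms by (simp add: phase_time_def)
qed

context gap_machine begin

text \<open>The loop stops for some \<open>D \<le> d\<close>, so it never uses more than \<open>move_count d\<close> moves. This is
  where the bound on the time of all phases and on all numbers comes from.\<close>

lemma runs_search_loop:
  assumes d: "hi_trial n E (move_count d) \<le> d" and P: "(n * n) ^ move_count d \<le> B"
    and B: "move_count d + moves_factor + d + n + 2 * k + 2 \<le> B"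
    and j: "j \<le> d" and s: "env s" "fst s rD = j" "fst s rL = move_count j" "fst s rgo \<noteq> 0"
  shows "runs B (While (Reg rgo) (phase_prog ;;
       If (Sub (Reg rhi) (Reg rD))
         (Assign rD (Add (Reg rD) (Const 1)) ;; Assign rL (Mult (Reg rL) (Const moves_factor)))
         (Assign rgo (Const 0)))) s ((d - j + 1) * (phase_time n (move_count d) + 5) + 1)
     (\<lambda>s'. env s' \<and> (\<exists>j\<le>d. hi_trial n E (move_count j) \<le> j \<and>
       fst s' rhi = hi_trial n E (move_count j) \<and> fst s' rlo = lo_trial n E (move_count j)))"
  (is "runs B ?w s _ ?Q")
  using j s
proof (induction "d - j" arbitrary: j s rule: less_induct)
  case less
  let ?L = "move_count j"
  let ?T = "phase_time n (move_count d)"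
  let ?b = "If (Sub (Reg rhi) (Reg rD))
         (Assign rD (Add (Reg rD) (Const 1)) ;; Assign rL (Mult (Reg rL) (Const moves_factor)))
         (Assign rgo (Const 0))"
  note prems = less.prems
  have L: "?L \<le> move_count d" using prems(1) by (rule move_count_mono)
  have "(n * n) ^ ?L \<le> B" using power_mono_exp[OF move_count_pos L, of "n * n"] P by linarith
  hence phase: "runs B phase_prog s ?T
      (\<lambda>s'. env s' \<and> fst s' rhi = hi_trial n E ?L \<and> fst s' rlo = lo_trial n E ?L \<and> keeps phase_regs s s')"
    using prems L B move_count_pos by (intro runs_weaken[OF runs_phase_prog phase_time_mono]) auto
  have "runs B (phase_prog ;; ?b) s (?T + (1 + (1 + 1) + 1)) (\<lambda>s'. runs B ?w s' ((d - j) * (?T + 5) + 1) ?Q)"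
  proof (rule runs_Seq, rule runs_weaken[OF phase order_refl], elim conjE)
    fix s1 assume s1: "env s1" "fst s1 rhi = hi_trial n E ?L" "fst s1 rlo = lo_trial n E ?L" "keeps phase_regs s s1"
    have r: "fst s1 rD = j" "fst s1 rL = ?L" "fst s1 rgo \<noteq> 0"
      using s1(4) prems by (auto simp: keeps_def phase_regs_def)
    show "runs B ?b s1 (1 + (1 + 1) + 1) (\<lambda>s'. runs B ?w s' ((d - j) * (?T + 5) + 1) ?Q)"
    proof (rule runs_If, goal_cases)
      case 1
      show ?case by (simp add: fits_def)
    next
      case 2
      hence "j < hi_trial n E ?L" using r s1 by simp
      hence jd: "Suc j \<le> d" using d prems(1) by (cases "j = d") auto
      have L': "?L * moves_factor = move_count (Suc j)" by (simp add: move_count_def)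
      have L'B: "move_count (Suc j) \<le> B" using move_count_mono[OF jd] B by linarith
      let ?s = "((fst s1)(rD := Suc j, rL := move_count (Suc j)), snd s1)"
      have "runs B ?w ?s ((d - Suc j + 1) * (?T + 5) + 1) ?Q"
        using jd s1 r by (intro less.hyps) auto
      hence next_round: "runs B ?w ?s ((d - j) * (?T + 5) + 1) ?Q" using jd by (simp add: Suc_diff_Suc)
      show ?case
        apply (rule runs_Seq, rule runs_Assign)
        subgoal using B by (simp add: fits_def)
        subgoal using r B jd by simp
        apply (rule runs_Assign)
        subgoal using B by (simp add: fits_def)
        subgoal using r L' L'B by simp
        subgoal using r L' next_round by simp
        done
    next
      case 3
      hence stop: "hi_trial n E ?L \<le> j" using r s1 by simp
      have "runs B ?w ((fst s1)(rgo := 0), snd s1) 1 ?Q"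
        using stop s1 prems(1) by (intro runs_While_False) (auto simp: fits_def)
      hence "runs B ?w ((fst s1)(rgo := 0), snd s1) ((d - j) * (?T + 5) + 1) ?Q"
        by (rule runs_weaken) auto
      thus ?case by (intro runs_Assign) (simp_all add: fits_def)
    qed
  qed
  hence "runs B ?w s (1 + (?T + (1 + (1 + 1) + 1)) + ((d - j) * (?T + 5) + 1)) ?Q"
    using prems by (intro runs_While_True) (simp_all add: fits_def)
  thus ?case by (rule runs_weaken) (auto simp: algebra_simps)
qed

lemma runs_gap_prog:
  assumes d: "hi_trial n E (move_count d) \<le> d" and P: "(n * n) ^ move_count d \<le> B"
    and B: "move_count d + moves_factor + d + n + 2 * k + 2 \<le> B"
    and s: "snd s 0 = n" "snd s 1 = k" "\<And>c. c < n * n \<Longrightarrow> snd s (c + 2) = (if E c then 1 else 0)"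
  shows "runs B gap_prog s ((d + 1) * (phase_time n (move_count d) + 5) + 8)
     (\<lambda>s'. \<exists>j\<le>d. hi_trial n E (move_count j) \<le> j \<and>
       (fst s' 0 \<noteq> 0 \<longleftrightarrow> lo_trial n E (move_count j) + 2 * k \<le> hi_trial n E (move_count j)))"
    (is "runs B _ s _ ?Q")
proof -
  let ?s = "((fst s)(rn := n, rnn := n * n, rbase := n * n + 2, rD := 0, rL := move_count 0, rgo := 1), snd s)"
  have env: "env ?s" using s by (simp add: env_def)
  have m0: "initial_moves = move_count 0" by (simp add: move_count_def)
  have L: "move_count 0 \<le> B" using move_count_mono[of 0 d] B by linarith
  let ?T = "phase_time n (move_count d)"
  let ?f = "Assign 0 (Sub (Add (Reg rhi) (Const 1)) (Add (Reg rlo) (Add (Mem (Const 1)) (Mem (Const 1)))))"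
  let ?w = "While (Reg rgo) (phase_prog ;;
       If (Sub (Reg rhi) (Reg rD))
         (Assign rD (Add (Reg rD) (Const 1)) ;; Assign rL (Mult (Reg rL) (Const moves_factor)))
         (Assign rgo (Const 0)))"
  have loop_then: "runs B (?w ;; ?f) ?s (((d - 0 + 1) * (?T + 5) + 1) + 1) ?Q"
  proof (rule runs_Seq, rule runs_weaken[OF runs_search_loop[OF d P B, of 0 ?s] order_refl], goal_cases)
    case (6 s1)
    then obtain j where s1: "env s1" and j: "j \<le> d" "hi_trial n E (move_count j) \<le> j"
       "fst s1 rhi = hi_trial n E (move_count j)" "fst s1 rlo = lo_trial n E (move_count j)" by blast
    have k: "snd s1 1 = k" using s1 by (simp add: env_def)
    have "hi_trial n E (move_count j) + 1 \<le> B" using hi_trial_le[of n E "move_count j"] B by linarith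
    moreover have "expr_val (Sub (Add (Reg rhi) (Const 1)) (Add (Reg rlo) (Add (Mem (Const 1)) (Mem (Const 1))))) s1
      = hi_trial n E (move_count j) + 1 - (lo_trial n E (move_count j) + 2 * k)"
      using j k by simp
    ultimately show ?case using j B_bounds by (intro runs_Assign) (auto simp: fits_def)
  qed (use env in simp_all)
  have "runs B gap_prog s (1 + (1 + (1 + (1 + (1 + (1 + (((d - 0 + 1) * (?T + 5) + 1) + 1))))))) ?Q"
    unfolding gap_prog_def
    apply (rule runs_Seq, rule runs_Assign)
    subgoal by (simp add: fits_def)
    subgoal using s B_bounds by simp
    apply (rule runs_Seq, rule runs_Assign)
    subgoal by (simp add: fits_def)
    subgoal using s B_bounds by simp
    apply (rule runs_Seq, rule runs_Assign)
    subgoal using B_bounds by (simp add: fits_def)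
    subgoal using s B_n by simp
    apply (rule runs_Seq, rule runs_Assign)
    subgoal by (simp add: fits_def)
    subgoal by simp
    apply (rule runs_Seq, rule runs_Assign)
    subgoal using L m0 by (simp add: fits_def)
    subgoal using L m0 by simp
    apply (rule runs_Seq, rule runs_Assign)
    subgoal using B_bounds by (simp add: fits_def)
    subgoal using B_bounds by simp
    subgoal using loop_then s m0 by simp
    done
  thus ?thesis by (rule runs_weaken) auto
qed

end

section \<open>The search on graphs with coded edges\<close>

text \<open>Positional notation: every sequence of \<open>L\<close> digits is the expansion of a number.\<close>

lemma digits_exist:
  fixes b :: nat
  assumes "\<And>i. i < L \<Longrightarrow> f i < b"
  shows "\<exists>X<b ^ L. \<forall>i<L. X div b ^ i mod b = f i"
  using assms
proof (induction L)
  case (Suc L)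
  then obtain X where X: "X < b ^ L" "\<And>i. i < L \<Longrightarrow> X div b ^ i mod b = f i" by auto
  let ?X = "f L * b ^ L + X"
  have fL: "f L < b" using Suc.prems by simp
  have "?X < b ^ Suc L"
  proof -
    have "?X < (f L + 1) * b ^ L" using X(1) by simp
    also have "\<dots> \<le> b * b ^ L" using fL by (intro mult_right_mono) auto
    finally show ?thesis by simp
  qed
  moreover have "?X div b ^ i mod b = f i" if "i < Suc L" for i
  proof (cases "i = L")
    case True
    have "?X div b ^ L = f L" using X(1) fL by simp
    thus ?thesis using fL True by simp
  next
    case False
    hence i: "i < L" using that by simp
    then obtain e where e: "L = i + Suc e" using less_imp_Suc_add by auto
    have b: "0 < b" using fL by simp
    have "?X = X + b ^ i * (b * (f L * b ^ e))" by (simp add: e power_add)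
    moreover have "(X + b ^ i * Z) div b ^ i = X div b ^ i + Z" for Z using b by simp
    ultimately have "?X div b ^ i = X div b ^ i + b * (f L * b ^ e)" by (simp only:)
    hence "?X div b ^ i mod b = X div b ^ i mod b" by (simp only: mod_mult_self2)
    thus ?thesis using X(2)[OF i] by simp
  qed
  ultimately show ?case by blast
qed simp

definition coded_adj :: "nat \<Rightarrow> (nat \<Rightarrow> bool) \<Rightarrow> nat \<Rightarrow> nat \<Rightarrow> bool" where
  "coded_adj n E x y \<longleftrightarrow> x < n \<and> y < n \<and> E (x * n + y)"

text \<open>Graphs on the vertices \<open>0, \<dots>, n - 1\<close> given by the codes of their edges.\<close>

locale coded_graph =
  fixes n :: nat and E :: "nat \<Rightarrow> bool"
  assumes E_sym: "x < n \<Longrightarrow> y < n \<Longrightarrow> E (x * n + y) \<Longrightarrow> E (y * n + x)"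
    and E_irrefl: "x < n \<Longrightarrow> \<not> E (x * n + x)"

sublocale coded_graph \<subseteq> finite_graph "{..<n}" "coded_adj n E"
  by unfold_locales (auto simp: coded_adj_def E_sym E_irrefl)

context coded_graph begin

lemma adj_code: "c < n * n \<Longrightarrow> coded_adj n E (c div n) (c mod n) \<longleftrightarrow> E c"
  using code_split_less[of c n] by (simp add: coded_adj_def)

text \<open>A vertex that is matched at some point keeps its partner. So after edge \<open>e\<close> has been
  considered, one of its ends is matched for good.\<close>

lemma greedy_upto_props:
  assumes m: "mating m" and c: "c \<le> n * n"
  shows "mating (greedy_upto n E m c)"
    and "m x \<noteq> x \<Longrightarrow> greedy_upto n E m c x = m x"
    and "\<And>e. e < c \<Longrightarrow> E e \<Longrightarrow> greedy_upto n E m c (e div n) \<noteq> e div n \<or> greedy_upto n E m c (e mod n) \<noteq> e mod n"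
  using c
proof (induction c)
  case 0
  { case 1 show ?case using m by simp }
  { case 2 thus ?case by simp }
  { case 3 thus ?case by simp }
next
  case (Suc c)
  let ?m = "greedy_upto n E m c"
  let ?x = "c div n" and ?y = "c mod n"
  have IH: "mating ?m" "m x \<noteq> x \<Longrightarrow> ?m x = m x"
    "\<And>e. e < c \<Longrightarrow> E e \<Longrightarrow> ?m (e div n) \<noteq> e div n \<or> ?m (e mod n) \<noteq> e mod n" if "Suc c \<le> n * n"
    using Suc.IH that by auto
  have step: "greedy_upto n E m (Suc c) = (if E c \<and> ?m ?x = ?x \<and> ?m ?y = ?y then ?m(?x := ?y, ?y := ?x) else ?m)"
    by (simp add: Let_def rematch_def fun_upd_idem_iff)
  have grow: "greedy_upto n E m (Suc c) z = ?m z" if "?m z \<noteq> z" for z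
    using that unfolding step by auto
  {
    case 1
    have "mating (rematch ?x ?y ?m)" if "E c"
      using code_split_less[of c n] adj_code[of c] 1 that by (intro mating_rematch[OF IH(1)[OF 1]]) auto
    thus ?case using IH(1)[OF 1] by (simp add: Let_def)
  next
    case 2
    thus ?case using IH(2)[OF 2(2)] grow[of x] by simp
  next
    case (3 e)
    show ?case
    proof (cases "e = c")
      case False
      hence "?m (e div n) \<noteq> e div n \<or> ?m (e mod n) \<noteq> e mod n" using IH(3)[OF 3(3)] 3 by simp
      thus ?thesis using grow by metis
    next
      case True
      have "?x \<noteq> ?y" using 3 True adj_code[of c] adj_irrefl[of ?x] by auto
      thus ?thesis using 3 True unfolding step by auto
    qed
  }
qed

lemma completion_greedy: "completion (greedy n E)"
  unfolding completion_def
proof (intro allI impI conjI ballI)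
  fix m assume m: "mating m"
  note g = greedy_upto_props[OF m order_refl]
  show "greedy n E m x = m x" if "m x \<noteq> x" for x using g(2)[OF that] .
  have "\<not> coded_adj n E x y" if "x \<in> exposed (greedy n E m)" "y \<in> exposed (greedy n E m)" for x y
  proof
    assume xy: "coded_adj n E x y"
    hence "x < n" "y < n" "E (x * n + y)" by (auto simp: coded_adj_def)
    moreover have "x * n + y < n * n"
    proof -
      have "x * n + y < (x + 1) * n" using \<open>y < n\<close> by simp
      also have "\<dots> \<le> n * n" using \<open>x < n\<close> by (intro mult_right_mono) auto
      finally show ?thesis .
    qed
    ultimately show False using g(3)[of "x * n + y"] that by (auto simp: exposed_def)
  qed
  thus "maximal_mating (greedy n E m)" using g(1) by (simp add: maximal_mating_def)
qed

lemma mating_id: "mating (\<lambda>x. x)"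
  by (simp add: mating_def)

lemma moves_upto_eq_rematches:
  assumes "0 < n"
  shows "moves_upto n E X m L =
    rematches (map (\<lambda>i. let c = X div (n * n) ^ i mod (n * n) in (c div n, c mod n)) [0..<L]) m"
proof (induction L)
  case (Suc L)
  have "X div (n * n) ^ L mod (n * n) < n * n" using assms by simp
  from adj_code[OF this] show ?case using Suc by (simp add: rematches_def Let_def)
qed (simp add: rematches_def)

text \<open>Shorter sequences of moves are padded with the pair \<open>(0, 0)\<close>, which is not an edge.\<close>

lemma rematches_eq_moves_upto:
  assumes n: "0 < n" and N: "length N \<le> L" "set N \<subseteq> {..<n} \<times> {..<n}"
  shows "\<exists>X<(n * n) ^ L. rematches N m = moves_upto n E X m L"
proof -
  define N' where "N' = N @ replicate (L - length N) (0, 0)"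
  have len: "length N' = L" using N(1) by (simp add: N'_def)
  have N': "fst (N' ! i) < n \<and> snd (N' ! i) < n" if "i < L" for i
  proof -
    have "N' ! i \<in> set N'" using that len by simp
    moreover have "set N' \<subseteq> {..<n} \<times> {..<n}" using N(2) n by (auto simp: N'_def)
    ultimately have "N' ! i \<in> {..<n} \<times> {..<n}" by blast
    thus ?thesis by (simp add: mem_Times_iff)
  qed
  let ?f = "\<lambda>i. fst (N' ! i) * n + snd (N' ! i)"
  have "?f i < n * n" if "i < L" for i
  proof -
    have "?f i < (fst (N' ! i) + 1) * n" using N'[OF that] by simp
    also have "\<dots> \<le> n * n" using N'[OF that] by (intro mult_right_mono) auto
    finally show ?thesis .
  qed
  from digits_exist[of L ?f, OF this] obtain X where X: "X < (n * n) ^ L"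
    "\<And>i. i < L \<Longrightarrow> X div (n * n) ^ i mod (n * n) = ?f i" by auto
  have "map (\<lambda>i. let c = X div (n * n) ^ i mod (n * n) in (c div n, c mod n)) [0..<L] = N'"
  proof (rule nth_equalityI)
    fix i assume "i < length (map (\<lambda>i. let c = X div (n * n) ^ i mod (n * n) in (c div n, c mod n)) [0..<L])"
    hence i: "i < L" by simp
    have "?f i div n = fst (N' ! i)" "?f i mod n = snd (N' ! i)" using N'[OF i] by simp_all
    thus "map (\<lambda>i. let c = X div (n * n) ^ i mod (n * n) in (c div n, c mod n)) [0..<L] ! i = N' ! i"
      using i X(2)[OF i] by (simp add: Let_def)
  qed (simp add: len)
  moreover have "rematches N' m = rematches N m"
  proof -
    have "fold (\<lambda>(x, y) m. if coded_adj n E x y then rematch x y m else m) (replicate k (0, 0)) m' = m'" for k m'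
      using adj_irrefl[of 0] by (induction k) auto
    thus ?thesis by (simp add: rematches_def N'_def)
  qed
  ultimately have "rematches N m = moves_upto n E X m L"
    using moves_upto_eq_rematches[OF n, of X m L] by simp
  thus ?thesis using X(1) by blast
qed

lemma trial_eq: "trial n E L X = card (exposed (greedy n E (moves_upto n E X (greedy n E (\<lambda>x. x)) L)))"
  by (simp add: trial_def exposed_def)

lemma trial_maximal:
  assumes "0 < n"
  shows "\<exists>m. maximal_mating m \<and> card (exposed m) = trial n E L X"
proof -
  let ?N = "map (\<lambda>i. let c = X div (n * n) ^ i mod (n * n) in (c div n, c mod n)) [0..<L]"
  have "mating (greedy n E (\<lambda>x. x))"
    using completion_greedy mating_id by (simp add: completion_def maximal_mating_def)
  moreover have "set ?N \<subseteq> {..<n} \<times> {..<n}"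
    using assms code_split_less[of "_ mod (n * n)" n] by (auto simp: Let_def)
  ultimately have "mating (moves_upto n E X (greedy n E (\<lambda>x. x)) L)"
    unfolding moves_upto_eq_rematches[OF assms] by (rule mating_rematches)
  hence "maximal_mating (greedy n E (moves_upto n E X (greedy n E (\<lambda>x. x)) L))"
    using completion_greedy by (simp add: completion_def)
  thus ?thesis unfolding trial_eq by blast
qed

lemma hi_trial_le_bound:
  assumes "\<And>m. maximal_mating m \<Longrightarrow> card (exposed m) \<le> d"
  shows "hi_trial n E L \<le> d"
proof (cases "n = 0")
  case True
  thus ?thesis using hi_trial_le[of n E L] by simp
next
  case False
  hence "trial n E L X \<le> d" for X using trial_maximal[of L X] assms False by (metis bot_nat_0.not_eq_extremum)
  thus ?thesis unfolding hi_trial_def by (subst Max_le_iff) auto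
qed

text \<open>If the greatest number found for \<open>D = j\<close> is at most \<open>j\<close>, the hypotheses of
  \<open>all_exposures_reached\<close> hold, so the trials produce exactly the numbers of vertices exposed by maximal
  matchings.\<close>

lemma hi_lo_trial_correct:
  assumes "hi_trial n E (move_count j) \<le> j"
  shows "\<exists>m. maximal_mating m \<and> card (exposed m) = hi_trial n E (move_count j)"
    and "\<exists>m. maximal_mating m \<and> card (exposed m) = lo_trial n E (move_count j)"
    and "maximal_mating m \<Longrightarrow> card (exposed m) \<le> hi_trial n E (move_count j)"
    and "maximal_mating m \<Longrightarrow> lo_trial n E (move_count j) \<le> card (exposed m)"
proof -
  let ?L = "move_count j"
  let ?m0 = "greedy n E (\<lambda>x. x)"
  have m0: "maximal_mating ?m0" using completion_greedy mating_id by (simp add: completion_def)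
  have "(\<exists>m. maximal_mating m \<and> card (exposed m) = hi_trial n E ?L) \<and>
    (\<exists>m. maximal_mating m \<and> card (exposed m) = lo_trial n E ?L) \<and>
    (\<forall>m. maximal_mating m \<longrightarrow> card (exposed m) \<le> hi_trial n E ?L \<and> lo_trial n E ?L \<le> card (exposed m))"
  proof (cases "n = 0")
    case True
    hence "exposed m = {}" for m unfolding exposed_def by blast
    moreover have "hi_trial n E ?L = 0" "lo_trial n E ?L = 0"
      using True hi_trial_le[of n E ?L] lo_trial_le[of n E ?L] by simp_all
    ultimately show ?thesis using m0 by auto
  next
    case False
    hence n: "0 < n" by simp
    let ?R = "trial n E ?L ` {..<(n * n) ^ ?L}"
    have R: "finite ?R" "?R \<noteq> {}" using n by (auto simp: lessThan_empty_iff)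
    have "Min ?R \<le> n" using Min_in[OF R] trial_le by (metis imageE)
    hence hl: "hi_trial n E ?L = Max ?R" "lo_trial n E ?L = Min ?R"
      unfolding hi_trial_def lo_trial_def using R by (simp_all add: Max_insert Min_insert)
    have all: "card (exposed m) \<in> ?R" if "maximal_mating m" for m
    proof -
      have "\<exists>N. length N \<le> ?L \<and> set N \<subseteq> {..<n} \<times> {..<n} \<and>
          card (exposed (greedy n E (rematches N ?m0))) = card (exposed m)"
      proof (rule all_exposures_reached[OF completion_greedy m0 _ _ that])
        show "72 * (8 ^ (16 * j + 32)) ^ 3 \<le> ?L" by (simp only: move_count_eq)
        fix N :: "(nat \<times> nat) list" assume "length N \<le> ?L" "set N \<subseteq> {..<n} \<times> {..<n}"
        from rematches_eq_moves_upto[OF n this, of ?m0]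
        have "card (exposed (greedy n E (rematches N ?m0))) \<in> ?R" by (auto simp: trial_eq)
        hence "card (exposed (greedy n E (rematches N ?m0))) \<le> Max ?R" using R(1) by (rule Max_ge[rotated])
        thus "card (exposed (greedy n E (rematches N ?m0))) \<le> j" using assms hl by simp
      qed
      then obtain N where N: "length N \<le> ?L" "set N \<subseteq> {..<n} \<times> {..<n}"
        and eq: "card (exposed (greedy n E (rematches N ?m0))) = card (exposed m)" by blast
      from rematches_eq_moves_upto[OF n N, of ?m0] obtain X where "X < (n * n) ^ ?L"
        "rematches N ?m0 = moves_upto n E X ?m0 ?L" by blast
      thus ?thesis using eq by (auto simp: trial_eq intro!: image_eqI[of _ _ X])
    qed
    have "Max ?R \<in> ?R" "Min ?R \<in> ?R" using R by auto
    hence "\<exists>m. maximal_mating m \<and> card (exposed m) = Max ?R" "\<exists>m. maximal_mating m \<and> card (exposed m) = Min ?R"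
      using trial_maximal[OF n] by (metis imageE)+
    thus ?thesis using all R(1) unfolding hl by auto
  qed
  thus "\<exists>m. maximal_mating m \<and> card (exposed m) = hi_trial n E (move_count j)"
    "\<exists>m. maximal_mating m \<and> card (exposed m) = lo_trial n E (move_count j)"
    "maximal_mating m \<Longrightarrow> card (exposed m) \<le> hi_trial n E (move_count j)"
    "maximal_mating m \<Longrightarrow> lo_trial n E (move_count j) \<le> card (exposed m)" by blast+
qed

end

section \<open>Matchings as involutions of an enumeration of the vertices\<close>

lemma finite_matchings:
  assumes "simple_graph G"
  shows "finite {M. matching G M}"
proof -
  have "snd G \<subseteq> Pow (fst G)" using assms by (auto simp: simple_graph_def)
  hence "finite (snd G)" using assms finite_subset unfolding simple_graph_def by (metis finite_Pow_iff)
  moreover have "{M. matching G M} \<subseteq> Pow (snd G)" by (auto simp: matching_def)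
  ultimately show ?thesis using finite_subset by auto
qed

text \<open>A maximum matching is maximal, so the matching number can be computed from maximal
  matchings alone.\<close>

lemma maximum_matching_maximal:
  assumes "simple_graph G"
  shows "\<exists>M. maximal_matching G M \<and> card M = matching_number G"
    and "matching G M \<Longrightarrow> card M \<le> matching_number G"
proof -
  note fin = finite_matchings[OF assms]
  have "matching G {}" by (simp add: matching_def)
  hence ne: "card ` {M. matching G M} \<noteq> {}" by auto
  show le: "matching G M \<Longrightarrow> card M \<le> matching_number G" for M
    unfolding matching_number_def using fin by auto
  have "matching_number G \<in> card ` {M. matching G M}"
    unfolding matching_number_def using fin ne by (intro Max_in) auto
  then obtain M where M: "matching G M" "card M = matching_number G" by auto
  have "M' = M" if "matching G M'" "M \<subseteq> M'" for M'
  proof -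
    have "finite (snd G)"
    proof -
      have "snd G \<subseteq> Pow (fst G)" "finite (fst G)" using assms by (auto simp: simple_graph_def)
      thus ?thesis using finite_subset by blast
    qed
    hence "finite M'" using that(1) finite_subset unfolding matching_def by blast
    thus ?thesis using le[OF that(1)] M(2) that(2) by (metis card_seteq)
  qed
  thus "\<exists>M. maximal_matching G M \<and> card M = matching_number G"
    using M unfolding maximal_matching_def by blast
qed

lemma min_maximal_matching:
  assumes "simple_graph G"
  shows "\<exists>M. maximal_matching G M \<and> card M = min_maximal_matching_number G"
    and "maximal_matching G M \<Longrightarrow> min_maximal_matching_number G \<le> card M"
proof -
  have fin: "finite {M. maximal_matching G M}"
    by (rule finite_subset[OF _ finite_matchings[OF assms]]) (auto simp: maximal_matching_def)
  have ne: "{M. maximal_matching G M} \<noteq> {}" using maximum_matching_maximal(1)[OF assms] by auto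
  show "maximal_matching G M \<Longrightarrow> min_maximal_matching_number G \<le> card M"
    unfolding min_maximal_matching_number_def using fin by auto
  have "min_maximal_matching_number G \<in> card ` {M. maximal_matching G M}"
    unfolding min_maximal_matching_number_def using fin ne by (intro Min_in) auto
  thus "\<exists>M. maximal_matching G M \<and> card M = min_maximal_matching_number G" by auto
qed

definition edge_code :: "'a graph \<Rightarrow> 'a list \<Rightarrow> nat \<Rightarrow> bool" where
  "edge_code G vs c \<longleftrightarrow> {vs ! (c div length vs), vs ! (c mod length vs)} \<in> snd G"

text \<open>An encoding of \<open>G\<close> enumerates its vertices; a vertex is identified with its position.\<close>

locale enumerated_graph =
  fixes G :: "'a graph" and vs :: "'a list"
  assumes simple: "simple_graph G" and distinct: "distinct vs" and set_vs: "set vs = fst G"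
begin

lemma edge_code_pair: "y < length vs \<Longrightarrow> edge_code G vs (x * length vs + y) \<longleftrightarrow> {vs ! x, vs ! y} \<in> snd G"
proof -
  assume y: "y < length vs"
  hence "(x * length vs + y) div length vs = x" "(x * length vs + y) mod length vs = y"
    by (auto simp: div_add1_eq)
  thus ?thesis by (simp add: edge_code_def)
qed

lemma edge_card: "e \<in> snd G \<Longrightarrow> card e = 2 \<and> e \<subseteq> fst G"
  using simple by (auto simp: simple_graph_def)

sublocale coded_graph "length vs" "edge_code G vs"
proof
  fix x y assume xy: "x < length vs" "y < length vs"
  show "edge_code G vs (y * length vs + x)" if "edge_code G vs (x * length vs + y)"
    using that xy by (simp add: edge_code_pair insert_commute)
next
  fix x assume x: "x < length vs"
  have "card {vs ! x, vs ! x} \<noteq> 2" by simp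
  thus "\<not> edge_code G vs (x * length vs + x)" using edge_card x by (metis edge_code_pair)
qed

abbreviation v :: "nat \<Rightarrow> 'a" where "v i \<equiv> vs ! i"
abbreviation n :: nat where "n \<equiv> length vs"

lemma v_eq: "i < n \<Longrightarrow> j < n \<Longrightarrow> v i = v j \<longleftrightarrow> i = j"
  using distinct by (simp add: nth_eq_iff_index_eq)

lemma adj_iff: "coded_adj n (edge_code G vs) x y \<longleftrightarrow> x < n \<and> y < n \<and> {v x, v y} \<in> snd G"
  unfolding coded_adj_def using edge_code_pair by blast

lemma edge_obtain:
  assumes "e \<in> snd G"
  obtains i j where "i < n" "j < n" "i \<noteq> j" "e = {v i, v j}"
proof -
  obtain a b where ab: "e = {a, b}" "a \<noteq> b" using edge_card[OF assms] by (meson card_2_iff)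
  have "a \<in> set vs" "b \<in> set vs" using edge_card[OF assms] ab set_vs by auto
  then obtain i j where "i < n" "j < n" "a = v i" "b = v j" by (metis in_set_conv_nth)
  thus ?thesis using that ab by auto
qed

definition edges_of :: "(nat \<Rightarrow> nat) \<Rightarrow> 'a set set" where
  "edges_of m = (\<lambda>i. {v i, v (m i)}) ` {i. i < n \<and> m i \<noteq> i}"

text \<open>Distinct edges are disjoint because an involution has only one value at each vertex.\<close>

lemma matching_edges_of:
  assumes "mating m"
  shows "matching G (edges_of m)"
  unfolding matching_def
proof
  show "edges_of m \<subseteq> snd G"
    using matingD(3)[OF assms] by (auto simp: edges_of_def adj_iff)
  show "pairwise disjnt (edges_of m)"
  proof (rule pairwiseI)
    fix e f assume "e \<in> edges_of m" "f \<in> edges_of m" and ne: "e \<noteq> f"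
    then obtain i j where ij: "i < n" "j < n" "e = {v i, v (m i)}" "f = {v j, v (m j)}"
      by (auto simp: edges_of_def)
    have m: "m i < n" "m j < n" "m (m i) = i" "m (m j) = j"
      using matingD(1,2)[OF assms, of i] matingD(1,2)[OF assms, of j] ij by auto
    have "i \<noteq> j" using ne ij by blast
    moreover have "i \<noteq> m j" "m i \<noteq> j" using ne ij m by (metis insert_commute)+
    moreover have "m i \<noteq> m j" using m \<open>i \<noteq> j\<close> by metis
    ultimately have "v i \<noteq> v j" "v i \<noteq> v (m j)" "v (m i) \<noteq> v j" "v (m i) \<noteq> v (m j)"
      using v_eq ij(1,2) m(1,2) by blast+
    thus "disjnt e f" unfolding ij(3,4) by (simp add: disjnt_def)
  qed
qed

text \<open>The edges partition the vertices that are not exposed into pairs.\<close>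

lemma card_edges_of:
  assumes "mating m"
  shows "2 * card (edges_of m) + card (exposed m) = n"
proof -
  have "matching G (edges_of m)" using matching_edges_of[OF assms] .
  hence M: "edges_of m \<subseteq> snd G" "pairwise disjnt (edges_of m)" by (auto simp: matching_def)
  have c2: "card e = 2" if "e \<in> edges_of m" for e using edge_card M(1) that by blast
  have "card (\<Union> (edges_of m)) = (\<Sum>e\<in>edges_of m. card e)"
    by (rule card_Union_disjoint[OF M(2)]) (use c2 card.infinite in fastforce)
  also have "\<dots> = 2 * card (edges_of m)" using c2 by simp
  finally have "card (\<Union> (edges_of m)) = 2 * card (edges_of m)" .
  moreover have "\<Union> (edges_of m) = v ` {i. i < n \<and> m i \<noteq> i}"
  proof -
    have "v (m i) \<in> v ` {i. i < n \<and> m i \<noteq> i}" if "i < n" "m i \<noteq> i" for i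
      using matingD(1,2)[OF assms, of i] that by auto
    thus ?thesis by (auto simp: edges_of_def)
  qed
  moreover have "card (v ` {i. i < n \<and> m i \<noteq> i}) = card {i. i < n \<and> m i \<noteq> i}"
    by (rule card_image) (auto simp: inj_on_def v_eq)
  moreover have "card {i. i < n \<and> m i \<noteq> i} + card (exposed m) = card {..<n}"
  proof -
    have un: "{..<n} = {i. i < n \<and> m i \<noteq> i} \<union> exposed m" by (auto simp: exposed_def)
    have dj: "{i. i < n \<and> m i \<noteq> i} \<inter> exposed m = {}" by (auto simp: exposed_def)
    have fin: "finite {i. i < n \<and> m i \<noteq> i}" "finite (exposed m)" by (auto simp: exposed_def)
    show ?thesis by (rule trans[OF card_Un_disjoint[OF fin dj, symmetric] arg_cong[OF un[symmetric], of card]])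
  qed
  ultimately show ?thesis by simp
qed

text \<open>An edge of a larger matching that is not in the given one has both ends exposed.\<close>

lemma maximal_edges_of:
  assumes m: "maximal_mating m"
  shows "maximal_matching G (edges_of m)"
  unfolding maximal_matching_def
proof (intro conjI allI impI)
  have mat: "mating m" using m by (simp add: maximal_mating_def)
  show "matching G (edges_of m)" using matching_edges_of[OF mat] .
  fix M' assume M': "matching G M' \<and> edges_of m \<subseteq> M'"
  have "e \<in> edges_of m" if e: "e \<in> M'" for e
  proof (rule ccontr)
    assume ne: "e \<notin> edges_of m"
    have "e \<in> snd G" using M' e by (auto simp: matching_def)
    then obtain i j where ij: "i < n" "j < n" "e = {v i, v j}" by (rule edge_obtain)
    have exp: "x \<in> exposed m" if "x < n" "v x \<in> e" for x
    proof (rule ccontr)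
      assume "x \<notin> exposed m"
      hence "{v x, v (m x)} \<in> edges_of m" using that by (auto simp: exposed_def edges_of_def)
      hence "disjnt e {v x, v (m x)}"
        using M' e ne unfolding matching_def pairwise_def by (metis subsetD)
      thus False using that by (auto simp: disjnt_def)
    qed
    have "coded_adj n (edge_code G vs) i j" using ij \<open>e \<in> snd G\<close> by (simp add: adj_iff)
    thus False using m exp[of i] exp[of j] ij by (auto simp: maximal_mating_def)
  qed
  thus "M' = edges_of m" using M' by auto
qed

text \<open>The partner of a vertex is unique since the edges are disjoint. An edge between
  exposed vertices could be added to \<open>M\<close>.\<close>

lemma mating_of_maximal_matching:
  assumes M: "maximal_matching G M"
  shows "\<exists>m. maximal_mating m \<and> edges_of m = M"
proof -
  have mat: "M \<subseteq> snd G" "pairwise disjnt M" using M by (auto simp: maximal_matching_def matching_def)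
  have uniq: "e = f" if "e \<in> M" "f \<in> M" "x \<in> e" "x \<in> f" for e f x
    using mat(2) that by (auto simp: pairwise_def disjnt_def)
  define m where "m i = (if \<exists>j<n. {v i, v j} \<in> M then (THE j. j < n \<and> {v i, v j} \<in> M) else i)" for i
  have ne: "i \<noteq> j" if "{v i, v j} \<in> M" for i j using edge_card[of "{v i, v j}"] mat(1) that by auto
  have m1: "m i = j" if "i < n" "j < n" "{v i, v j} \<in> M" for i j
  proof -
    have "j' = j" if "j' < n" "{v i, v j'} \<in> M" for j'
    proof -
      have "{v i, v j'} = {v i, v j}" using uniq[OF that(2) \<open>{v i, v j} \<in> M\<close>, of "v i"] by simp
      hence "v j' = v j" by (auto simp: doubleton_eq_iff)
      thus ?thesis using v_eq that(1) \<open>j < n\<close> by simp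
    qed
    hence "(THE j. j < n \<and> {v i, v j} \<in> M) = j" using that(2,3) by (intro the_equality) blast+
    moreover have "\<exists>j<n. {v i, v j} \<in> M" using that(2,3) by blast
    ultimately show ?thesis by (simp only: m_def if_True)
  qed
  have m2: "m i < n \<and> {v i, v (m i)} \<in> M" if i: "i < n" "m i \<noteq> i" for i
  proof -
    obtain j where "j < n" "{v i, v j} \<in> M" using i(2) unfolding m_def by meson
    thus ?thesis using m1[OF i(1)] by metis
  qed
  have mating: "mating m"
    unfolding mating_def
  proof
    fix x assume "x \<in> {..<n}"
    hence x: "x < n" by simp
    show "m x \<in> {..<n} \<and> m (m x) = x \<and> (m x = x \<or> coded_adj n (edge_code G vs) x (m x))"
    proof (cases "m x = x")
      case False
      note f = m2[OF x False]
      have "m (m x) = x" using m1[of "m x" x] f x by (simp add: insert_commute)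
      thus ?thesis using f x mat(1) by (auto simp: adj_iff)
    qed (use x in simp)
  qed
  have eq: "edges_of m = M"
  proof
    show "edges_of m \<subseteq> M" using m2 by (auto simp: edges_of_def)
    show "M \<subseteq> edges_of m"
    proof
      fix e assume e: "e \<in> M"
      then obtain i j where ij: "i < n" "j < n" "i \<noteq> j" "e = {v i, v j}"
        using edge_obtain mat(1) by (metis subsetD)
      hence "m i = j" using m1 e by simp
      thus "e \<in> edges_of m" using ij by (auto simp: edges_of_def)
    qed
  qed
  have "\<not> coded_adj n (edge_code G vs) x y" if "x \<in> exposed m" "y \<in> exposed m" for x y
  proof
    assume "coded_adj n (edge_code G vs) x y"
    hence xy: "x < n" "y < n" "{v x, v y} \<in> snd G" by (auto simp: adj_iff)
    let ?M = "insert {v x, v y} M"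
    have free: "v z \<notin> e" if e: "e \<in> M" and ze: "z \<in> exposed m" for e z
    proof
      assume z: "v z \<in> e"
      have zn: "z < n" "m z = z" using ze by (auto simp: exposed_def)
      obtain i j where ij: "i < n" "j < n" "i \<noteq> j" "e = {v i, v j}"
        using edge_obtain[OF subsetD[OF mat(1) e]] .
      have "m i = j" "m j = i" using m1[of i j] m1[of j i] ij e by (simp_all add: insert_commute)
      moreover have "z = i \<or> z = j" using z ij v_eq zn(1) by auto
      ultimately show False using zn ij by auto
    qed
    have "matching G ?M"
      unfolding matching_def pairwise_insert using mat xy(3) free that by (auto simp: disjnt_def)
    hence "?M = M" using M unfolding maximal_matching_def by blast
    hence "m x = y" using m1[of x y] xy by auto
    thus False using that ne[of x y] \<open>?M = M\<close> by (auto simp: exposed_def)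
  qed
  hence "maximal_mating m" using mating by (simp add: maximal_mating_def)
  thus ?thesis using eq by blast
qed

lemma min_maximal_matching_number_exposed:
  assumes hi: "\<exists>m. maximal_mating m \<and> card (exposed m) = hi" "\<And>m. maximal_mating m \<Longrightarrow> card (exposed m) \<le> hi"
  shows "2 * min_maximal_matching_number G + hi = n"
proof -
  obtain M where M: "maximal_matching G M" "card M = min_maximal_matching_number G"
    using min_maximal_matching(1)[OF simple] by blast
  obtain m where m: "maximal_mating m" "edges_of m = M" using mating_of_maximal_matching[OF M(1)] by blast
  obtain m' where m': "maximal_mating m'" "card (exposed m') = hi" using hi(1) by blast
  have "2 * card M + card (exposed m) = n" using card_edges_of[of m] m by (simp add: maximal_mating_def)
  moreover have "2 * card (edges_of m') + hi = n" using card_edges_of[of m'] m' by (simp add: maximal_mating_def)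
  moreover have "card M \<le> card (edges_of m')"
    using min_maximal_matching(2)[OF simple maximal_edges_of[OF m'(1)]] M(2) by simp
  moreover have "card (exposed m) \<le> hi" using hi(2)[OF m(1)] .
  ultimately show ?thesis using M(2) by linarith
qed

lemma matching_number_exposed:
  assumes lo: "\<exists>m. maximal_mating m \<and> card (exposed m) = lo" "\<And>m. maximal_mating m \<Longrightarrow> lo \<le> card (exposed m)"
  shows "2 * matching_number G + lo = n"
proof -
  obtain M where M: "maximal_matching G M" "card M = matching_number G"
    using maximum_matching_maximal(1)[OF simple] by blast
  obtain m where m: "maximal_mating m" "edges_of m = M" using mating_of_maximal_matching[OF M(1)] by blast
  obtain m' where m': "maximal_mating m'" "card (exposed m') = lo" using lo(1) by blast
  have "2 * card M + card (exposed m) = n" using card_edges_of[of m] m by (simp add: maximal_mating_def)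
  moreover have "2 * card (edges_of m') + lo = n" using card_edges_of[of m'] m' by (simp add: maximal_mating_def)
  moreover have "card (edges_of m') \<le> card M"
    using maximum_matching_maximal(2)[OF simple, of "edges_of m'"] maximal_edges_of[OF m'(1)] M(2)
    by (simp add: maximal_matching_def)
  moreover have "lo \<le> card (exposed m)" using lo(2)[OF m(1)] .
  ultimately show ?thesis using M(2) by linarith
qed

text \<open>The greatest number of exposed vertices is twice the parameter.\<close>

lemma max_exposed_exists:
  "\<exists>m. maximal_mating m \<and> 2 * min_maximal_matching_number G + card (exposed m) = n"
  "maximal_mating m \<Longrightarrow> 2 * min_maximal_matching_number G + card (exposed m) \<le> n"
proof -
  obtain M where M: "maximal_matching G M" "card M = min_maximal_matching_number G"
    using min_maximal_matching(1)[OF simple] by blast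
  obtain m where m: "maximal_mating m" "edges_of m = M" using mating_of_maximal_matching[OF M(1)] by blast
  have "2 * card M + card (exposed m) = n" using card_edges_of[of m] m by (simp add: maximal_mating_def)
  thus "\<exists>m. maximal_mating m \<and> 2 * min_maximal_matching_number G + card (exposed m) = n"
    using m M by auto
  show "2 * min_maximal_matching_number G + card (exposed m) \<le> n" if "maximal_mating m" for m
    using min_maximal_matching(2)[OF simple maximal_edges_of[OF that]] card_edges_of[of m] that
    by (simp add: maximal_mating_def)
qed

end

section \<open>The polynomial time bound and the theorem\<close>

lemma encoding_nth:
  fixes f :: "'a \<Rightarrow> 'a \<Rightarrow> nat" and vs :: "'a list" and k :: nat
  defines "w \<equiv> [length vs, k] @ concat (map (\<lambda>u. map (\<lambda>v. f u v) vs) vs)"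
  shows "length w = length vs * length vs + 2"
    and "c < length vs * length vs \<Longrightarrow> w ! (c + 2) = f (vs ! (c div length vs)) (vs ! (c mod length vs))"
proof -
  have *: "concat (map (\<lambda>u. map (\<lambda>v. f u v) vs) us) = map (\<lambda>(u, v). f u v) (List.product us vs)" for us
    by (induction us) auto
  show "length w = length vs * length vs + 2" by (simp add: w_def * length_product)
  show "w ! (c + 2) = f (vs ! (c div length vs)) (vs ! (c mod length vs))"
    if "c < length vs * length vs"
    using that by (simp add: w_def * product_nth length_product)
qed

lemma length_le_input_size: "length w \<le> input_size w"
proof (induction w)
  case (Cons x w)
  thus ?case using bit_length_ge_1[of x] by (simp add: input_size_def)
qed (simp add: input_size_def)

lemma bit_length_le_input_size: "i < length w \<Longrightarrow> bit_length (w ! i) \<le> input_size w"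
  unfolding input_size_def by (intro member_le_sum_list) simp_all

text \<open>In terms of the size \<open>X\<close> of the input: the steps of a phase are at most
  \<open>X ^ L * (44 * X + 14 * L + 20) + 3 * L + 7\<close>, there are at most \<open>d + 1\<close> phases, and a step costs at most
  \<open>600 * ((L + 5) * X + C + 2)\<close>, where \<open>C\<close> collects the constants that depend on \<open>d\<close> only.\<close>

definition time_bound :: "nat \<Rightarrow> nat poly" where
  "time_bound d = (let L = move_count d; C = bit_length (L + moves_factor + d + 4); X = [:0, 1:] in
     ([:d + 1:] * (X ^ L * [:14 * L + 20, 44:] + [:3 * L + 12:]) + [:8:]) * ([:600:] * [:C + 2, L + 5:]))"

text \<open>The numbers \<open>n\<close> and \<open>n * n\<close> are at most \<open>z\<close>, and \<open>(n * n) ^ L\<close> has at most \<open>(L + 1) * z\<close> bits.\<close>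

lemma time_bound_correct:
  assumes n: "n * n + 2 \<le> z" and k: "bit_length k \<le> z"
    and L: "L = move_count d" and B: "B = (n * n) ^ L + (L + moves_factor + d + 4) + n * n + n + 2 * k"
  shows "((d + 1) * (phase_time n L + 5) + 8) * step_cost B \<le> poly (time_bound d) z"
proof -
  have nz: "n \<le> z" "n * n \<le> z"
  proof -
    have "n \<le> n * n" by (cases n) auto
    thus "n \<le> z" "n * n \<le> z" using n by linarith+
  qed
  define C where "C = bit_length (L + moves_factor + d + 4)"
  have z1: "1 \<le> z" using n by simp
  have bz: "bit_length x \<le> z" if "x \<le> z" for x
    using bit_length_mono[OF that] bit_length_le_self[OF z1] by linarith
  have "bit_length ((n * n) ^ L) \<le> Suc L * z"
    using bit_length_power[of "n * n" L] mult_le_mono2[OF bz[OF nz(2)], of "Suc L"] by linarith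
  moreover have "bit_length (2 * k) \<le> 2 + z"
    using bit_length_mult[of 2 k] bit_length_le_self[of 2] k by simp
  moreover have "bit_length B \<le> bit_length ((n * n) ^ L) + C + bit_length (n * n) + bit_length n + bit_length (2 * k)"
    unfolding B C_def by (meson add_le_mono1 bit_length_add order_trans)
  ultimately have "bit_length B \<le> Suc L * z + C + z + z + (2 + z)"
    using bz[OF nz(1)] bz[OF nz(2)] by linarith
  also have "\<dots> \<le> (C + 2) + z * (L + 5)" by (simp add: algebra_simps)
  finally have step: "step_cost B \<le> 600 * ((C + 2) + z * (L + 5))" by (simp add: step_cost_def)
  have "try_time n L + 2 \<le> (14 * L + 20) + z * 44" using nz by (simp add: try_time_def)
  hence "(n * n) ^ L * (try_time n L + 2) \<le> z ^ L * ((14 * L + 20) + z * 44)"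
    using nz by (intro mult_mono power_mono) auto
  hence "phase_time n L + 5 \<le> z ^ L * ((14 * L + 20) + z * 44) + (3 * L + 12)"
    by (simp add: phase_time_def)
  hence "(d + 1) * (phase_time n L + 5) + 8 \<le> (d + 1) * (z ^ L * ((14 * L + 20) + z * 44) + (3 * L + 12)) + 8"
    by (intro add_right_mono mult_left_mono) auto
  hence "((d + 1) * (phase_time n L + 5) + 8) * step_cost B
     \<le> ((d + 1) * (z ^ L * ((14 * L + 20) + z * 44) + (3 * L + 12)) + 8) * (600 * ((C + 2) + z * (L + 5)))"
    using step by (rule mult_mono) auto
  also have "\<dots> = poly (time_bound d) z"
    unfolding time_bound_def Let_def L[symmetric] C_def[symmetric]
    by (simp only: poly_add poly_mult poly_power poly_pCons poly_0 mult_zero_right add_0_right add_0_left mult_1_right)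
  finally show ?thesis .
qed

lemma gap_prog_correct:
  assumes G: "simple_graph G" and vs: "distinct vs" "set vs = fst G"
    and w: "w = [length vs, k] @ concat (map (\<lambda>u. map (\<lambda>v. if {u, v} \<in> snd G then 1 else 0) vs) vs)"
    and d: "length vs = 2 * min_maximal_matching_number G + d"
  shows "\<exists>t \<le> poly (time_bound d) (input_size w). answers_in_time gap_prog w (matching_gap G \<ge> int k) t"
proof -
  interpret enumerated_graph G vs using G vs by unfold_locales
  let ?L = "move_count d"
  define B where "B = (n * n) ^ ?L + (?L + moves_factor + d + 4) + n * n + n + 2 * k"
  interpret gap_machine n k "edge_code G vs" B by unfold_locales (auto simp: B_def)
  note enc = encoding_nth[where vs = vs and k = k and f = "\<lambda>u v. if {u, v} \<in> snd G then 1 else 0", folded w]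
  have hi: "hi_trial n (edge_code G vs) L \<le> d" for L
    by (rule hi_trial_le_bound) (use max_exposed_exists(2) d in fastforce)
  have cells: "w ! 0 = n" "w ! 1 = k" by (simp_all add: w)
  have code: "w ! (c + 2) = (if edge_code G vs c then 1 else 0)" if "c < n * n" for c
    using enc(2)[OF that] by (simp add: edge_code_def)
  have le1: "x \<le> 1" if "x \<in> set (concat (map (\<lambda>u. map (\<lambda>v. if {u, v} \<in> snd G then 1 else 0) vs) vs))" for x :: nat
    using that by (auto split: if_splits)
  have "x \<le> B" if "x \<in> set w" for x
  proof -
    have "x = n \<or> x = k \<or> x \<le> 1" using that le1[of x] unfolding w by auto
    thus ?thesis by (auto simp: B_def)
  qed
  hence bounded: "bounded_state B (init_state w)" by (auto simp: bounded_state_def init_state_def)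
  have "runs B gap_prog (init_state w) ((d + 1) * (phase_time n ?L + 5) + 8)
     (\<lambda>s'. \<exists>j\<le>d. hi_trial n (edge_code G vs) (move_count j) \<le> j \<and>
       (fst s' 0 \<noteq> 0 \<longleftrightarrow> lo_trial n (edge_code G vs) (move_count j) + 2 * k
         \<le> hi_trial n (edge_code G vs) (move_count j)))"
  proof (rule runs_gap_prog[OF hi])
    show "snd (init_state w) 0 = n" "snd (init_state w) 1 = k" using enc(1) cells by (simp_all add: init_state_def)
    show "snd (init_state w) (c + 2) = (if edge_code G vs c then 1 else 0)" if "c < n * n" for c
      using code[OF that] that enc(1) by (simp add: init_state_def)
  qed (simp_all add: B_def)
  then obtain t s' j where t: "exec gap_prog (init_state w) t s'"
      "t \<le> ((d + 1) * (phase_time n ?L + 5) + 8) * step_cost B"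
    and j: "hi_trial n (edge_code G vs) (move_count j) \<le> j"
    and ans: "fst s' 0 \<noteq> 0 \<longleftrightarrow> lo_trial n (edge_code G vs) (move_count j) + 2 * k
         \<le> hi_trial n (edge_code G vs) (move_count j)"
    using bounded unfolding runs_def by blast
  have "2 * min_maximal_matching_number G + hi_trial n (edge_code G vs) (move_count j) = n"
    "2 * matching_number G + lo_trial n (edge_code G vs) (move_count j) = n"
    using hi_lo_trial_correct[OF j] min_maximal_matching_number_exposed matching_number_exposed by blast+
  hence "matching_gap G \<ge> int k \<longleftrightarrow> fst s' 0 \<noteq> 0"
    unfolding ans matching_gap_def by linarith
  hence "answers_in_time gap_prog w (matching_gap G \<ge> int k) t"
    unfolding answers_in_time_def using t(1) by blast
  moreover have "bit_length k \<le> input_size w" using bit_length_le_input_size[of 1 w] enc(1) cells by simp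
  hence "t \<le> poly (time_bound d) (input_size w)"
    using t(2) time_bound_correct[of n "input_size w" k ?L d B] length_le_input_size[of w] enc(1) B_def
    by simp
  ultimately show ?thesis by blast
qed

theorem theorem2p10:
  "\<exists>A. xp_algorithm A (matching_gap_instances :: (nat graph \<times> nat) set)
         matching_gap_encodings matching_gap_yes matching_gap_param"
proof
  show "xp_algorithm gap_prog (matching_gap_instances :: (nat graph \<times> nat) set)
         matching_gap_encodings matching_gap_yes matching_gap_param"
    unfolding xp_algorithm_def
  proof
    fix p :: real
    show "\<exists>q. \<forall>x\<in>matching_gap_instances :: (nat graph \<times> nat) set. matching_gap_param x = p \<longrightarrow>
        (\<forall>w\<in>matching_gap_encodings x. \<exists>t\<le>poly q (input_size w). answers_in_time gap_prog w (matching_gap_yes x) t)"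
    proof (intro exI[of _ "time_bound (nat \<lfloor>2 * p\<rfloor>)"] ballI impI)
      fix x :: "nat graph \<times> nat" and w
      assume x: "x \<in> matching_gap_instances" and p: "matching_gap_param x = p" and w: "w \<in> matching_gap_encodings x"
      let ?d = "nat \<lfloor>2 * p\<rfloor>"
      obtain G k where x_def: "x = (G, k)" by (cases x)
      have G: "simple_graph G" using x by (simp add: matching_gap_instances_def x_def)
      obtain vs where vs: "distinct vs" "set vs = fst G"
        and w_def: "w = [length vs, k] @ concat (map (\<lambda>u. map (\<lambda>v. if {u, v} \<in> snd G then 1 else 0) vs) vs)"
        using w by (auto simp: matching_gap_encodings_def x_def)
      interpret enumerated_graph G vs using G vs by unfold_locales
      obtain e where e: "2 * min_maximal_matching_number G + e = length vs" using max_exposed_exists(1) by blast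
      have "2 * p = real (length vs) - 2 * real (min_maximal_matching_number G)"
        using p distinct_card[OF vs(1)] vs(2) by (simp add: matching_gap_param_def x_def)
      also have "\<dots> = real e" using e by linarith
      finally have "?d = e" by simp
      thus "\<exists>t\<le>poly (time_bound ?d) (input_size w). answers_in_time gap_prog w (matching_gap_yes x) t"
        using gap_prog_correct[OF G vs w_def, of ?d] e by (simp add: matching_gap_yes_def x_def)
    qed
  qed
qed

end
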